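(* Let $D$ be a division ring with center $F$ such that $D$ is finite-dimensional over $F$. If $w(x_1,\ldots,x_n)$ is a non-trivial word, then there exist elements $c_1,\ldots,c_n\in D\setminus\{0\}$ such that $F(w(c_1,\ldots,c_n))$ is a maximal subfield of $D$.
   Context: A word $w(x_1,\dots,x_n)=x_{i_1}^{n_1}x_{i_2}^{n_2}\cdots x_{i_t}^{n_t}$ (with $1\le i_j\le n$, $n_j\in\mathbb{Z}$) is an element of the free group on the noncommuting indeterminates $x_1,\dots,x_n$; it is non-trivial if it is not the identity element of this free group. For $c_1,\dots,c_n\in D\setminus\{0\}$, $w(c_1,\dots,c_n)$ is the element obtained by substituting $c_i$ for $x_i$. For $a\in D$, $F(a)$ denotes the subfield of $D$ generated by $a$ over $F$. A subfield of $D$ is maximal if it is not properly contained in any other subfield of $D$ (subfields are commutative). *)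

theory Defs
  imports "HOL-Algebra.Algebra"
begin

section \<open>Division rings, centers, maximal subfields\<close>

text \<open>The equation also forces \<open>\<one> \<noteq> \<zero>\<close>: in the zero ring \<open>\<zero>\<close> is a unit.\<close>

locale skew_field = ring R for R (structure) +
  assumes nonzero_Units: "Units R = carrier R - {\<zero>}"

definition ring_center :: "('a, 'b) ring_scheme \<Rightarrow> 'a set" where
  "ring_center R = {z \<in> carrier R. \<forall>x \<in> carrier R. z \<otimes>\<^bsub>R\<^esub> x = x \<otimes>\<^bsub>R\<^esub> z}"

text \<open>The library predicate \<^const>\<open>subfield\<close> includes commutativity, so the ambient ring need
  not be commutative.\<close>

definition maximal_subfield :: "'a set \<Rightarrow> ('a, 'b) ring_scheme \<Rightarrow> bool" where
  "maximal_subfield K R \<longleftrightarrow> subfield K R \<and> (\<forall>L. subfield L R \<and> K \<subseteq> L \<longrightarrow> L = K)"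

definition simple_extension_field :: "('a, 'b) ring_scheme \<Rightarrow> 'a set \<Rightarrow> 'a \<Rightarrow> 'a set" where
  "simple_extension_field R F a = generate_field R (insert a F)"


section \<open>Words\<close>

text \<open>The list \<open>[(i\<^sub>1, n\<^sub>1), \<dots>, (i\<^sub>t, n\<^sub>t)]\<close> is the expression \<open>x_{i_1}^{n_1} \<dots> x_{i_t}^{n_t}\<close>.\<close>

type_synonym gword = "(nat \<times> int) list"

definition words :: "nat \<Rightarrow> gword set" where
  "words n = {w. fst ` set w \<subseteq> {1..n}}"

text \<open>The least congruence for concatenation under which \<open>k \<mapsto> x_i^k\<close> is a homomorphism from
  the additive group of integers, for each \<open>i\<close>. Two expressions are congruent iff they denote the
  same element of the free group. The indices are not bounded by \<open>n\<close> here, which makes no difference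
  because the free group on \<open>x_1, \<dots>, x_n\<close> embeds in the free group on all \<open>x_i\<close>.\<close>

inductive word_eq :: "gword \<Rightarrow> gword \<Rightarrow> bool" where
  refl: "word_eq u u"
| sym: "word_eq u v \<Longrightarrow> word_eq v u"
| trans: "word_eq u v \<Longrightarrow> word_eq v w \<Longrightarrow> word_eq u w"
| append: "word_eq u u' \<Longrightarrow> word_eq v v' \<Longrightarrow> word_eq (u @ v) (u' @ v')"
| zero: "word_eq [(i, 0)] []"
| add: "word_eq [(i, k), (i, l)] [(i, k + l)]"

definition nontrivial_word :: "gword \<Rightarrow> bool" where
  "nontrivial_word w \<longleftrightarrow> \<not> word_eq w []"

definition word_eval :: "('a, 'b) monoid_scheme \<Rightarrow> (nat \<Rightarrow> 'a) \<Rightarrow> gword \<Rightarrow> 'a" where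
  "word_eval G c w = foldr (\<lambda>(i, k) y. c i [^]\<^bsub>G\<^esub> k \<otimes>\<^bsub>G\<^esub> y) w \<one>\<^bsub>G\<^esub>"

text \<open>Evaluation at units depends only on the element of the free group.\<close>

lemma (in group) word_eval_closed:
  assumes "range c \<subseteq> carrier G" shows "word_eval G c w \<in> carrier G"
  using assms by (induction w) (auto simp: word_eval_def image_subset_iff)

lemma (in group) word_eval_append:
  assumes "range c \<subseteq> carrier G"
  shows "word_eval G c (u @ v) = word_eval G c u \<otimes> word_eval G c v"
proof (induction u)
  case Nil
  then show ?case using word_eval_closed[OF assms, of v] by (simp add: word_eval_def)
next
  case (Cons p u)
  obtain i k where p: "p = (i, k)" by fastforce
  have step: "word_eval G c (p # w) = c i [^] k \<otimes> word_eval G c w" for w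
    by (simp add: word_eval_def p)
  have "c i \<in> carrier G" using assms by auto
  then show ?case
    using word_eval_closed[OF assms] by (simp add: step Cons m_assoc)
qed

lemma (in group) word_eval_cong:
  assumes "word_eq u v" "range c \<subseteq> carrier G"
  shows "word_eval G c u = word_eval G c v"
  using assms
proof (induction rule: word_eq.induct)
  case (append u u' v v')
  then show ?case by (simp add: word_eval_append)
next
  case (add i k l)
  then have "c i \<in> carrier G" by auto
  then show ?case by (simp add: word_eval_def int_pow_mult)
qed (auto simp: word_eval_def)

lemma (in monoid) word_eval_units_of:
  assumes "range c \<subseteq> Units G"
  shows "word_eval (units_of G) c w = word_eval G c w"
proof -
  interpret U: group "units_of G" by (rule units_group)
  have pow: "x [^]\<^bsub>units_of G\<^esub> (n::nat) = x [^]\<^bsub>G\<^esub> n" for x n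
    by (induction n) (simp_all add: units_of_one units_of_mult)
  have ipow: "c i [^]\<^bsub>units_of G\<^esub> (k::int) = c i [^]\<^bsub>G\<^esub> k" for i k
  proof -
    have "c i [^]\<^bsub>units_of G\<^esub> (n::nat) \<in> Units G" for n
      using assms U.nat_pow_closed[of "c i" n] by (auto simp: units_of_carrier)
    then have "inv\<^bsub>units_of G\<^esub> (c i [^]\<^bsub>G\<^esub> (n::nat)) = inv\<^bsub>G\<^esub> (c i [^]\<^bsub>G\<^esub> n)" for n
      using units_of_inv by (simp add: pow)
    then show ?thesis unfolding int_pow_def2 pow by (simp only:)
  qed
  show ?thesis
    by (induction w) (auto simp: word_eval_def units_of_one units_of_mult ipow)
qed

lemma (in monoid) word_eval_Units_cong:
  assumes "word_eq u v" "range c \<subseteq> Units G"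
  shows "word_eval G c u = word_eval G c v"
  using group.word_eval_cong[OF units_group assms(1), of c] assms(2)
  by (simp add: units_of_carrier word_eval_units_of)

end

theory Submission
  imports Defs
begin

text \<open>
  Let \<open>K\<close> be a maximal commutative subset of the division ring \<open>D\<close>, and let \<open>E\<close> be the ring of
  endomorphisms of \<open>D\<close> as a left vector space over \<open>K\<close>. Right multiplication embeds \<open>D\<close> into
  \<open>E\<close>, and by Jacobson density a family that spans \<open>D\<close> over the center \<open>F\<close> spans \<open>E\<close> over \<open>K\<close>
  (\<open>endos_span_rmul\<close>). So \<open>E\<close> is a matrix ring over \<open>K\<close>, and the elements of \<open>D\<close> are the members
  of \<open>E\<close> whose coordinates lie in \<open>F\<close> rather than in \<open>K\<close>.

  A field \<open>F(x)\<close> is a maximal subfield as soon as \<open>D = K v F(x)\<close> for a single vector \<open>v\<close>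
  (\<open>maximal_subfield_if_bispan\<close>), that is, as soon as right multiplication by \<open>x\<close> has a cyclic
  vector in this sense. This is a condition on an element \<open>T\<close> of \<open>E\<close>: some expression
  \<open>\<Sum> y \<phi> T^k\<close>, where the operators \<open>\<phi>\<close> have image in the line \<open>K v\<close>, is invertible.

  Suppose that \<open>F\<close> is infinite. Then it suffices to find units of \<open>E\<close> at which the word takes a
  value \<open>T\<close> with this property. Indeed, the invertibility of an expression that is rational in a
  coordinate persists for all but finitely many values of that coordinate, so the coordinates of
  these units can be moved from \<open>K\<close> into \<open>F\<close> one after the other (\<open>laurent_word_transfer\<close>). The
  units are found among the block diagonal matrices with blocks in the special linear group of
  degree two. On each block, \<open>T\<close> plus its inverse is the scalar given by the trace of \<open>T\<close>.
  Traces of a nontrivial word on that group avoid any given finite set (\<open>word_trace_avoids\<close>): at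
  matrices with eigenvalues \<open>r\<close> and \<open>1 / r\<close> and eigenlines in general position the trace of a
  cyclically reduced word has a pole at \<open>r = 0\<close>, by a ping-pong argument. So the scalars can be
  made distinct, and the sum of cyclic vectors for the blocks is then cyclic for \<open>T\<close>
  (\<open>exists_cyclic_word\<close>).

  If \<open>F\<close> is finite, then \<open>D\<close> is finite, hence commutative (\<open>finite_skew_field_commutative\<close>), and
  \<open>D\<close> itself is the field generated by any of its elements over \<open>F\<close>. Wedderburn's theorem used
  here is obtained from the same description of \<open>E\<close> by counting its elements in two ways.
\<close>

section \<open>Germs of rational functions\<close>

text \<open>A punctured cofinite neighbourhood together with its center: the condition at \<open>t0\<close> itself lets
  values and invertibility be read off there, the cofinite part lets the parameter be moved.\<close>

definition near :: "'a set \<Rightarrow> 'a \<Rightarrow> ('a \<Rightarrow> bool) \<Rightarrow> bool" where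
  "near Z t0 P \<longleftrightarrow> P t0 \<and> finite {t \<in> Z. \<not> P t}"

lemma near_always: "t0 \<in> Z \<Longrightarrow> (\<And>t. t \<in> Z \<Longrightarrow> P t) \<Longrightarrow> near Z t0 P"
  unfolding near_def by (metis (mono_tags, lifting) empty_Collect_eq finite.emptyI)

lemma near_mp:
  assumes "near Z t0 P" "t0 \<in> Z" "\<And>t. t \<in> Z \<Longrightarrow> P t \<Longrightarrow> Q t" shows "near Z t0 Q"
proof -
  have "{t \<in> Z. \<not> Q t} \<subseteq> {t \<in> Z. \<not> P t}" using assms(3) by auto
  then show ?thesis using assms unfolding near_def by (auto intro: finite_subset)
qed

lemma near_conj:
  assumes "near Z t0 P" "near Z t0 Q" shows "near Z t0 (\<lambda>t. P t \<and> Q t)"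
proof -
  have "{t \<in> Z. \<not> (P t \<and> Q t)} = {t \<in> Z. \<not> P t} \<union> {t \<in> Z. \<not> Q t}" by auto
  then show ?thesis using assms unfolding near_def by auto
qed

lemma near_ball:
  assumes "finite I" "t0 \<in> Z" "\<And>i. i \<in> I \<Longrightarrow> near Z t0 (P i)"
  shows "near Z t0 (\<lambda>t. \<forall>i\<in>I. P i t)"
  using assms(1,3)
proof (induction I)
  case empty
  then show ?case using assms(2) by (auto intro: near_always)
next
  case (insert i I)
  have "near Z t0 (\<lambda>t. P i t \<and> (\<forall>i\<in>I. P i t))" using insert by (intro near_conj) auto
  then show ?case by (rule near_mp[OF _ assms(2)]) auto
qed

lemma near_infinite:
  assumes "near Z t0 P" "Y \<subseteq> Z" "infinite Y" obtains t where "t \<in> Y" "P t"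
proof -
  have "\<not> Y \<subseteq> {t \<in> Z. \<not> P t}" using assms unfolding near_def by (meson finite_subset)
  then show ?thesis using that assms(2) by auto
qed

context field
begin

definition polyfn :: "('a \<Rightarrow> 'a) \<Rightarrow> bool" where
  "polyfn f \<longleftrightarrow> (\<exists>p. set p \<subseteq> carrier R \<and> (\<forall>t\<in>carrier R. f t = eval p t))"

lemma polyfn_closed: "polyfn f \<Longrightarrow> t \<in> carrier R \<Longrightarrow> f t \<in> carrier R"
  unfolding polyfn_def using eval_in_carrier by auto

lemma polyfn_const: "c \<in> carrier R \<Longrightarrow> polyfn (\<lambda>t. c)"
  unfolding polyfn_def by (intro exI[of _ "[c]"]) auto

lemma polyfn_id: "polyfn (\<lambda>t. t)"
  unfolding polyfn_def by (intro exI[of _ "[\<one>, \<zero>]"]) auto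

lemma polyfn_add:
  assumes "polyfn f" "polyfn g" shows "polyfn (\<lambda>t. f t \<oplus> g t)"
proof -
  obtain p q where "set p \<subseteq> carrier R" "\<forall>t\<in>carrier R. f t = eval p t"
    "set q \<subseteq> carrier R" "\<forall>t\<in>carrier R. g t = eval q t"
    using assms unfolding polyfn_def by auto
  then show ?thesis unfolding polyfn_def
    using eval_poly_add poly_add_in_carrier by (intro exI[of _ "poly_add p q"]) auto
qed

lemma polyfn_mult:
  assumes "polyfn f" "polyfn g" shows "polyfn (\<lambda>t. f t \<otimes> g t)"
proof -
  obtain p q where "set p \<subseteq> carrier R" "\<forall>t\<in>carrier R. f t = eval p t"
    "set q \<subseteq> carrier R" "\<forall>t\<in>carrier R. g t = eval q t"
    using assms unfolding polyfn_def by auto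
  then show ?thesis unfolding polyfn_def
    using eval_poly_mult poly_mult_in_carrier by (intro exI[of _ "poly_mult p q"]) auto
qed

lemma polyfn_pow: "polyfn (\<lambda>t. t [^] (n::nat))"
proof (induction n)
  case 0 then show ?case using polyfn_const[of \<one>] by simp
next
  case (Suc n) then show ?case using polyfn_mult[OF Suc polyfn_id] by simp
qed

text \<open>The only source of the cofinite sets below. A value \<open>t0\<close> at which \<open>f\<close> does not vanish is the
  witness that the polynomial representing \<open>f\<close> is not zero.\<close>

lemma polyfn_finite_zeros:
  assumes "polyfn f" "t0 \<in> carrier R" "f t0 \<noteq> \<zero>"
  shows "finite {t \<in> carrier R. f t = \<zero>}"
proof -
  obtain p where p: "set p \<subseteq> carrier R" "\<forall>t\<in>carrier R. f t = eval p t"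
    using assms(1) unfolding polyfn_def by auto
  define q where "q = normalize p"
  have q: "q \<in> carrier (poly_ring R)" "\<forall>t\<in>carrier R. f t = eval q t"
    using p normalize_gives_polynomial[OF p(1)] eval_normalize
    unfolding q_def univ_poly_carrier by auto
  have "q \<noteq> []" using q(2) assms(2,3) by auto
  then have "{t \<in> carrier R. f t = \<zero>} = {t. is_root q t}"
    using q unfolding is_root_def by auto
  then show ?thesis using finite_number_of_roots[OF q(1)] by simp
qed

lemma polyfn_near_nonzero:
  "polyfn f \<Longrightarrow> t0 \<in> carrier R \<Longrightarrow> f t0 \<noteq> \<zero> \<Longrightarrow> near (carrier R) t0 (\<lambda>t. f t \<noteq> \<zero>)"
  using polyfn_finite_zeros unfolding near_def by simp

text \<open>The local ring at \<open>t0\<close> of the rational functions in one variable, as functions: \<open>f\<close> is \<open>p / q\<close>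
  near \<open>t0\<close> with \<open>q t0 \<noteq> \<zero>\<close>. Clearing the denominator avoids values of a quotient at its poles.\<close>

definition scalar_germ :: "'a \<Rightarrow> ('a \<Rightarrow> 'a) \<Rightarrow> bool" where
  "scalar_germ t0 f \<longleftrightarrow> (\<exists>p q. polyfn p \<and> polyfn q \<and> q t0 \<noteq> \<zero> \<and>
     near (carrier R) t0 (\<lambda>t. f t \<in> carrier R \<and> q t \<otimes> f t = p t))"

lemma scalar_germ_closed:
  assumes "scalar_germ t0 f" "t0 \<in> carrier R" shows "near (carrier R) t0 (\<lambda>t. f t \<in> carrier R)"
proof -
  obtain p q where "near (carrier R) t0 (\<lambda>t. f t \<in> carrier R \<and> q t \<otimes> f t = p t)"
    using assms unfolding scalar_germ_def by blast
  then show ?thesis by (rule near_mp[OF _ assms(2)]) blast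
qed

lemma scalar_germ_cong:
  assumes "scalar_germ t0 f" "t0 \<in> carrier R" "near (carrier R) t0 (\<lambda>t. f t = g t)"
  shows "scalar_germ t0 g"
proof -
  obtain p q where pq: "polyfn p" "polyfn q" "q t0 \<noteq> \<zero>"
    "near (carrier R) t0 (\<lambda>t. f t \<in> carrier R \<and> q t \<otimes> f t = p t)"
    using assms(1) unfolding scalar_germ_def by blast
  have "near (carrier R) t0 (\<lambda>t. g t \<in> carrier R \<and> q t \<otimes> g t = p t)"
    by (rule near_mp[OF near_conj[OF pq(4) assms(3)] assms(2)]) auto
  then show ?thesis using pq unfolding scalar_germ_def by blast
qed

lemma scalar_germ_polyfn:
  assumes "polyfn f" "t0 \<in> carrier R" shows "scalar_germ t0 f"
proof -
  have "near (carrier R) t0 (\<lambda>t. f t \<in> carrier R \<and> \<one> \<otimes> f t = f t)"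
    by (rule near_always[OF assms(2)]) (simp add: polyfn_closed[OF assms(1)])
  then show ?thesis
    unfolding scalar_germ_def using assms(1) polyfn_const[OF one_closed] one_not_zero by blast
qed

lemma scalar_germ_add:
  assumes "scalar_germ t0 f" "scalar_germ t0 g" "t0 \<in> carrier R"
  shows "scalar_germ t0 (\<lambda>t. f t \<oplus> g t)"
proof -
  obtain p q where pq: "polyfn p" "polyfn q" "q t0 \<noteq> \<zero>"
    "near (carrier R) t0 (\<lambda>t. f t \<in> carrier R \<and> q t \<otimes> f t = p t)"
    using assms(1) unfolding scalar_germ_def by blast
  obtain p' q' where pq': "polyfn p'" "polyfn q'" "q' t0 \<noteq> \<zero>"
    "near (carrier R) t0 (\<lambda>t. g t \<in> carrier R \<and> q' t \<otimes> g t = p' t)"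
    using assms(2) unfolding scalar_germ_def by blast
  have "near (carrier R) t0 (\<lambda>t. f t \<oplus> g t \<in> carrier R \<and>
     (q t \<otimes> q' t) \<otimes> (f t \<oplus> g t) = q' t \<otimes> p t \<oplus> q t \<otimes> p' t)"
  proof (rule near_mp[OF near_conj[OF pq(4) pq'(4)] assms(3)])
    fix t assume t: "t \<in> carrier R"
      and h: "(f t \<in> carrier R \<and> q t \<otimes> f t = p t) \<and> (g t \<in> carrier R \<and> q' t \<otimes> g t = p' t)"
    have c: "q t \<in> carrier R" "q' t \<in> carrier R" using polyfn_closed pq(2) pq'(2) t by auto
    have d: "f t \<in> carrier R" "g t \<in> carrier R" using h by auto
    have e: "(q t \<otimes> q' t) \<otimes> (f t \<oplus> g t) = q' t \<otimes> (q t \<otimes> f t) \<oplus> q t \<otimes> (q' t \<otimes> g t)"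
      using c d by (simp add: r_distr m_ac)
    then show "f t \<oplus> g t \<in> carrier R \<and>
      (q t \<otimes> q' t) \<otimes> (f t \<oplus> g t) = q' t \<otimes> p t \<oplus> q t \<otimes> p' t" unfolding e using h by auto
  qed
  moreover have "q t0 \<otimes> q' t0 \<noteq> \<zero>"
    using pq(3) pq'(3) polyfn_closed[OF pq(2) assms(3)] polyfn_closed[OF pq'(2) assms(3)]
    by (simp add: integral_iff)
  ultimately show ?thesis unfolding scalar_germ_def
    using polyfn_add[OF polyfn_mult[OF pq'(2) pq(1)] polyfn_mult[OF pq(2) pq'(1)]]
      polyfn_mult[OF pq(2) pq'(2)] by blast
qed

lemma scalar_germ_mult:
  assumes "scalar_germ t0 f" "scalar_germ t0 g" "t0 \<in> carrier R"
  shows "scalar_germ t0 (\<lambda>t. f t \<otimes> g t)"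
proof -
  obtain p q where pq: "polyfn p" "polyfn q" "q t0 \<noteq> \<zero>"
    "near (carrier R) t0 (\<lambda>t. f t \<in> carrier R \<and> q t \<otimes> f t = p t)"
    using assms(1) unfolding scalar_germ_def by blast
  obtain p' q' where pq': "polyfn p'" "polyfn q'" "q' t0 \<noteq> \<zero>"
    "near (carrier R) t0 (\<lambda>t. g t \<in> carrier R \<and> q' t \<otimes> g t = p' t)"
    using assms(2) unfolding scalar_germ_def by blast
  have "near (carrier R) t0 (\<lambda>t. f t \<otimes> g t \<in> carrier R \<and>
     (q t \<otimes> q' t) \<otimes> (f t \<otimes> g t) = p t \<otimes> p' t)"
  proof (rule near_mp[OF near_conj[OF pq(4) pq'(4)] assms(3)])
    fix t assume t: "t \<in> carrier R"
      and h: "(f t \<in> carrier R \<and> q t \<otimes> f t = p t) \<and> (g t \<in> carrier R \<and> q' t \<otimes> g t = p' t)"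
    have c: "q t \<in> carrier R" "q' t \<in> carrier R" using polyfn_closed pq(2) pq'(2) t by auto
    have d: "f t \<in> carrier R" "g t \<in> carrier R" using h by auto
    have e: "(q t \<otimes> q' t) \<otimes> (f t \<otimes> g t) = (q t \<otimes> f t) \<otimes> (q' t \<otimes> g t)"
      using c d by (simp add: m_ac)
    then show "f t \<otimes> g t \<in> carrier R \<and> (q t \<otimes> q' t) \<otimes> (f t \<otimes> g t) = p t \<otimes> p' t" unfolding e using h by auto
  qed
  moreover have "q t0 \<otimes> q' t0 \<noteq> \<zero>"
    using pq(3) pq'(3) polyfn_closed[OF pq(2) assms(3)] polyfn_closed[OF pq'(2) assms(3)]
    by (simp add: integral_iff)
  ultimately show ?thesis unfolding scalar_germ_def
    using polyfn_mult[OF pq(1) pq'(1)] polyfn_mult[OF pq(2) pq'(2)] by blast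
qed

text \<open>The numerator \<open>p = q f\<close> is a polynomial function that does not vanish at \<open>t0\<close>.\<close>

lemma scalar_germ_near_nonzero:
  assumes "scalar_germ t0 f" "t0 \<in> carrier R" "f t0 \<noteq> \<zero>"
  shows "near (carrier R) t0 (\<lambda>t. f t \<noteq> \<zero>)"
proof -
  obtain p q where pq: "polyfn p" "polyfn q" "q t0 \<noteq> \<zero>"
    "near (carrier R) t0 (\<lambda>t. f t \<in> carrier R \<and> q t \<otimes> f t = p t)"
    using assms(1) unfolding scalar_germ_def by blast
  have f0: "f t0 \<in> carrier R" "p t0 = q t0 \<otimes> f t0" using pq(4) unfolding near_def by auto
  have "q t0 \<otimes> f t0 \<noteq> \<zero>"
    using integral[of "q t0" "f t0"] polyfn_closed[OF pq(2) assms(2)] pq(3) assms(3) f0(1) by blast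
  then have "p t0 \<noteq> \<zero>" using f0(2) by metis
  then have n: "near (carrier R) t0 (\<lambda>t. (f t \<in> carrier R \<and> q t \<otimes> f t = p t) \<and> p t \<noteq> \<zero>)"
    using near_conj[OF pq(4)] polyfn_near_nonzero[of p t0] pq(1) assms(2) by blast
  show ?thesis
  proof (rule near_mp[OF n assms(2)])
    fix t assume "t \<in> carrier R" "(f t \<in> carrier R \<and> q t \<otimes> f t = p t) \<and> p t \<noteq> \<zero>"
    then show "f t \<noteq> \<zero>" using polyfn_closed[OF pq(2)] r_null by metis
  qed
qed

text \<open>The ring of germs is local: a germ with nonzero value at \<open>t0\<close> is invertible, \<open>p / q\<close> having
  the inverse \<open>q / p\<close>.\<close>

lemma scalar_germ_inverse:
  assumes "scalar_germ t0 f" "t0 \<in> carrier R" "f t0 \<noteq> \<zero>"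
  obtains g where "scalar_germ t0 g" "near (carrier R) t0 (\<lambda>t. g t \<in> carrier R \<and> g t \<otimes> f t = \<one>)"
proof -
  obtain p q where pq: "polyfn p" "polyfn q" "q t0 \<noteq> \<zero>"
    "near (carrier R) t0 (\<lambda>t. f t \<in> carrier R \<and> q t \<otimes> f t = p t)"
    using assms(1) unfolding scalar_germ_def by blast
  let ?g = "\<lambda>t. inv (f t)"
  have n: "near (carrier R) t0 (\<lambda>t. (f t \<in> carrier R \<and> q t \<otimes> f t = p t) \<and> f t \<noteq> \<zero>)"
    by (rule near_conj[OF pq(4) scalar_germ_near_nonzero[of t0 f, OF assms]])
  have 1: "near (carrier R) t0 (\<lambda>t. ?g t \<in> carrier R \<and> ?g t \<otimes> f t = \<one>)"
    by (rule near_mp[OF n assms(2)]) (simp add: field_Units)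
  have 2: "near (carrier R) t0 (\<lambda>t. ?g t \<in> carrier R \<and> p t \<otimes> ?g t = q t)"
  proof (rule near_mp[OF n assms(2)])
    fix t assume t: "t \<in> carrier R" and h: "(f t \<in> carrier R \<and> q t \<otimes> f t = p t) \<and> f t \<noteq> \<zero>"
    then have g: "inv (f t) \<in> carrier R" "f t \<otimes> inv (f t) = \<one>" by (simp_all add: field_Units)
    have c: "q t \<in> carrier R" using polyfn_closed pq t by auto
    have "p t \<otimes> inv (f t) = (q t \<otimes> f t) \<otimes> inv (f t)" using h by simp
    also have "\<dots> = q t" using c g conjunct1[OF conjunct1[OF h]] by (simp add: m_assoc)
    finally show "?g t \<in> carrier R \<and> p t \<otimes> ?g t = q t" using g by simp
  qed
  have f0: "f t0 \<in> carrier R" "p t0 = q t0 \<otimes> f t0" using pq(4) unfolding near_def by auto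
  have "q t0 \<otimes> f t0 \<noteq> \<zero>"
    using integral[of "q t0" "f t0"] polyfn_closed[OF pq(2) assms(2)] pq(3) assms(3) f0(1) by blast
  then have "p t0 \<noteq> \<zero>" using f0(2) by metis
  then have "scalar_germ t0 ?g" using 2 pq unfolding scalar_germ_def by blast
  then show ?thesis using that 1 by blast
qed

end

section \<open>Elements of an algebra depending on a parameter\<close>

locale central_subfield = ring R for R (structure) +
  fixes Z :: "'a set"
  assumes subfield: "subfield Z R"
    and central: "\<And>z x. z \<in> Z \<Longrightarrow> x \<in> carrier R \<Longrightarrow> z \<otimes> x = x \<otimes> z"
begin

sublocale Z: field "R\<lparr>carrier := Z\<rparr>"
  using subfield_iff(2)[OF subfield] .

lemma Z_sub: "z \<in> Z \<Longrightarrow> z \<in> carrier R"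
  using subfieldE(3)[OF subfield] by auto

end

text \<open>A finite-dimensional algebra over a central subfield, given by a spanning family \<open>b\<close>, and a
  point of the line \<open>Z\<close> around which elements of the algebra are allowed to vary. Since \<open>b\<close> is
  only required to span, coordinates are not unique; the arguments below produce them and never
  compare them.\<close>

locale germs = central_subfield +
  fixes N :: nat and b :: "nat \<Rightarrow> 'a" and t0 :: 'a
  assumes b_closed: "\<And>i. i < N \<Longrightarrow> b i \<in> carrier R"
    and b_span: "\<And>x. x \<in> carrier R \<Longrightarrow> \<exists>u. (\<forall>i<N. u i \<in> Z) \<and> x = (\<Oplus>i\<in>{..<N}. u i \<otimes> b i)"
    and t0: "t0 \<in> Z"
begin

abbreviation locally where "locally \<equiv> near Z t0"
abbreviation sgerm where "sgerm \<equiv> Z.scalar_germ t0"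

lemma sgerm_closed: "sgerm f \<Longrightarrow> locally (\<lambda>t. f t \<in> Z)"
  using Z.scalar_germ_closed[of t0 f] t0 by simp

lemma sgerm_const: "c \<in> Z \<Longrightarrow> sgerm (\<lambda>t. c)"
  using Z.scalar_germ_polyfn[of "\<lambda>t. c" t0] Z.polyfn_const[of c] t0 by simp

lemma sgerm_id: "sgerm (\<lambda>t. t)"
  using Z.scalar_germ_polyfn[of "\<lambda>t. t" t0] Z.polyfn_id t0 by simp

lemma sgerm_add: "sgerm f \<Longrightarrow> sgerm g \<Longrightarrow> sgerm (\<lambda>t. f t \<oplus> g t)"
  using Z.scalar_germ_add[of t0 f g] t0 by simp

lemma sgerm_mult: "sgerm f \<Longrightarrow> sgerm g \<Longrightarrow> sgerm (\<lambda>t. f t \<otimes> g t)"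
  using Z.scalar_germ_mult[of t0 f g] t0 by simp

lemma sgerm_cong: "sgerm f \<Longrightarrow> locally (\<lambda>t. f t = g t) \<Longrightarrow> sgerm g"
  using Z.scalar_germ_cong[of t0 f g] t0 by simp

lemma sgerm_inverse:
  assumes "sgerm f" "f t0 \<noteq> \<zero>"
  obtains g where "sgerm g" "locally (\<lambda>t. g t \<in> Z \<and> g t \<otimes> f t = \<one>)"
  using Z.scalar_germ_inverse[of t0 f] assms t0 by auto

lemma Z_minus: "z \<in> Z \<Longrightarrow> \<ominus> z \<in> Z"
  using subringE(5)[OF subfieldE(1)[OF subfield]] .

lemma Z_one: "\<one> \<in> Z" and Z_zero: "\<zero> \<in> Z"
  using Z.one_closed Z.zero_closed by simp_all

lemma sgerm_neg:
  assumes "sgerm f" shows "sgerm (\<lambda>t. \<ominus> f t)"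
proof -
  have "locally (\<lambda>t. (\<ominus> \<one>) \<otimes> f t = \<ominus> f t)"
    by (rule near_mp[OF sgerm_closed[OF assms] t0]) (simp add: Z_sub l_minus)
  then show ?thesis
    by (rule sgerm_cong[OF sgerm_mult[OF sgerm_const[OF Z_minus[OF Z_one]] assms]])
qed

lemma locally_mp: "locally P \<Longrightarrow> (\<And>t. t \<in> Z \<Longrightarrow> P t \<Longrightarrow> Q t) \<Longrightarrow> locally Q"
  using near_mp[OF _ t0] by blast

lemma locally_mp2: "locally P \<Longrightarrow> locally P' \<Longrightarrow> (\<And>t. t \<in> Z \<Longrightarrow> P t \<Longrightarrow> P' t \<Longrightarrow> Q t) \<Longrightarrow> locally Q"
  by (rule locally_mp[OF near_conj[of Z t0 P P']]) auto

lemma locally_mp3: "locally P \<Longrightarrow> locally P' \<Longrightarrow> locally P'' \<Longrightarrow> (\<And>t. t \<in> Z \<Longrightarrow> P t \<Longrightarrow> P' t \<Longrightarrow> P'' t \<Longrightarrow> Q t) \<Longrightarrow> locally Q"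
  by (rule locally_mp2[of "\<lambda>t. P t \<and> P' t" P'']) (auto intro: near_conj)

lemma locally_all: "(\<And>i::nat. i < n \<Longrightarrow> locally (P i)) \<Longrightarrow> locally (\<lambda>t. \<forall>i<n. P i t)"
  using near_ball[of "{..<n}" t0 Z P] t0 by (auto simp: Ball_def)

text \<open>Elements of the algebra depending rationally on a parameter near \<open>t0\<close>.\<close>

definition germ :: "('a \<Rightarrow> 'a) \<Rightarrow> bool" where
  "germ f \<longleftrightarrow> (\<exists>\<eta>. (\<forall>i<N. sgerm (\<eta> i)) \<and> locally (\<lambda>t. f t = (\<Oplus>i\<in>{..<N}. \<eta> i t \<otimes> b i)))"

lemma germ_cong:
  assumes "germ f" "locally (\<lambda>t. f t = g t)" shows "germ g"
proof -
  obtain \<eta> where h: "\<forall>i<N. sgerm (\<eta> i)" "locally (\<lambda>t. f t = (\<Oplus>i\<in>{..<N}. \<eta> i t \<otimes> b i))"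
    using assms(1) unfolding germ_def by blast
  have "locally (\<lambda>t. g t = (\<Oplus>i\<in>{..<N}. \<eta> i t \<otimes> b i))"
    by (rule locally_mp2[OF h(2) assms(2)]) metis
  then show ?thesis using h(1) unfolding germ_def by blast
qed

lemma comb_closed: "(\<And>i. i < (n::nat) \<Longrightarrow> u i \<in> Z) \<Longrightarrow> (\<And>i. i < n \<Longrightarrow> v i \<in> carrier R) \<Longrightarrow>
   (\<Oplus>i\<in>{..<n}. u i \<otimes> v i) \<in> carrier R"
  by (intro finsum_closed) (auto simp: Z_sub)

lemma germ_closed:
  assumes "germ f" shows "locally (\<lambda>t. f t \<in> carrier R)"
proof -
  obtain \<eta> where h: "\<forall>i<N. sgerm (\<eta> i)" "locally (\<lambda>t. f t = (\<Oplus>i\<in>{..<N}. \<eta> i t \<otimes> b i))"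
    using assms(1) unfolding germ_def by blast
  have "locally (\<lambda>t. \<forall>i<N. \<eta> i t \<in> Z)" using h(1) sgerm_closed by (intro locally_all) blast
  from locally_mp2[OF this h(2)] show ?thesis using comb_closed b_closed by simp
qed

lemma germ_const:
  assumes "c \<in> carrier R" shows "germ (\<lambda>t. c)"
proof -
  obtain u where u: "\<forall>i<N. u i \<in> Z" "c = (\<Oplus>i\<in>{..<N}. u i \<otimes> b i)"
    using b_span[OF assms] by blast
  show ?thesis unfolding germ_def
    using u sgerm_const by (intro exI[of _ "\<lambda>i t. u i"] conjI) (auto intro: near_always[OF t0])
qed

lemma germ_add:
  assumes "germ f" "germ g" shows "germ (\<lambda>t. f t \<oplus> g t)"
proof -
  obtain \<eta> where h: "\<forall>i<N. sgerm (\<eta> i)" "locally (\<lambda>t. f t = (\<Oplus>i\<in>{..<N}. \<eta> i t \<otimes> b i))"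
    using assms(1) unfolding germ_def by blast
  obtain \<theta> where k: "\<forall>i<N. sgerm (\<theta> i)" "locally (\<lambda>t. g t = (\<Oplus>i\<in>{..<N}. \<theta> i t \<otimes> b i))"
    using assms(2) unfolding germ_def by blast
  have c: "locally (\<lambda>t. \<forall>i<N. \<eta> i t \<in> Z \<and> \<theta> i t \<in> Z)"
    using h(1) k(1) sgerm_closed by (intro locally_all near_conj) blast+
  have "locally (\<lambda>t. f t \<oplus> g t = (\<Oplus>i\<in>{..<N}. (\<eta> i t \<oplus> \<theta> i t) \<otimes> b i))"
  proof (rule locally_mp3[OF c h(2) k(2)])
    fix t assume c: "\<forall>i<N. \<eta> i t \<in> Z \<and> \<theta> i t \<in> Z"
      and eq: "f t = (\<Oplus>i\<in>{..<N}. \<eta> i t \<otimes> b i)" "g t = (\<Oplus>i\<in>{..<N}. \<theta> i t \<otimes> b i)"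
    have "(\<Oplus>i\<in>{..<N}. \<eta> i t \<otimes> b i) \<oplus> (\<Oplus>i\<in>{..<N}. \<theta> i t \<otimes> b i) =
      (\<Oplus>i\<in>{..<N}. \<eta> i t \<otimes> b i \<oplus> \<theta> i t \<otimes> b i)"
      using c by (intro finsum_addf[symmetric]) (auto simp: b_closed Z_sub)
    also have "\<dots> = (\<Oplus>i\<in>{..<N}. (\<eta> i t \<oplus> \<theta> i t) \<otimes> b i)"
      using c by (intro finsum_cong') (auto simp: l_distr b_closed Z_sub)
    finally show "f t \<oplus> g t = (\<Oplus>i\<in>{..<N}. (\<eta> i t \<oplus> \<theta> i t) \<otimes> b i)" unfolding eq .
  qed
  then show ?thesis unfolding germ_def using h(1) k(1) sgerm_add
    by (intro exI[of _ "\<lambda>i t. \<eta> i t \<oplus> \<theta> i t"]) blast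
qed

lemma germ_scale:
  assumes "sgerm \<mu>" "germ f" shows "germ (\<lambda>t. \<mu> t \<otimes> f t)"
proof -
  obtain \<eta> where h: "\<forall>i<N. sgerm (\<eta> i)" "locally (\<lambda>t. f t = (\<Oplus>i\<in>{..<N}. \<eta> i t \<otimes> b i))"
    using assms(2) unfolding germ_def by blast
  have c: "locally (\<lambda>t. \<forall>i<N. \<eta> i t \<in> Z)"
    using h(1) sgerm_closed by (intro locally_all near_conj) blast+
  have "locally (\<lambda>t. \<mu> t \<otimes> f t = (\<Oplus>i\<in>{..<N}. (\<mu> t \<otimes> \<eta> i t) \<otimes> b i))"
  proof (rule locally_mp3[OF c h(2) sgerm_closed[OF assms(1)]])
    fix t assume c: "\<forall>i<N. \<eta> i t \<in> Z" "\<mu> t \<in> Z"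
      and eq: "f t = (\<Oplus>i\<in>{..<N}. \<eta> i t \<otimes> b i)"
    have "\<mu> t \<otimes> (\<Oplus>i\<in>{..<N}. \<eta> i t \<otimes> b i) = (\<Oplus>i\<in>{..<N}. \<mu> t \<otimes> (\<eta> i t \<otimes> b i))"
      using c by (intro finsum_rdistr) (auto simp: b_closed Z_sub)
    also have "\<dots> = (\<Oplus>i\<in>{..<N}. (\<mu> t \<otimes> \<eta> i t) \<otimes> b i)"
      using c by (intro finsum_cong') (auto simp: m_assoc b_closed Z_sub)
    finally show "\<mu> t \<otimes> f t = (\<Oplus>i\<in>{..<N}. (\<mu> t \<otimes> \<eta> i t) \<otimes> b i)" unfolding eq .
  qed
  then show ?thesis unfolding germ_def using h(1) sgerm_mult[OF assms(1)]
    by (intro exI[of _ "\<lambda>i t. \<mu> t \<otimes> \<eta> i t"]) blast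
qed

lemma germ_finsum:
  fixes n :: nat
  assumes "\<And>i. i < n \<Longrightarrow> germ (f i)" shows "germ (\<lambda>t. \<Oplus>i\<in>{..<n}. f i t)"
  using assms
proof (induction n)
  case 0
  then show ?case using germ_const[OF zero_closed] by simp
next
  case (Suc n)
  have "locally (\<lambda>t. \<forall>i<Suc n. f i t \<in> carrier R)" using Suc.prems germ_closed by (intro locally_all) blast
  then have "locally (\<lambda>t. f n t \<oplus> (\<Oplus>i\<in>{..<n}. f i t) = (\<Oplus>i\<in>{..<Suc n}. f i t))"
    by (rule locally_mp) (simp add: lessThan_Suc Pi_def)
  then show ?case by (rule germ_cong[rotated]) (use Suc in \<open>auto intro: germ_add\<close>)
qed

lemma germ_rmult_const:
  assumes "germ f" "c \<in> carrier R" shows "germ (\<lambda>t. f t \<otimes> c)"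
proof -
  obtain \<eta> where h: "\<forall>i<N. sgerm (\<eta> i)" "locally (\<lambda>t. f t = (\<Oplus>i\<in>{..<N}. \<eta> i t \<otimes> b i))"
    using assms(1) unfolding germ_def by blast
  have c: "locally (\<lambda>t. \<forall>i<N. \<eta> i t \<in> Z)"
    using h(1) sgerm_closed by (intro locally_all near_conj) blast+
  have "locally (\<lambda>t. (\<Oplus>i\<in>{..<N}. \<eta> i t \<otimes> (b i \<otimes> c)) = f t \<otimes> c)"
  proof (rule locally_mp2[OF c h(2)])
    fix t assume c: "\<forall>i<N. \<eta> i t \<in> Z" and eq: "f t = (\<Oplus>i\<in>{..<N}. \<eta> i t \<otimes> b i)"
    have "(\<Oplus>i\<in>{..<N}. \<eta> i t \<otimes> b i) \<otimes> c = (\<Oplus>i\<in>{..<N}. (\<eta> i t \<otimes> b i) \<otimes> c)"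
      using c assms(2) by (intro finsum_ldistr) (auto simp: b_closed Z_sub)
    also have "\<dots> = (\<Oplus>i\<in>{..<N}. \<eta> i t \<otimes> (b i \<otimes> c))"
      using c assms(2) by (intro finsum_cong') (auto simp: m_assoc b_closed Z_sub)
    finally show "(\<Oplus>i\<in>{..<N}. \<eta> i t \<otimes> (b i \<otimes> c)) = f t \<otimes> c" unfolding eq by (rule HOL.sym)
  qed
  then show ?thesis
    by (rule germ_cong[rotated])
      (use h assms(2) b_closed in \<open>auto intro!: germ_finsum germ_scale germ_const\<close>)
qed

lemma germ_mult:
  assumes "germ f" "germ g" shows "germ (\<lambda>t. f t \<otimes> g t)"
proof -
  obtain \<eta> where h: "\<forall>i<N. sgerm (\<eta> i)" "locally (\<lambda>t. g t = (\<Oplus>i\<in>{..<N}. \<eta> i t \<otimes> b i))"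
    using assms(2) unfolding germ_def by blast
  have c: "locally (\<lambda>t. \<forall>i<N. \<eta> i t \<in> Z)"
    using h(1) sgerm_closed by (intro locally_all near_conj) blast+
  have "locally (\<lambda>t. (\<Oplus>i\<in>{..<N}. \<eta> i t \<otimes> (f t \<otimes> b i)) = f t \<otimes> g t)"
  proof (rule locally_mp3[OF c h(2) germ_closed[OF assms(1)]])
    fix t assume c: "\<forall>i<N. \<eta> i t \<in> Z" and f: "f t \<in> carrier R"
      and eq: "g t = (\<Oplus>i\<in>{..<N}. \<eta> i t \<otimes> b i)"
    have "f t \<otimes> (\<Oplus>i\<in>{..<N}. \<eta> i t \<otimes> b i) = (\<Oplus>i\<in>{..<N}. f t \<otimes> (\<eta> i t \<otimes> b i))"
      using c f by (intro finsum_rdistr) (auto simp: b_closed Z_sub)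
    also have "\<dots> = (\<Oplus>i\<in>{..<N}. \<eta> i t \<otimes> (f t \<otimes> b i))"
    proof (intro finsum_cong')
      fix i assume "i \<in> {..<N}"
      then have i: "\<eta> i t \<in> Z" "b i \<in> carrier R" using c b_closed by auto
      have "f t \<otimes> (\<eta> i t \<otimes> b i) = (f t \<otimes> \<eta> i t) \<otimes> b i" using i f by (simp add: m_assoc Z_sub)
      also have "\<dots> = (\<eta> i t \<otimes> f t) \<otimes> b i" using central[OF i(1) f] by simp
      also have "\<dots> = \<eta> i t \<otimes> (f t \<otimes> b i)" using i f by (simp add: m_assoc Z_sub)
      finally show "f t \<otimes> (\<eta> i t \<otimes> b i) = \<eta> i t \<otimes> (f t \<otimes> b i)" .
    qed (use c f in \<open>auto simp: b_closed Z_sub\<close>)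
    finally show "(\<Oplus>i\<in>{..<N}. \<eta> i t \<otimes> (f t \<otimes> b i)) = f t \<otimes> g t" unfolding eq by (rule HOL.sym)
  qed
  then show ?thesis
    by (rule germ_cong[rotated])
      (use h assms(1) b_closed in \<open>auto intro!: germ_finsum germ_scale germ_rmult_const\<close>)
qed

text \<open>Coordinates are not unique, so those of a germ vanishing at \<open>t0\<close> need not vanish there;
  subtracting their values at \<open>t0\<close> corrects this.\<close>

lemma germ_coords:
  assumes "germ f" "f t0 = \<zero>"
  obtains m where "\<forall>i<N. sgerm (m i) \<and> m i t0 = \<zero>" "locally (\<lambda>t. f t = (\<Oplus>i\<in>{..<N}. m i t \<otimes> b i))"
proof -
  obtain \<eta> where h: "\<forall>i<N. sgerm (\<eta> i)" "locally (\<lambda>t. f t = (\<Oplus>i\<in>{..<N}. \<eta> i t \<otimes> b i))"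
    using assms(1) unfolding germ_def by blast
  have c: "locally (\<lambda>t. \<forall>i<N. \<eta> i t \<in> Z)"
    using h(1) sgerm_closed by (intro locally_all) blast+
  then have c0: "\<forall>i<N. \<eta> i t0 \<in> Z" unfolding near_def by blast
  have h0: "(\<Oplus>i\<in>{..<N}. \<eta> i t0 \<otimes> b i) = \<zero>" using h(2) assms(2) unfolding near_def by simp
  let ?m = "\<lambda>i t. \<eta> i t \<oplus> \<ominus> \<eta> i t0"
  have "locally (\<lambda>t. f t = (\<Oplus>i\<in>{..<N}. ?m i t \<otimes> b i))"
  proof (rule locally_mp2[OF c h(2)])
    fix t assume c: "\<forall>i<N. \<eta> i t \<in> Z" and eq: "f t = (\<Oplus>i\<in>{..<N}. \<eta> i t \<otimes> b i)"
    have "(\<Oplus>i\<in>{..<N}. ?m i t \<otimes> b i) \<oplus> (\<Oplus>i\<in>{..<N}. \<eta> i t0 \<otimes> b i) =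
      (\<Oplus>i\<in>{..<N}. ?m i t \<otimes> b i \<oplus> \<eta> i t0 \<otimes> b i)"
      using c c0 by (intro finsum_addf[symmetric]) (auto simp: b_closed Z_sub)
    also have "\<dots> = (\<Oplus>i\<in>{..<N}. \<eta> i t \<otimes> b i)"
    proof (rule finsum_cong')
      fix i assume "i \<in> {..<N}"
      then have c: "\<eta> i t \<in> carrier R" "\<eta> i t0 \<in> carrier R" "b i \<in> carrier R"
        using c c0 b_closed by (auto simp: Z_sub)
      then have "?m i t \<otimes> b i \<oplus> \<eta> i t0 \<otimes> b i = (\<eta> i t \<oplus> \<ominus> \<eta> i t0 \<oplus> \<eta> i t0) \<otimes> b i"
        by (simp add: l_distr)
      then show "?m i t \<otimes> b i \<oplus> \<eta> i t0 \<otimes> b i = \<eta> i t \<otimes> b i"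
        using c by (simp add: a_assoc l_neg)
    qed (use c b_closed in \<open>auto simp: Z_sub\<close>)
    finally have "f t = (\<Oplus>i\<in>{..<N}. ?m i t \<otimes> b i) \<oplus> \<zero>" unfolding h0 eq by (rule HOL.sym)
    moreover have "(\<Oplus>i\<in>{..<N}. ?m i t \<otimes> b i) \<in> carrier R"
      using c c0 by (intro finsum_closed) (auto simp: b_closed Z_sub)
    ultimately show "f t = (\<Oplus>i\<in>{..<N}. ?m i t \<otimes> b i)" by simp
  qed
  moreover have "\<forall>i<N. sgerm (?m i) \<and> ?m i t0 = \<zero>"
  proof (intro allI impI conjI)
    fix i assume "i < N"
    then have i: "sgerm (\<eta> i)" "\<eta> i t0 \<in> Z" using h(1) c0 by blast+
    show "sgerm (?m i)" by (rule sgerm_add[OF i(1) sgerm_const[OF Z_minus[OF i(2)]]])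
    show "?m i t0 = \<zero>" using r_neg[OF Z_sub[OF i(2)]] .
  qed
  ultimately show ?thesis using that[of ?m] by blast
qed

text \<open>Nakayama's lemma for the local ring of scalar germs, in the form of Gaussian elimination.
  The matrix \<open>\<one> + m\<close> is the identity at \<open>t0\<close>, so each diagonal entry met on the way is a unit
  and no pivoting is needed; the condition \<open>m j i t0 = \<zero>\<close> is inherited by the smaller matrix.
  The predicate \<open>M\<close> stands for an arbitrary module of germs.\<close>

lemma elimination:
  fixes n :: nat
  assumes cong: "\<And>f g. M f \<Longrightarrow> locally (\<lambda>t. f t = g t) \<Longrightarrow> M g"
    and add: "\<And>f g. M f \<Longrightarrow> M g \<Longrightarrow> M (\<lambda>t. f t \<oplus> g t)"
    and scale: "\<And>\<mu> f. sgerm \<mu> \<Longrightarrow> M f \<Longrightarrow> M (\<lambda>t. \<mu> t \<otimes> f t)"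
    and "\<And>i. i < n \<Longrightarrow> v i \<in> carrier R"
    and "\<And>j i. j < n \<Longrightarrow> i < n \<Longrightarrow> sgerm (m j i) \<and> m j i t0 = \<zero>"
    and "\<And>j. j < n \<Longrightarrow> M (\<lambda>t. v j \<oplus> (\<Oplus>i\<in>{..<n}. m j i t \<otimes> v i))"
    and "j < n"
  shows "M (\<lambda>t. v j)"
  using assms(4-7)
proof (induction n arbitrary: m j)
  case 0
  then show ?case by simp
next
  case (Suc n)
  note v = Suc.prems(1) and m = Suc.prems(2) and Mv = Suc.prems(3)
  have "sgerm (\<lambda>t. \<one> \<oplus> m n n t)" "\<one> \<oplus> m n n t0 \<noteq> \<zero>"
    using m[of n n] sgerm_add[OF sgerm_const[OF Z_one]] Z.one_not_zero by auto
  then obtain u where u: "sgerm u" "locally (\<lambda>t. u t \<in> Z \<and> u t \<otimes> (\<one> \<oplus> m n n t) = \<one>)"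
    using sgerm_inverse by blast
  have mZ: "locally (\<lambda>t. \<forall>j<Suc n. \<forall>i<Suc n. m j i t \<in> Z)"
    using m sgerm_closed by (intro locally_all) blast
  let ?s = "\<lambda>j t. \<Oplus>i\<in>{..<n}. m j i t \<otimes> v i"
  let ?v = "\<lambda>j t. v j \<oplus> (\<Oplus>i\<in>{..<Suc n}. m j i t \<otimes> v i)"
  have sum_Suc: "?v j t = v j \<oplus> (m j n t \<otimes> v n \<oplus> ?s j t)" "?s j t \<in> carrier R"
    if "j < Suc n" "\<forall>j<Suc n. \<forall>i<Suc n. m j i t \<in> Z" for j t
    using that v by (auto simp: lessThan_Suc Z_sub Pi_def intro!: finsum_closed)
  let ?m' = "\<lambda>j i t. m j i t \<oplus> \<ominus> (m j n t \<otimes> (u t \<otimes> m n i t))"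
  have sg': "sgerm (?m' j i) \<and> ?m' j i t0 = \<zero>" if "j < n" "i < n" for j i
  proof -
    have "sgerm (m j i)" "sgerm (m j n)" "sgerm (m n i)" "m j i t0 = \<zero>" "m j n t0 = \<zero>" "m n i t0 = \<zero>"
      using m that by simp_all
    moreover have "u t0 \<in> Z" using u(2) unfolding near_def by blast
    ultimately show ?thesis using u(1) by (auto intro!: sgerm_add sgerm_neg sgerm_mult simp: Z_sub)
  qed
  \<comment> \<open>The last generator is expressed through the others and its own member of \<open>M\<close>.\<close>
  have last: "locally (\<lambda>t. v n = u t \<otimes> (?v n t \<oplus> \<ominus> ?s n t))"
  proof (rule locally_mp2[OF u(2) mZ])
    fix t assume u: "u t \<in> Z \<and> u t \<otimes> (\<one> \<oplus> m n n t) = \<one>" and mz: "\<forall>j<Suc n. \<forall>i<Suc n. m j i t \<in> Z"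
    have c: "m n n t \<in> carrier R" "u t \<in> carrier R" "v n \<in> carrier R" "?s n t \<in> carrier R"
      using mz u v sum_Suc[of n t] by (auto simp: Z_sub)
    have "?v n t \<oplus> \<ominus> ?s n t = v n \<oplus> m n n t \<otimes> v n"
      using c sum_Suc[of n t] mz by (simp add: a_assoc r_neg)
    also have "\<dots> = (\<one> \<oplus> m n n t) \<otimes> v n" using c by (simp add: l_distr)
    finally have "u t \<otimes> (?v n t \<oplus> \<ominus> ?s n t) = (u t \<otimes> (\<one> \<oplus> m n n t)) \<otimes> v n"
      using c by (simp add: m_assoc)
    then show "v n = u t \<otimes> (?v n t \<oplus> \<ominus> ?s n t)" using u c by simp
  qed
  have M': "M (\<lambda>t. v j \<oplus> (\<Oplus>i\<in>{..<n}. ?m' j i t \<otimes> v i))" if j: "j < n" for j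
  proof (rule cong)
    have "sgerm (\<lambda>t. \<ominus> (m j n t \<otimes> u t))" using m[of j n] u(1) j by (intro sgerm_neg sgerm_mult) auto
    then show "M (\<lambda>t. ?v j t \<oplus> \<ominus> (m j n t \<otimes> u t) \<otimes> ?v n t)"
      using j by (intro add[OF Mv scale[OF _ Mv]]) auto
    show "locally (\<lambda>t. ?v j t \<oplus> \<ominus> (m j n t \<otimes> u t) \<otimes> ?v n t =
       v j \<oplus> (\<Oplus>i\<in>{..<n}. ?m' j i t \<otimes> v i))"
    proof (rule locally_mp3[OF u(2) mZ last])
      fix t assume u: "u t \<in> Z \<and> u t \<otimes> (\<one> \<oplus> m n n t) = \<one>"
        and mz: "\<forall>j<Suc n. \<forall>i<Suc n. m j i t \<in> Z"
        and l: "v n = u t \<otimes> (?v n t \<oplus> \<ominus> ?s n t)"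
      define V where "V = ?v n t"
      define w where "w = m j n t \<otimes> u t"
      have cc: "m j n t \<in> carrier R" "u t \<in> carrier R" "v n \<in> carrier R" "v j \<in> carrier R"
        "?s n t \<in> carrier R" "?s j t \<in> carrier R" "V \<in> carrier R" "w \<in> carrier R" "m n n t \<in> carrier R"
        using mz u v sum_Suc[of n t] sum_Suc[of j t] j unfolding V_def w_def by (auto simp: Z_sub)
      have "(\<Oplus>i\<in>{..<n}. ?m' j i t \<otimes> v i) =
        (\<Oplus>i\<in>{..<n}. m j i t \<otimes> v i \<oplus> (\<ominus> w) \<otimes> (m n i t \<otimes> v i))"
      proof (rule finsum_cong')
        fix i assume "i \<in> {..<n}"
        then have "m j i t \<in> carrier R" "m n i t \<in> carrier R" "v i \<in> carrier R"
          using mz v j by (auto simp: Z_sub)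
        then show "?m' j i t \<otimes> v i = m j i t \<otimes> v i \<oplus> (\<ominus> w) \<otimes> (m n i t \<otimes> v i)"
          using cc by (simp add: w_def l_distr l_minus m_assoc)
      qed (use mz v j cc in \<open>auto simp: Z_sub\<close>)
      also have "\<dots> = ?s j t \<oplus> (\<Oplus>i\<in>{..<n}. (\<ominus> w) \<otimes> (m n i t \<otimes> v i))"
        using mz v j cc by (intro finsum_addf) (auto simp: Z_sub)
      also have "(\<Oplus>i\<in>{..<n}. (\<ominus> w) \<otimes> (m n i t \<otimes> v i)) = (\<ominus> w) \<otimes> ?s n t"
        using mz v j cc by (intro finsum_rdistr[symmetric]) (auto simp: Z_sub)
      finally have 1: "(\<Oplus>i\<in>{..<n}. ?m' j i t \<otimes> v i) = ?s j t \<oplus> (\<ominus> w) \<otimes> ?s n t" .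
      have l': "v n = u t \<otimes> (V \<oplus> \<ominus> ?s n t)" unfolding V_def by (rule l)
      have 2: "m j n t \<otimes> v n = w \<otimes> V \<oplus> \<ominus> (w \<otimes> ?s n t)"
      proof -
        have "m j n t \<otimes> v n = m j n t \<otimes> (u t \<otimes> (V \<oplus> \<ominus> ?s n t))"
          by (subst l') simp
        also have "\<dots> = w \<otimes> (V \<oplus> \<ominus> ?s n t)" using cc by (simp add: w_def m_assoc)
        finally show ?thesis using cc by (simp add: r_distr r_minus)
      qed
      have "?v j t \<oplus> \<ominus> w \<otimes> V = v j \<oplus> ((w \<otimes> V \<oplus> \<ominus> (w \<otimes> ?s n t)) \<oplus> ?s j t) \<oplus> \<ominus> w \<otimes> V"
        using sum_Suc(1)[of j t] mz j 2 by simp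
      also have "\<dots> = v j \<oplus> (?s j t \<oplus> (\<ominus> w) \<otimes> ?s n t)"
      proof -
        have "w \<otimes> V \<in> carrier R" "w \<otimes> ?s n t \<in> carrier R" using cc by auto
        moreover have "x \<oplus> ((y \<oplus> \<ominus> z) \<oplus> q) \<oplus> \<ominus> y = x \<oplus> (q \<oplus> \<ominus> z)"
          if "x \<in> carrier R" "y \<in> carrier R" "z \<in> carrier R" "q \<in> carrier R" for x y z q
        proof -
          have "x \<oplus> ((y \<oplus> \<ominus> z) \<oplus> q) \<oplus> \<ominus> y = (x \<oplus> (q \<oplus> \<ominus> z)) \<oplus> (y \<oplus> \<ominus> y)"
            using that by (simp add: a_ac)
          then show ?thesis using that by (simp add: r_neg)
        qed
        ultimately show ?thesis using cc by (simp add: l_minus)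
      qed
      finally show "?v j t \<oplus> \<ominus> (m j n t \<otimes> u t) \<otimes> ?v n t = v j \<oplus> (\<Oplus>i\<in>{..<n}. ?m' j i t \<otimes> v i)"
        unfolding 1 V_def w_def .
    qed
  qed
  have IH: "M (\<lambda>t. v i)" if "i < n" for i
    by (rule Suc.IH[of ?m' i]) (use v sg' M' that in auto)
  show ?case
  proof (cases "j < n")
    case True then show ?thesis by (rule IH)
  next
    case False
    then have j: "j = n" using Suc.prems(4) by simp
    have Ms: "M (\<lambda>t. u t \<otimes> ?v n t \<oplus> (\<Oplus>i\<in>{..<k}. (\<ominus> (u t \<otimes> m n i t)) \<otimes> v i))" if "k \<le> n" for k
      using that
    proof (induction k)
      case 0
      have "locally (\<lambda>t. u t \<otimes> ?v n t = u t \<otimes> ?v n t \<oplus> (\<Oplus>i\<in>{..<0}. (\<ominus> (u t \<otimes> m n i t)) \<otimes> v i))"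
        by (rule locally_mp2[OF u(2) mZ])
          (use sum_Suc v in \<open>auto simp: Z_sub\<close>)
      then show ?case using cong[OF scale[OF u(1) Mv[of n]]] by auto
    next
      case (Suc k)
      let ?A = "\<lambda>t. u t \<otimes> ?v n t \<oplus> (\<Oplus>i\<in>{..<k}. (\<ominus> (u t \<otimes> m n i t)) \<otimes> v i)"
      have "sgerm (\<lambda>t. \<ominus> (u t \<otimes> m n k t))" using m[of n k] u(1) Suc by (intro sgerm_neg sgerm_mult) auto
      then have M1: "M (\<lambda>t. ?A t \<oplus> (\<ominus> (u t \<otimes> m n k t)) \<otimes> v k)"
        using Suc IH[of k] by (intro add[OF _ scale]) auto
      have "locally (\<lambda>t. ?A t \<oplus> (\<ominus> (u t \<otimes> m n k t)) \<otimes> v k =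
          u t \<otimes> ?v n t \<oplus> (\<Oplus>i\<in>{..<Suc k}. (\<ominus> (u t \<otimes> m n i t)) \<otimes> v i))"
      proof (rule locally_mp2[OF u(2) mZ])
        fix t assume u: "u t \<in> Z \<and> u t \<otimes> (\<one> \<oplus> m n n t) = \<one>"
          and mz: "\<forall>j<Suc n. \<forall>i<Suc n. m j i t \<in> Z"
        have c: "(\<lambda>i. (\<ominus> (u t \<otimes> m n i t)) \<otimes> v i) \<in> {..<Suc k} \<rightarrow> carrier R"
          "u t \<in> carrier R" "?v n t \<in> carrier R"
          using u mz v Suc.prems sum_Suc[of n t] by (auto simp: Z_sub)
        have fk: "(\<Oplus>i\<in>{..<Suc k}. (\<ominus> (u t \<otimes> m n i t)) \<otimes> v i) =
          (\<ominus> (u t \<otimes> m n k t)) \<otimes> v k \<oplus> (\<Oplus>i\<in>{..<k}. (\<ominus> (u t \<otimes> m n i t)) \<otimes> v i)"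
          using c(1) by (simp add: lessThan_Suc Pi_def)
        have cl: "(\<Oplus>i\<in>{..<k}. (\<ominus> (u t \<otimes> m n i t)) \<otimes> v i) \<in> carrier R"
           "(\<ominus> (u t \<otimes> m n k t)) \<otimes> v k \<in> carrier R" "u t \<otimes> ?v n t \<in> carrier R"
          using c by (auto intro!: finsum_closed)
        show "?A t \<oplus> (\<ominus> (u t \<otimes> m n k t)) \<otimes> v k =
          u t \<otimes> ?v n t \<oplus> (\<Oplus>i\<in>{..<Suc k}. (\<ominus> (u t \<otimes> m n i t)) \<otimes> v i)"
          unfolding fk using cl by (simp add: a_ac)
      qed
      then show ?case by (rule cong[OF M1])
    qed
    have "locally (\<lambda>t. u t \<otimes> ?v n t \<oplus> (\<Oplus>i\<in>{..<n}. (\<ominus> (u t \<otimes> m n i t)) \<otimes> v i) = v n)"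
    proof (rule locally_mp3[OF u(2) mZ last])
      fix t assume u: "u t \<in> Z \<and> u t \<otimes> (\<one> \<oplus> m n n t) = \<one>"
        and mz: "\<forall>j<Suc n. \<forall>i<Suc n. m j i t \<in> Z"
        and l: "v n = u t \<otimes> (?v n t \<oplus> \<ominus> ?s n t)"
      have c: "u t \<in> carrier R" "?v n t \<in> carrier R" "?s n t \<in> carrier R"
        using u mz v sum_Suc[of n t] by (auto simp: Z_sub)
      have "(\<Oplus>i\<in>{..<n}. (\<ominus> (u t \<otimes> m n i t)) \<otimes> v i) = (\<Oplus>i\<in>{..<n}. (\<ominus> u t) \<otimes> (m n i t \<otimes> v i))"
        using c mz v by (intro finsum_cong') (auto simp: Z_sub m_assoc l_minus)
      also have "\<dots> = (\<ominus> u t) \<otimes> ?s n t"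
        using mz v c by (intro finsum_rdistr[symmetric]) (auto simp: Z_sub)
      finally have 1: "(\<Oplus>i\<in>{..<n}. (\<ominus> (u t \<otimes> m n i t)) \<otimes> v i) = (\<ominus> u t) \<otimes> ?s n t" .
      have "u t \<otimes> (?v n t \<oplus> \<ominus> ?s n t) = u t \<otimes> ?v n t \<oplus> (\<ominus> u t) \<otimes> ?s n t"
        using c by (simp add: r_distr l_minus r_minus)
      then show "u t \<otimes> ?v n t \<oplus> (\<Oplus>i\<in>{..<n}. (\<ominus> (u t \<otimes> m n i t)) \<otimes> v i) = v n"
        unfolding 1 using l by simp
    qed
    then show ?thesis unfolding j by (rule cong[OF Ms[OF order.refl]])
  qed
qed

text \<open>If \<open>f = \<one> + h\<close> with \<open>h\<close> vanishing at \<open>t0\<close>, then \<open>f b\<^sub>j = b\<^sub>j + \<Sum> m\<^sub>j\<^sub>i b\<^sub>i\<close> with germs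
  \<open>m\<^sub>j\<^sub>i\<close> vanishing at \<open>t0\<close>. By \<open>elimination\<close> all \<open>b\<^sub>j\<close>, hence also \<open>\<one>\<close>, are multiples of \<open>f\<close> by
  germs. The same on the other side gives a left inverse.\<close>

lemma germ_inverse_one:
  assumes f: "germ f" and f0: "f t0 = \<one>"
  obtains g where "germ g" "locally (\<lambda>t. f t \<in> Units R \<and> inv (f t) = g t)"
proof -
  define h where "h t = f t \<oplus> \<ominus> \<one>" for t
  have h: "germ h" "h t0 = \<zero>"
    unfolding h_def using f f0 by (auto intro!: germ_add germ_const simp: r_neg)
  have fh: "locally (\<lambda>t. h t \<in> carrier R \<and> f t = \<one> \<oplus> h t)"
  proof (rule locally_mp[OF germ_closed[OF f]])
    fix t assume "f t \<in> carrier R"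
    then show "h t \<in> carrier R \<and> f t = \<one> \<oplus> h t"
      using a_lcomm[of \<one> "f t" "\<ominus> \<one>"] by (simp add: h_def r_neg)
  qed
  have coords: "\<exists>m. \<forall>j<N. (\<forall>i<N. sgerm (m j i) \<and> m j i t0 = \<zero>) \<and>
      locally (\<lambda>t. k j t = (\<Oplus>i\<in>{..<N}. m j i t \<otimes> b i))"
    if k: "\<And>j. j < N \<Longrightarrow> germ (k j) \<and> k j t0 = \<zero>" for k
  proof -
    have "\<forall>j. \<exists>m. j < N \<longrightarrow> (\<forall>i<N. sgerm (m i) \<and> m i t0 = \<zero>) \<and>
      locally (\<lambda>t. k j t = (\<Oplus>i\<in>{..<N}. m i t \<otimes> b i))"
    proof
      fix j show "\<exists>m. j < N \<longrightarrow> (\<forall>i<N. sgerm (m i) \<and> m i t0 = \<zero>) \<and>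
        locally (\<lambda>t. k j t = (\<Oplus>i\<in>{..<N}. m i t \<otimes> b i))"
      proof (cases "j < N")
        case True
        obtain m where "\<forall>i<N. sgerm (m i) \<and> m i t0 = \<zero>"
          "locally (\<lambda>t. k j t = (\<Oplus>i\<in>{..<N}. m i t \<otimes> b i))"
          using germ_coords[of "k j"] k[OF True] by blast
        then show ?thesis by blast
      qed simp
    qed
    from choice[OF this] show ?thesis by blast
  qed
  \<comment> \<open>The operation \<open>B\<close> is multiplication or its opposite, which treats both sides at once.\<close>
  have gen: "\<exists>g. germ g \<and> locally (\<lambda>t. \<one> = B (f t) (g t))"
    if B: "B = (\<lambda>x y. x \<otimes> y) \<or> B = (\<lambda>x y. y \<otimes> x)" for B
  proof -
    have Bg: "germ x \<Longrightarrow> germ y \<Longrightarrow> germ (\<lambda>t. B (x t) (y t))" for x y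
      using B germ_mult by auto
    have Bd: "B (\<one> \<oplus> x) y = y \<oplus> B x y" "B x (y \<oplus> z) = B x y \<oplus> B x z" "B \<zero> y = \<zero>"
      if "x \<in> carrier R" "y \<in> carrier R" "z \<in> carrier R" for x y z
      using B that by (auto simp: l_distr r_distr)
    have Bz: "B x (u \<otimes> y) = u \<otimes> B x y" if "x \<in> carrier R" "y \<in> carrier R" "u \<in> Z" for x y u
      using B
    proof
      assume B: "B = (\<lambda>x y. x \<otimes> y)"
      have "x \<otimes> (u \<otimes> y) = (x \<otimes> u) \<otimes> y" using that by (simp add: m_assoc Z_sub)
      also have "\<dots> = (u \<otimes> x) \<otimes> y" using central[of u x] that by simp
      also have "\<dots> = u \<otimes> (x \<otimes> y)" using that by (simp add: m_assoc Z_sub)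
      finally show ?thesis unfolding B .
    next
      assume B: "B = (\<lambda>x y. y \<otimes> x)"
      show ?thesis unfolding B using that by (simp add: m_assoc Z_sub)
    qed
    define M where "M x \<longleftrightarrow> (\<exists>g. germ g \<and> locally (\<lambda>t. x t = B (f t) (g t)))" for x
    have "germ (\<lambda>t. B (h t) (b j)) \<and> B (h t0) (b j) = \<zero>" if "j < N" for j
      using Bg[OF h(1) germ_const[OF b_closed[OF that]]] h(2) Bd(3) b_closed[OF that] by simp
    from coords[of "\<lambda>j t. B (h t) (b j)", OF this] obtain m where m: "\<forall>j<N. (\<forall>i<N. sgerm (m j i) \<and> m j i t0 = \<zero>) \<and>
        locally (\<lambda>t. B (h t) (b j) = (\<Oplus>i\<in>{..<N}. m j i t \<otimes> b i))"
      by blast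
    have Mb: "M (\<lambda>t. b j)" if "j < N" for j
    proof (rule elimination[of M N b m])
      show "M g" if "M x" "locally (\<lambda>t. x t = g t)" for x g
      proof -
        obtain y where y: "germ y" "locally (\<lambda>t. x t = B (f t) (y t))" using \<open>M x\<close> unfolding M_def by blast
        have "locally (\<lambda>t. g t = B (f t) (y t))" by (rule locally_mp2[OF y(2) that(2)]) simp
        then show ?thesis using y(1) unfolding M_def by blast
      qed
      show "M (\<lambda>t. x t \<oplus> x' t)" if "M x" "M x'" for x x'
      proof -
        obtain y where y: "germ y" "locally (\<lambda>t. x t = B (f t) (y t))" using \<open>M x\<close> unfolding M_def by blast
        obtain y' where y': "germ y'" "locally (\<lambda>t. x' t = B (f t) (y' t))" using \<open>M x'\<close> unfolding M_def by blast
        have c: "locally (\<lambda>t. f t \<in> carrier R \<and> y t \<in> carrier R \<and> y' t \<in> carrier R)"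
          using f y y' by (intro near_conj germ_closed)
        have "locally (\<lambda>t. x t \<oplus> x' t = B (f t) (y t \<oplus> y' t))"
          by (rule locally_mp3[OF c y(2) y'(2)]) (simp add: Bd(2))
        then show ?thesis using germ_add[OF y(1) y'(1)] unfolding M_def by blast
      qed
      show "M (\<lambda>t. \<mu> t \<otimes> x t)" if \<mu>: "sgerm \<mu>" and "M x" for \<mu> x
      proof -
        obtain y where y: "germ y" "locally (\<lambda>t. x t = B (f t) (y t))" using \<open>M x\<close> unfolding M_def by blast
        have c: "locally (\<lambda>t. f t \<in> carrier R \<and> y t \<in> carrier R \<and> \<mu> t \<in> Z)"
          using f y \<mu> by (intro near_conj germ_closed sgerm_closed)
        have "locally (\<lambda>t. \<mu> t \<otimes> x t = B (f t) (\<mu> t \<otimes> y t))"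
          by (rule locally_mp2[OF c y(2)]) (simp add: Bz)
        then show ?thesis using germ_scale[OF \<mu> y(1)] unfolding M_def by blast
      qed
      show "M (\<lambda>t. b j \<oplus> (\<Oplus>i\<in>{..<N}. m j i t \<otimes> b i))" if j: "j < N" for j
      proof -
        have "locally (\<lambda>t. b j \<oplus> (\<Oplus>i\<in>{..<N}. m j i t \<otimes> b i) = B (f t) (b j))"
          by (rule locally_mp2[OF fh conjunct2[OF m[rule_format, OF j]]]) (simp add: Bd(1)[OF _ b_closed[OF j] zero_closed])
        then show ?thesis using germ_const[OF b_closed[OF j]] unfolding M_def by blast
      qed
    qed (use m b_closed that in auto)
    obtain c where c: "\<forall>i<N. c i \<in> Z" "\<one> = (\<Oplus>i\<in>{..<N}. c i \<otimes> b i)"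
      using b_span[OF one_closed] by blast
    have "\<forall>j. \<exists>g. j < N \<longrightarrow> germ g \<and> locally (\<lambda>t. b j = B (f t) (g t))"
      using Mb unfolding M_def by blast
    then obtain g where g: "\<And>j. j < N \<Longrightarrow> germ (g j)" "\<And>j. j < N \<Longrightarrow> locally (\<lambda>t. b j = B (f t) (g j t))"
      by metis
    have gc: "locally (\<lambda>t. \<forall>j<N. g j t \<in> carrier R)" using g(1) germ_closed by (intro locally_all) blast
    have gb: "locally (\<lambda>t. \<forall>j<N. b j = B (f t) (g j t))" using g(2) by (intro locally_all) blast
    have "germ (\<lambda>t. \<Oplus>i\<in>{..<N}. c i \<otimes> g i t)"
      using g(1) c(1) by (intro germ_finsum germ_scale sgerm_const) auto
    moreover have "locally (\<lambda>t. \<one> = B (f t) (\<Oplus>i\<in>{..<N}. c i \<otimes> g i t))"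
    proof (rule locally_mp3[OF gc gb germ_closed[OF f]])
      fix t assume gc: "\<forall>j<N. g j t \<in> carrier R" and gb: "\<forall>j<N. b j = B (f t) (g j t)"
        and fc: "f t \<in> carrier R"
      have "B (f t) (\<Oplus>i\<in>{..<N}. c i \<otimes> g i t) = (\<Oplus>i\<in>{..<N}. B (f t) (c i \<otimes> g i t))"
        using B
      proof
        assume B: "B = (\<lambda>x y. x \<otimes> y)"
        show ?thesis unfolding B using gc fc c(1) by (intro finsum_rdistr) (auto simp: Z_sub)
      next
        assume B: "B = (\<lambda>x y. y \<otimes> x)"
        show ?thesis unfolding B using gc fc c(1) by (intro finsum_ldistr) (auto simp: Z_sub)
      qed
      also have "\<dots> = (\<Oplus>i\<in>{..<N}. c i \<otimes> b i)"
        using gb gc fc c(1) Bz b_closed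
        by (intro finsum_cong') (auto simp: Z_sub)
      finally show "\<one> = B (f t) (\<Oplus>i\<in>{..<N}. c i \<otimes> g i t)" using c(2) by simp
    qed
    ultimately show ?thesis by blast
  qed
  obtain g where g: "germ g" "locally (\<lambda>t. \<one> = f t \<otimes> g t)"
    using gen[of "\<lambda>x y. x \<otimes> y"] by blast
  obtain g' where g': "germ g'" "locally (\<lambda>t. \<one> = g' t \<otimes> f t)"
    using gen[of "\<lambda>x y. y \<otimes> x"] by blast
  have c: "locally (\<lambda>t. f t \<in> carrier R \<and> g t \<in> carrier R \<and> g' t \<in> carrier R)"
    using f g g' by (intro near_conj germ_closed)
  have "locally (\<lambda>t. f t \<in> Units R \<and> inv (f t) = g t)"
  proof (rule locally_mp3[OF c g(2) g'(2)])
    fix t assume c: "f t \<in> carrier R \<and> g t \<in> carrier R \<and> g' t \<in> carrier R"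
      and e: "\<one> = f t \<otimes> g t" "\<one> = g' t \<otimes> f t"
    have "g' t = g' t \<otimes> (f t \<otimes> g t)" using c e(1)[symmetric] by simp
    also have "\<dots> = (g' t \<otimes> f t) \<otimes> g t" using c by (simp add: m_assoc)
    finally have "g' t = g t" using c e(2)[symmetric] by simp
    then have e2: "g t \<otimes> f t = \<one>" using e(2) by simp
    have "f t \<in> Units R" using c e(1)[symmetric] e2 unfolding Units_def by blast
    moreover have "inv (f t) = g t" using inv_unique'[of "f t" "g t"] c e(1)[symmetric] e2 by simp
    ultimately show "f t \<in> Units R \<and> inv (f t) = g t" by simp
  qed
  then show ?thesis using that g(1) by blast
qed

lemma germ_inverse:
  assumes f: "germ f" and f0: "f t0 \<in> Units R"
  obtains g where "germ g" "locally (\<lambda>t. f t \<in> Units R \<and> inv (f t) = g t)"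
proof -
  let ?u = "inv (f t0)"
  have u: "?u \<in> Units R" "?u \<in> carrier R" using f0 by auto
  obtain g where g: "germ g" "locally (\<lambda>t. f t \<otimes> ?u \<in> Units R \<and> inv (f t \<otimes> ?u) = g t)"
    using germ_inverse_one[of "\<lambda>t. f t \<otimes> ?u"] germ_mult[OF f germ_const[OF u(2)]] f0 by auto
  have "locally (\<lambda>t. f t \<in> Units R \<and> inv (f t) = ?u \<otimes> g t)"
  proof (rule locally_mp2[OF germ_closed[OF f] g(2)])
    fix t assume c: "f t \<in> carrier R" and e: "f t \<otimes> ?u \<in> Units R \<and> inv (f t \<otimes> ?u) = g t"
    have "f t = (f t \<otimes> ?u) \<otimes> f t0" using c f0 by (simp add: m_assoc Units_closed)
    then have fU: "f t \<in> Units R" using e f0 Units_m_closed[of "f t \<otimes> ?u" "f t0"] by simp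
    have "inv (f t \<otimes> ?u) = f t0 \<otimes> inv (f t)"
    proof (rule inv_unique'[symmetric])
      have "(f t \<otimes> ?u) \<otimes> (f t0 \<otimes> inv (f t)) = f t \<otimes> ((?u \<otimes> f t0) \<otimes> inv (f t))"
        using c u fU f0 by (simp add: m_assoc Units_closed del: Units_l_inv Units_r_inv)
      also have "\<dots> = \<one>" using fU f0 by simp
      finally show "(f t \<otimes> ?u) \<otimes> (f t0 \<otimes> inv (f t)) = \<one>" .
      have "(f t0 \<otimes> inv (f t)) \<otimes> (f t \<otimes> ?u) = f t0 \<otimes> ((inv (f t) \<otimes> f t) \<otimes> ?u)"
        using c u fU f0 by (simp add: m_assoc Units_closed del: Units_l_inv Units_r_inv)
      also have "\<dots> = \<one>" using f0 fU u by simp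
      finally show "(f t0 \<otimes> inv (f t)) \<otimes> (f t \<otimes> ?u) = \<one>" .
    qed (use c u fU f0 in \<open>auto simp: Units_closed\<close>)
    then have "?u \<otimes> g t = (?u \<otimes> f t0) \<otimes> inv (f t)"
      using e f0 fU by (simp add: m_assoc Units_closed del: Units_l_inv Units_r_inv)
    then show "f t \<in> Units R \<and> inv (f t) = ?u \<otimes> g t" using fU f0 by simp
  qed
  then show ?thesis using that germ_mult[OF germ_const[OF u(2)] g(1)] by blast
qed

lemma germ_near_Units:
  assumes "germ f" "f t0 \<in> Units R" shows "locally (\<lambda>t. f t \<in> Units R)"
proof -
  obtain g where "locally (\<lambda>t. f t \<in> Units R \<and> inv (f t) = g t)"
    using germ_inverse[of f] assms by blast
  then show ?thesis by (rule locally_mp) blast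
qed

lemma germ_inv:
  assumes "germ f" "f t0 \<in> Units R" shows "germ (\<lambda>t. inv (f t))"
proof -
  obtain g where g: "germ g" "locally (\<lambda>t. f t \<in> Units R \<and> inv (f t) = g t)"
    using germ_inverse[of f] assms by blast
  have "locally (\<lambda>t. g t = inv (f t))" by (rule locally_mp[OF g(2)]) simp
  then show ?thesis by (rule germ_cong[OF g(1)])
qed

lemma germ_nat_pow: "germ f \<Longrightarrow> germ (\<lambda>t. f t [^] (n::nat))"
  by (induction n) (auto intro: germ_const germ_mult)

lemma Units_nat_pow: "x \<in> Units R \<Longrightarrow> x [^] (n::nat) \<in> Units R"
  by (induction n) auto

lemma germ_int_pow:
  assumes "germ f" "f t0 \<in> Units R" shows "germ (\<lambda>t. f t [^] (k::int))"
proof (cases "k < 0")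
  case True
  have "(\<lambda>t. f t [^] k) = (\<lambda>t. inv (f t [^] nat (- k)))"
    using True by (simp only: int_pow_def2 if_True)
  then show ?thesis
    using germ_inv[OF germ_nat_pow[OF assms(1)] Units_nat_pow[OF assms(2)]] by (simp only:)
next
  case False
  have "(\<lambda>t. f t [^] k) = (\<lambda>t. f t [^] nat k)"
    using False by (simp only: int_pow_def2 if_False)
  then show ?thesis using germ_nat_pow[OF assms(1)] by (simp only:)
qed

text \<open>A word value is built from products and inverses, so it depends rationally on the parameter.\<close>

lemma germ_word_eval:
  assumes "\<And>i. germ (\<lambda>t. c t i)" "\<And>i. c t0 i \<in> Units R"
  shows "germ (\<lambda>t. word_eval R (c t) w)"
proof (induction w)
  case Nil
  then show ?case by (simp add: word_eval_def germ_const)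
next
  case (Cons p w)
  obtain i k where p: "p = (i, k)" by fastforce
  have e: "word_eval R (c t) (p # w) = c t i [^] k \<otimes> word_eval R (c t) w" for t
    by (simp add: word_eval_def p)
  show ?case unfolding e using Cons assms germ_int_pow by (intro germ_mult) auto
qed

end

section \<open>Self-centralizing subfields\<close>

context skew_field
begin

lemma inv_nonzero:
  assumes "x \<in> carrier R" "x \<noteq> \<zero>"
  shows "inv x \<in> carrier R" "x \<otimes> inv x = \<one>" "inv x \<otimes> x = \<one>" "inv x \<noteq> \<zero>"
proof -
  have U: "x \<in> Units R" using assms nonzero_Units by simp
  then show "inv x \<in> carrier R" "x \<otimes> inv x = \<one>" "inv x \<otimes> x = \<one>" by simp_all
  have "inv x \<in> Units R" using U by simp
  then show "inv x \<noteq> \<zero>" using nonzero_Units by simp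
qed

lemma one_not_zero [simp]: "\<one> \<noteq> \<zero>"
  using Units_one_closed nonzero_Units by blast

lemma eq_of_minus_zero:
  assumes "x \<in> carrier R" "y \<in> carrier R" "x \<oplus> \<ominus> y = \<zero>" shows "x = y"
proof -
  have "x = (x \<oplus> \<ominus> y) \<oplus> y" using assms(1,2) by (simp add: a_assoc l_neg)
  then show ?thesis using assms(2,3) by simp
qed

lemma nonzero_mult:
  assumes "x \<in> carrier R" "y \<in> carrier R" "x \<noteq> \<zero>" "y \<noteq> \<zero>" shows "x \<otimes> y \<noteq> \<zero>"
  using assms nonzero_Units Units_m_closed by blast

definition centralizer :: "'a set \<Rightarrow> 'a set" where
  "centralizer S = {x \<in> carrier R. \<forall>s\<in>S. x \<otimes> s = s \<otimes> x}"

lemma centralizer_inv: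
  assumes "S \<subseteq> carrier R" "x \<in> centralizer S" "x \<noteq> \<zero>" shows "inv x \<in> centralizer S"
proof -
  have x: "x \<in> carrier R" using assms(2) by (simp add: centralizer_def)
  note i = inv_nonzero[OF x assms(3)]
  have "inv x \<otimes> s = s \<otimes> inv x" if "s \<in> S" for s
  proof -
    have s: "s \<in> carrier R" using that assms(1) by auto
    have e: "x \<otimes> s = s \<otimes> x" using assms(2) that by (simp add: centralizer_def)
    have "inv x \<otimes> s = inv x \<otimes> (s \<otimes> x) \<otimes> inv x" using x s i by (simp add: m_assoc)
    also have "\<dots> = inv x \<otimes> (x \<otimes> s) \<otimes> inv x" unfolding e ..
    also have "\<dots> = (inv x \<otimes> x) \<otimes> s \<otimes> inv x" using x s i(1) by (simp add: m_assoc)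
    finally show ?thesis using s i by simp
  qed
  then show ?thesis using i by (simp add: centralizer_def)
qed

lemma centralizer_subring:
  assumes "S \<subseteq> carrier R" shows "subring (centralizer S) R"
proof (rule subringI)
  show "\<ominus> h \<in> centralizer S" if "h \<in> centralizer S" for h
    using that assms by (auto simp: centralizer_def subset_iff l_minus r_minus)
  show "h \<otimes> k \<in> centralizer S" if "h \<in> centralizer S" "k \<in> centralizer S" for h k
  proof -
    have hk: "h \<in> carrier R" "k \<in> carrier R" using that by (auto simp: centralizer_def)
    have "(h \<otimes> k) \<otimes> s = s \<otimes> (h \<otimes> k)" if s: "s \<in> S" for s
    proof -
      have sc: "s \<in> carrier R" using s assms by auto
      have e: "h \<otimes> s = s \<otimes> h" "k \<otimes> s = s \<otimes> k"
        using s \<open>h \<in> centralizer S\<close> \<open>k \<in> centralizer S\<close> by (auto simp: centralizer_def)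
      have "(h \<otimes> k) \<otimes> s = h \<otimes> (k \<otimes> s)" using hk sc by (simp add: m_assoc)
      also have "\<dots> = (h \<otimes> s) \<otimes> k" unfolding e(2) using hk sc by (simp add: m_assoc)
      also have "\<dots> = s \<otimes> (h \<otimes> k)" unfolding e(1) using hk sc by (simp add: m_assoc)
      finally show ?thesis .
    qed
    then show ?thesis using hk by (simp add: centralizer_def)
  qed
  show "h \<oplus> k \<in> centralizer S" if "h \<in> centralizer S" "k \<in> centralizer S" for h k
    using that assms by (auto simp: centralizer_def subset_iff l_distr r_distr)
qed (use assms in \<open>auto simp: centralizer_def subset_iff\<close>)

lemma subfieldI_skew:
  assumes K: "subring K R" and comm: "\<And>x y. x \<in> K \<Longrightarrow> y \<in> K \<Longrightarrow> x \<otimes> y = y \<otimes> x"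
    and inv: "\<And>x. x \<in> K \<Longrightarrow> x \<noteq> \<zero> \<Longrightarrow> inv x \<in> K"
  shows "subfield K R"
proof (rule subfieldI)
  note KE = subringE[OF K]
  show "subcring K R" by (rule subcringI[OF K comm])
  show "Units (R\<lparr>carrier := K\<rparr>) = K - {\<zero>}"
  proof
    show "Units (R\<lparr>carrier := K\<rparr>) \<subseteq> K - {\<zero>}"
    proof
      fix x assume "x \<in> Units (R\<lparr>carrier := K\<rparr>)"
      then obtain y where y: "x \<in> K" "y \<in> K" "x \<otimes> y = \<one>" by (auto simp: Units_def)
      then have "y \<in> carrier R" using KE(1) by auto
      then have "x \<noteq> \<zero>" using y one_not_zero by (metis l_null)
      then show "x \<in> K - {\<zero>}" using y by simp
    qed
    show "K - {\<zero>} \<subseteq> Units (R\<lparr>carrier := K\<rparr>)"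
    proof
      fix x assume x: "x \<in> K - {\<zero>}"
      then have "x \<in> carrier R" using KE(1) by auto
      from inv_nonzero[OF this] x inv show "x \<in> Units (R\<lparr>carrier := K\<rparr>)"
        by (auto simp: Units_def intro!: bexI[of _ "inv x"])
    qed
  qed
qed

lemma center_eq_centralizer: "ring_center R = centralizer (carrier R)"
  unfolding ring_center_def centralizer_def ..

lemma centralizer_anti: "S \<subseteq> T \<Longrightarrow> centralizer T \<subseteq> centralizer S"
  unfolding centralizer_def by blast

lemma centralizerD: "x \<in> centralizer S \<Longrightarrow> s \<in> S \<Longrightarrow> x \<otimes> s = s \<otimes> x"
  and centralizer_carrier: "centralizer S \<subseteq> carrier R"
  by (auto simp: centralizer_def)

text \<open>Such a set is commutative because it lies in its own centralizer, and a centralizer is closed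
  under the field operations.\<close>

lemma self_centralizing_subfield:
  assumes "centralizer K = K" shows "subfield K R"
proof -
  have K: "K \<subseteq> carrier R" using centralizer_carrier[of K] unfolding assms .
  show ?thesis
  proof (rule subfieldI_skew)
    show "subring K R" using centralizer_subring[OF K] unfolding assms .
    show "x \<otimes> y = y \<otimes> x" if "x \<in> K" "y \<in> K" for x y
      using centralizerD[of x K y] that unfolding assms by blast
    show "inv x \<in> K" if "x \<in> K" "x \<noteq> \<zero>" for x
      using centralizer_inv[OF K, of x] that unfolding assms by blast
  qed
qed

lemma center_subfield: "subfield (ring_center R) R"
proof (rule subfieldI_skew)
  show "subring (ring_center R) R"
    using centralizer_subring[of "carrier R"] by (simp add: center_eq_centralizer)
  show "x \<otimes> y = y \<otimes> x" if "x \<in> ring_center R" "y \<in> ring_center R" for x y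
    using centralizerD[of x "carrier R" y] centralizer_carrier[of "carrier R"] that
    unfolding center_eq_centralizer by blast
  show "inv x \<in> ring_center R" if "x \<in> ring_center R" "x \<noteq> \<zero>" for x
    using centralizer_inv[of "carrier R" x] that by (simp add: center_eq_centralizer)
qed

text \<open>A maximal commutative set containing \<open>S\<close> exists by Zorn's lemma, and an element commuting with
  all of it can be added to it.\<close>

lemma exists_self_centralizing:
  assumes "S \<subseteq> carrier R" "\<And>x y. x \<in> S \<Longrightarrow> y \<in> S \<Longrightarrow> x \<otimes> y = y \<otimes> x"
  obtains K where "S \<subseteq> K" "centralizer K = K"
proof -
  define cm where "cm x y \<longleftrightarrow> x \<otimes> y = y \<otimes> x" for x y
  have cm_sym: "cm x y \<Longrightarrow> cm y x" and cm_refl: "cm x x" for x y by (simp_all add: cm_def)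
  have C_cm: "centralizer T = {x \<in> carrier R. \<forall>y\<in>T. cm x y}" for T
    unfolding centralizer_def cm_def ..
  define A where "A = {K. S \<subseteq> K \<and> K \<subseteq> carrier R \<and> (\<forall>x\<in>K. \<forall>y\<in>K. cm x y)}"
  have AI: "T \<in> A" if "S \<subseteq> T" "T \<subseteq> carrier R" "\<And>x y. x \<in> T \<Longrightarrow> y \<in> T \<Longrightarrow> cm x y" for T
    using that unfolding A_def by simp
  have AD: "S \<subseteq> T" "T \<subseteq> carrier R" "x \<in> T \<Longrightarrow> y \<in> T \<Longrightarrow> cm x y" if "T \<in> A" for T x y
    using that unfolding A_def by simp_all
  have "\<exists>M\<in>A. \<forall>Y\<in>A. M \<subseteq> Y \<longrightarrow> Y = M"
  proof (rule subset_Zorn_nonempty)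
    have "S \<in> A" using assms by (intro AI) (simp_all add: cm_def)
    then show "A \<noteq> {}" by blast
    fix \<C> assume C: "\<C> \<noteq> {}" "subset.chain A \<C>"
    then have sub: "\<C> \<subseteq> A" and tot: "\<And>U Y. U \<in> \<C> \<Longrightarrow> Y \<in> \<C> \<Longrightarrow> U \<subseteq> Y \<or> Y \<subseteq> U"
      unfolding subset_chain_def by blast+
    show "\<Union>\<C> \<in> A"
    proof (rule AI)
      obtain T where "T \<in> \<C>" using C(1) by blast
      then show "S \<subseteq> \<Union>\<C>" using sub AD(1) by blast
      show "\<Union>\<C> \<subseteq> carrier R" using sub AD(2) by blast
      fix x y assume xy: "x \<in> \<Union>\<C>" "y \<in> \<Union>\<C>"
      obtain U Y where UY: "x \<in> U" "U \<in> \<C>" "y \<in> Y" "Y \<in> \<C>" using xy by blast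
      then obtain W where "W \<in> \<C>" "x \<in> W" "y \<in> W" using tot[of U Y] by blast
      then show "cm x y" using sub AD(3)[of W x y] by blast
    qed
  qed
  then obtain K where K: "K \<in> A" "\<forall>Y\<in>A. K \<subseteq> Y \<longrightarrow> Y = K" by (rule bexE)
  have "x \<in> K" if x: "x \<in> centralizer K" for x
  proof -
    have "x \<in> carrier R" "\<And>y. y \<in> K \<Longrightarrow> cm x y" using x unfolding C_cm by simp_all
    then have "insert x K \<in> A"
      using AD[OF K(1)] cm_sym cm_refl by (intro AI) auto
    then have "insert x K = K" using K(2) by blast
    then show ?thesis by blast
  qed
  moreover have "K \<subseteq> centralizer K" using AD(2,3)[OF K(1)] unfolding C_cm by blast
  ultimately have "centralizer K = K" by blast
  then show ?thesis using that AD(1)[OF K(1)] by blast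
qed

text \<open>Centralizers are closed under the operations that generate a field. Used twice, with \<open>T\<close> the
  set of generators and then with \<open>T\<close> the generated set, this makes the field generated by
  commuting elements commutative.\<close>

lemma generate_field_in_centralizer:
  assumes "S \<subseteq> carrier R" "T \<subseteq> carrier R" "S \<subseteq> centralizer T"
  shows "generate_field R S \<subseteq> centralizer T"
proof
  note E = subringE[OF centralizer_subring[OF assms(2)]]
  fix x assume "x \<in> generate_field R S"
  then show "x \<in> centralizer T"
    by induction (use E assms centralizer_inv in auto)
qed

lemma generate_field_subfield:
  assumes S: "S \<subseteq> carrier R" "\<And>x y. x \<in> S \<Longrightarrow> y \<in> S \<Longrightarrow> x \<otimes> y = y \<otimes> x"
  shows "subfield (generate_field R S) R"
proof (rule subfieldI_skew)
  let ?H = "generate_field R S"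
  have "S \<subseteq> centralizer S" using S unfolding centralizer_def by blast
  then have 1: "?H \<subseteq> centralizer S" by (rule generate_field_in_centralizer[OF S(1) S(1)])
  then have Hc: "?H \<subseteq> carrier R" using centralizer_carrier by blast
  have "S \<subseteq> centralizer ?H" using 1 S(1) unfolding centralizer_def by fastforce
  then have 2: "?H \<subseteq> centralizer ?H" by (rule generate_field_in_centralizer[OF S(1) Hc])
  then show "x \<otimes> y = y \<otimes> x" if "x \<in> ?H" "y \<in> ?H" for x y
    using that centralizerD by blast
  show "subring ?H R"
    using Hc by (intro subringI) (auto intro: generate_field.intros)
  show "inv x \<in> ?H" if "x \<in> ?H" "x \<noteq> \<zero>" for x
    using that by (rule generate_field.m_inv)
qed

section \<open>Density\<close>

definition left_independent :: "'i set \<Rightarrow> ('i \<Rightarrow> 'a) \<Rightarrow> 'a set \<Rightarrow> bool" where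
  "left_independent I e C \<longleftrightarrow> (\<forall>u. (\<forall>i\<in>I. u i \<in> C) \<and> (\<Oplus>i\<in>I. u i \<otimes> e i) = \<zero> \<longrightarrow> (\<forall>i\<in>I. u i = \<zero>))"

lemma left_independentD:
  assumes "left_independent I e C" "\<forall>i\<in>I. u i \<in> C" "(\<Oplus>i\<in>I. u i \<otimes> e i) = \<zero>" "i \<in> I"
  shows "u i = \<zero>"
  using assms unfolding left_independent_def by blast

lemma left_independent_mono:
  assumes "left_independent (insert j I) e C" "j \<notin> I" "finite I" "\<zero> \<in> C" "C \<subseteq> carrier R"
    "\<And>i. i \<in> insert j I \<Longrightarrow> e i \<in> carrier R"
  shows "left_independent I e C"
  unfolding left_independent_def
proof (intro allI impI)
  fix u assume u: "(\<forall>i\<in>I. u i \<in> C) \<and> (\<Oplus>i\<in>I. u i \<otimes> e i) = \<zero>"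
  let ?u = "u(j := \<zero>)"
  have "(\<Oplus>i\<in>insert j I. ?u i \<otimes> e i) = ?u j \<otimes> e j \<oplus> (\<Oplus>i\<in>I. ?u i \<otimes> e i)"
    using assms u by (intro finsum_insert) (auto simp: subset_iff)
  also have "(\<Oplus>i\<in>I. ?u i \<otimes> e i) = (\<Oplus>i\<in>I. u i \<otimes> e i)"
    using assms u by (intro finsum_cong') (auto simp: subset_iff)
  finally have "(\<Oplus>i\<in>insert j I. ?u i \<otimes> e i) = \<zero>" using u assms(6) by simp
  moreover have "\<forall>i\<in>insert j I. ?u i \<in> C" using u assms(4) by simp
  ultimately have "\<forall>i\<in>insert j I. ?u i = \<zero>" using assms(1) unfolding left_independent_def by blast
  then show "\<forall>i\<in>I. u i = \<zero>" using assms(2) by (metis fun_upd_other insertCI)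
qed

text \<open>The ring of operators generated by left multiplications by \<open>B\<close> and all right multiplications.
  For this ring the division ring is a simple module whose endomorphisms are the left
  multiplications by the centralizer of \<open>B\<close>. Functions are identified when they agree on the
  carrier.\<close>

inductive_set bimod_ops :: "'a set \<Rightarrow> ('a \<Rightarrow> 'a) set" for B where
  ops_mult: "b \<in> B \<Longrightarrow> c \<in> carrier R \<Longrightarrow> (\<lambda>x. b \<otimes> x \<otimes> c) \<in> bimod_ops B"
| ops_add: "f \<in> bimod_ops B \<Longrightarrow> g \<in> bimod_ops B \<Longrightarrow> (\<lambda>x. f x \<oplus> g x) \<in> bimod_ops B"
| ops_cong: "f \<in> bimod_ops B \<Longrightarrow> (\<And>x. x \<in> carrier R \<Longrightarrow> g x = f x) \<Longrightarrow> g \<in> bimod_ops B"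

context
  fixes B assumes B: "subring B R"
begin

lemma B_carrier: "b \<in> B \<Longrightarrow> b \<in> carrier R"
  using subringE(1)[OF B] by auto

lemma bimod_ops_closed: "f \<in> bimod_ops B \<Longrightarrow> x \<in> carrier R \<Longrightarrow> f x \<in> carrier R"
  by (induction rule: bimod_ops.induct) (auto simp: B_carrier)

lemma bimod_ops_add_hom:
  "f \<in> bimod_ops B \<Longrightarrow> x \<in> carrier R \<Longrightarrow> y \<in> carrier R \<Longrightarrow> f (x \<oplus> y) = f x \<oplus> f y"
proof (induction rule: bimod_ops.induct)
  case (ops_add f g)
  then show ?case using bimod_ops_closed[of f] bimod_ops_closed[of g] by (simp add: a_ac)
qed (auto simp: B_carrier l_distr r_distr)

lemma bimod_ops_rmult:
  "f \<in> bimod_ops B \<Longrightarrow> d \<in> carrier R \<Longrightarrow> (\<lambda>x. f x \<otimes> d) \<in> bimod_ops B"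
proof (induction rule: bimod_ops.induct)
  case (ops_mult b c)
  then show ?case
    by (intro bimod_ops.ops_cong[OF bimod_ops.ops_mult[of b B "c \<otimes> d"]]) (auto simp: m_assoc B_carrier)
next
  case (ops_add f g)
  then show ?case
    by (intro bimod_ops.ops_cong[OF bimod_ops.ops_add[OF ops_add.IH]]) (auto simp: l_distr bimod_ops_closed)
next
  case (ops_cong f g)
  then show ?case by (intro bimod_ops.ops_cong[OF ops_cong.IH]) auto
qed

lemma bimod_ops_lmult:
  "f \<in> bimod_ops B \<Longrightarrow> k \<in> B \<Longrightarrow> (\<lambda>x. k \<otimes> f x) \<in> bimod_ops B"
proof (induction rule: bimod_ops.induct)
  case (ops_mult b c)
  then have "k \<otimes> b \<in> B" using subringE(6)[OF B] by blast
  then show ?case using ops_mult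
    by (intro bimod_ops.ops_cong[OF bimod_ops.ops_mult[of "k \<otimes> b" B c]]) (auto simp: m_assoc B_carrier)
next
  case (ops_add f g)
  then show ?case
    by (intro bimod_ops.ops_cong[OF bimod_ops.ops_add[OF ops_add.IH]]) (auto simp: r_distr bimod_ops_closed B_carrier)
next
  case (ops_cong f g)
  then show ?case by (intro bimod_ops.ops_cong[OF ops_cong.IH]) auto
qed

lemma bimod_ops_zero: "(\<lambda>x. \<zero>) \<in> bimod_ops B"
  by (rule bimod_ops.ops_cong[OF bimod_ops.ops_mult[of \<one> B \<zero>]]) (use subringE(3)[OF B] in auto)

lemma bimod_ops_finsum:
  assumes "finite I" "\<And>i. i \<in> I \<Longrightarrow> f i \<in> bimod_ops B"
  shows "(\<lambda>x. \<Oplus>i\<in>I. f i x) \<in> bimod_ops B"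
  using assms
proof (induction I)
  case empty
  then show ?case by (intro bimod_ops.ops_cong[OF bimod_ops_zero]) simp
next
  case (insert i I)
  then have "(\<lambda>x. f i x \<oplus> (\<Oplus>i\<in>I. f i x)) \<in> bimod_ops B" by (intro bimod_ops.ops_add) auto
  then show ?case
  proof (rule bimod_ops.ops_cong)
    fix x assume x: "x \<in> carrier R"
    have "f i x \<in> carrier R" "(\<lambda>i. f i x) \<in> I \<rightarrow> carrier R"
      using insert.prems x bimod_ops_closed by auto
    then show "(\<Oplus>i\<in>insert i I. f i x) = f i x \<oplus> (\<Oplus>i\<in>I. f i x)"
      using insert.hyps by (intro finsum_insert)
  qed
qed

text \<open>The sum is additive in \<open>f\<close> and compatible with right multiplication, so it suffices that it
  vanishes for the left multiplications \<open>x \<mapsto> b \<otimes> x\<close>.\<close>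

lemma annihilator_bimod_ops:
  assumes I: "finite I" and e: "\<And>i. i \<in> I \<Longrightarrow> e i \<in> carrier R"
    and u: "\<And>i. i \<in> I \<Longrightarrow> u i \<in> carrier R"
    and ann: "\<And>b. b \<in> B \<Longrightarrow> (\<Oplus>i\<in>I. u i \<otimes> (b \<otimes> e i)) = \<zero>"
    and "f \<in> bimod_ops B"
  shows "(\<Oplus>i\<in>I. u i \<otimes> f (e i)) = \<zero>"
  using assms(5)
proof (induction rule: bimod_ops.induct)
  case (ops_mult b c)
  have "(\<Oplus>i\<in>I. u i \<otimes> (b \<otimes> e i \<otimes> c)) = (\<Oplus>i\<in>I. (u i \<otimes> (b \<otimes> e i)) \<otimes> c)"
    using e u ops_mult by (intro finsum_cong') (auto simp: m_assoc B_carrier)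
  also have "\<dots> = (\<Oplus>i\<in>I. u i \<otimes> (b \<otimes> e i)) \<otimes> c"
    using e u ops_mult I by (intro finsum_ldistr[symmetric]) (auto simp: B_carrier)
  finally show ?case using ann[OF ops_mult(1)] ops_mult(2) by simp
next
  case (ops_add f g)
  have "(\<Oplus>i\<in>I. u i \<otimes> (f (e i) \<oplus> g (e i))) = (\<Oplus>i\<in>I. u i \<otimes> f (e i) \<oplus> u i \<otimes> g (e i))"
    using e u ops_add bimod_ops_closed by (intro finsum_cong') (auto simp: r_distr)
  also have "\<dots> = (\<Oplus>i\<in>I. u i \<otimes> f (e i)) \<oplus> (\<Oplus>i\<in>I. u i \<otimes> g (e i))"
    using e u ops_add bimod_ops_closed by (intro finsum_addf) auto
  finally show ?case using ops_add.IH by simp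
next
  case (ops_cong f g)
  have "(\<Oplus>i\<in>I. u i \<otimes> g (e i)) = (\<Oplus>i\<in>I. u i \<otimes> f (e i))"
    using e u ops_cong bimod_ops_closed by (intro finsum_cong') auto
  then show ?case using ops_cong.IH by simp
qed

text \<open>Jacobson's density theorem for this module. Given dual operators for the old elements,
  subtract from an operator \<open>f\<close> the combination of the dual operators that agrees with it on the
  old elements. The result kills the old elements. If it always killed the new element \<open>e r\<close> as
  well, then \<open>e r\<close> would be a combination of the old ones with coefficients \<open>s i (e r)\<close>, and
  these commute with \<open>B\<close>, contrary to independence.\<close>

lemma jacobson_density:
  assumes "finite I" and "\<And>i. i \<in> I \<Longrightarrow> e i \<in> carrier R"
    and "left_independent I e (centralizer B)"
  shows "\<exists>s. \<forall>i\<in>I. s i \<in> bimod_ops B \<and> (\<forall>j\<in>I. s i (e j) = (if j = i then \<one> else \<zero>))"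
  using assms
proof (induction I)
  case empty
  then show ?case by simp
next
  case (insert r I)
  have Bc: "B \<subseteq> carrier R" using B_carrier by auto
  have e: "e i \<in> carrier R" if "i \<in> insert r I" for i using insert.prems(1) that .
  note CE = subringE[OF centralizer_subring[OF Bc]]
  have indI: "left_independent I e (centralizer B)"
    by (rule left_independent_mono[OF insert.prems(2) insert.hyps(2,1) CE(2,1)]) (use e in auto)
  obtain s where s: "\<And>i. i \<in> I \<Longrightarrow> s i \<in> bimod_ops B"
    "\<And>i j. i \<in> I \<Longrightarrow> j \<in> I \<Longrightarrow> s i (e j) = (if j = i then \<one> else \<zero>)"
    using insert.IH[OF _ indI] e by blast
  have sc: "s i x \<in> carrier R" if "i \<in> I" "x \<in> carrier R" for i x
    using bimod_ops_closed s(1) that by blast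
  define cut where "cut f x = f x \<oplus> \<ominus> (\<Oplus>i\<in>I. s i x \<otimes> f (e i))" for f x
  have fc: "f x \<in> carrier R" if "f \<in> bimod_ops B" "x \<in> carrier R" for f x
    using bimod_ops_closed that by blast
  have sumc: "(\<Oplus>i\<in>I. s i x \<otimes> f (e i)) \<in> carrier R" if "f \<in> bimod_ops B" "x \<in> carrier R" for f x
    using that e fc sc by (intro finsum_closed) auto
  have cut_op: "cut f \<in> bimod_ops B" if f: "f \<in> bimod_ops B" for f
  proof -
    have "(\<lambda>x. f x \<oplus> (\<Oplus>i\<in>I. s i x \<otimes> f (e i)) \<otimes> \<ominus> \<one>) \<in> bimod_ops B"
      using f e fc s(1) insert.hyps(1)
      by (intro bimod_ops.ops_add bimod_ops_rmult bimod_ops_finsum) auto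
    then show ?thesis
    proof (rule bimod_ops.ops_cong)
      fix x assume "x \<in> carrier R"
      then show "cut f x = f x \<oplus> (\<Oplus>i\<in>I. s i x \<otimes> f (e i)) \<otimes> \<ominus> \<one>"
        unfolding cut_def using sumc[OF f] by (simp add: r_minus)
    qed
  qed
  have cut_zero: "cut f (e j) = \<zero>" if f: "f \<in> bimod_ops B" and j: "j \<in> I" for f j
  proof -
    have "(\<Oplus>i\<in>I. s i (e j) \<otimes> f (e i)) = (\<Oplus>i\<in>I. if j = i then f (e i) else \<zero>)"
      using f j e fc s(2) by (intro finsum_cong') auto
    also have "\<dots> = f (e j)"
      using insert.hyps(1) j e fc[OF f] by (intro finsum_singleton) auto
    finally show ?thesis unfolding cut_def using fc[OF f] e j by (simp add: r_neg)
  qed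
  \<comment> \<open>Some operator killing the old elements does not kill the new one; otherwise the new one
    would be a combination of the old ones with coefficients centralizing \<open>B\<close>.\<close>
  have "\<exists>f\<in>bimod_ops B. cut f (e r) \<noteq> \<zero>"
  proof (rule ccontr)
    assume none: "\<not> ?thesis"
    have *: "f (e r) = (\<Oplus>i\<in>I. s i (e r) \<otimes> f (e i))" if "f \<in> bimod_ops B" for f
    proof (rule eq_of_minus_zero)
      show "f (e r) \<oplus> \<ominus> (\<Oplus>i\<in>I. s i (e r) \<otimes> f (e i)) = \<zero>"
        using none that unfolding cut_def by blast
    qed (use fc[OF that e, of r] sumc[OF that e, of r] in simp_all)
    define w where "w i = s i (e r)" for i
    have wc: "w i \<in> carrier R" if "i \<in> I" for i unfolding w_def using sc e that by simp
    have comm: "w i \<otimes> k = k \<otimes> w i" if i: "i \<in> I" and k: "k \<in> B" for i k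
    proof -
      have kc: "k \<in> carrier R" using k by (rule B_carrier)
      have z: "(\<Oplus>j\<in>I. (w j \<otimes> k \<oplus> \<ominus> (k \<otimes> w j)) \<otimes> f (e j)) = \<zero>" if f: "f \<in> bimod_ops B" for f
      proof -
        have "(\<Oplus>j\<in>I. (w j \<otimes> k \<oplus> \<ominus> (k \<otimes> w j)) \<otimes> f (e j)) =
          (\<Oplus>j\<in>I. w j \<otimes> (k \<otimes> f (e j)) \<oplus> \<ominus> k \<otimes> (w j \<otimes> f (e j)))"
          using wc kc fc[OF f] e by (intro finsum_cong') (auto simp: l_distr l_minus m_assoc)
        also have "\<dots> = (\<Oplus>j\<in>I. w j \<otimes> (k \<otimes> f (e j))) \<oplus> (\<Oplus>j\<in>I. \<ominus> k \<otimes> (w j \<otimes> f (e j)))"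
          using wc kc fc[OF f] e by (intro finsum_addf) auto
        also have "(\<Oplus>j\<in>I. \<ominus> k \<otimes> (w j \<otimes> f (e j))) = \<ominus> k \<otimes> (\<Oplus>j\<in>I. w j \<otimes> f (e j))"
          using wc kc fc[OF f] e insert.hyps(1) by (intro finsum_rdistr[symmetric]) auto
        also have "(\<Oplus>j\<in>I. w j \<otimes> (k \<otimes> f (e j))) = k \<otimes> f (e r)"
          using *[OF bimod_ops_lmult[OF f k]] unfolding w_def by simp
        also have "(\<Oplus>j\<in>I. w j \<otimes> f (e j)) = f (e r)" using *[OF f] unfolding w_def by simp
        finally show ?thesis using kc fc[OF f e[of r]] by (simp add: l_minus r_neg)
      qed
      have "(\<Oplus>j\<in>I. (w j \<otimes> k \<oplus> \<ominus> (k \<otimes> w j)) \<otimes> s i (e j)) =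
        (\<Oplus>j\<in>I. if i = j then w j \<otimes> k \<oplus> \<ominus> (k \<otimes> w j) else \<zero>)"
        using wc kc s(2)[OF i] by (intro finsum_cong') auto
      also have "\<dots> = w i \<otimes> k \<oplus> \<ominus> (k \<otimes> w i)"
        using insert.hyps(1) i wc kc by (intro finsum_singleton) auto
      finally have "w i \<otimes> k \<oplus> \<ominus> (k \<otimes> w i) = \<zero>" using z[OF s(1)[OF i]] by simp
      from eq_of_minus_zero[OF _ _ this] show ?thesis using wc[OF i] kc by simp
    qed
    have one: "(\<lambda>x. \<one> \<otimes> x \<otimes> \<one>) \<in> bimod_ops B" using subringE(3)[OF B] by (intro bimod_ops.ops_mult) auto
    have er: "e r = (\<Oplus>i\<in>I. w i \<otimes> e i)"
    proof -
      have "(\<Oplus>i\<in>I. w i \<otimes> (\<one> \<otimes> e i \<otimes> \<one>)) = (\<Oplus>i\<in>I. w i \<otimes> e i)"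
        using e wc by (intro finsum_cong') auto
      then show ?thesis using *[OF one] e[of r] unfolding w_def by simp
    qed
    let ?u = "\<lambda>i. if i = r then \<ominus> \<one> else w i"
    have "\<forall>i\<in>insert r I. ?u i \<in> centralizer B"
    proof
      fix i assume i: "i \<in> insert r I"
      show "?u i \<in> centralizer B"
      proof (cases "i = r")
        case True then show ?thesis using CE(5)[OF CE(3)] by simp
      next
        case False
        then have "w i \<in> centralizer B" using i wc[of i] comm[of i] unfolding centralizer_def by blast
        then show ?thesis using False by simp
      qed
    qed
    moreover have "(\<Oplus>i\<in>insert r I. ?u i \<otimes> e i) = \<zero>"
    proof -
      have "(\<Oplus>i\<in>insert r I. ?u i \<otimes> e i) = ?u r \<otimes> e r \<oplus> (\<Oplus>i\<in>I. ?u i \<otimes> e i)"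
        using insert.hyps e wc by (intro finsum_insert) auto
      also have "(\<Oplus>i\<in>I. ?u i \<otimes> e i) = (\<Oplus>i\<in>I. w i \<otimes> e i)"
        using insert.hyps e wc by (intro finsum_cong') auto
      also have "\<dots> = e r" using er by simp
      finally show ?thesis using e[of r] by (simp add: l_minus l_neg)
    qed
    ultimately have "?u r = \<zero>"
      by (rule left_independentD[OF insert.prems(2), of ?u r]) simp
    then have "\<one> = \<zero>" using minus_minus[OF one_closed] by simp
    then show False by simp
  qed
  then obtain f where f: "f \<in> bimod_ops B" "cut f (e r) \<noteq> \<zero>" by blast
  define g where "g x = cut f x \<otimes> inv (cut f (e r))" for x
  have cfc: "cut f x \<in> carrier R" if "x \<in> carrier R" for x using fc[OF cut_op[OF f(1)] that] .
  note ic = inv_nonzero[OF cfc[OF e[OF insertI1]] f(2)]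
  have g: "g \<in> bimod_ops B" "g (e r) = \<one>" "\<And>j. j \<in> I \<Longrightarrow> g (e j) = \<zero>"
    unfolding g_def using bimod_ops_rmult[OF cut_op[OF f(1)] ic(1)] ic cut_zero[OF f(1)] by auto
  have gc: "g x \<in> carrier R" if "x \<in> carrier R" for x using fc[OF g(1) that] .
  define s' where "s' i = (if i = r then g else (\<lambda>x. s i x \<oplus> g x \<otimes> \<ominus> (s i (e r))))" for i
  have ser: "s i (e r) \<in> carrier R" if "i \<in> I" for i using sc that e by simp
  have "s' i \<in> bimod_ops B \<and> (\<forall>j\<in>insert r I. s' i (e j) = (if j = i then \<one> else \<zero>))"
    if i: "i \<in> insert r I" for i
  proof (cases "i = r")
    case True
    then show ?thesis using g insert.hyps(2) by (auto simp: s'_def)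
  next
    case False
    then have iI: "i \<in> I" using i by simp
    have "s' i \<in> bimod_ops B"
      using False s(1)[OF iI] g(1) ser[OF iI] by (auto simp: s'_def intro!: bimod_ops.ops_add bimod_ops_rmult)
    moreover have "s' i (e j) = (if j = i then \<one> else \<zero>)" if j: "j \<in> insert r I" for j
    proof (cases "j = r")
      case True
      then show ?thesis using False g(2) ser[OF iI] by (simp add: s'_def r_neg)
    next
      case jr: False
      then have jI: "j \<in> I" using j by simp
      show ?thesis using False s(2)[OF iI jI] g(3)[OF jI] ser[OF iI] by (simp add: s'_def)
    qed
    ultimately show ?thesis by blast
  qed
  then show ?case by blast
qed

text \<open>Density produces an operator that isolates the coefficient \<open>u i\<close>. In particular the maps
  \<open>x \<mapsto> u \<otimes> x \<otimes> e i\<close> are linearly independent over the division ring as soon as the \<open>e i\<close> are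
  independent over the center.\<close>

lemma annihilator_zero:
  assumes I: "finite I" and e: "\<And>i. i \<in> I \<Longrightarrow> e i \<in> carrier R"
    and ind: "left_independent I e (centralizer B)"
    and u: "\<And>i. i \<in> I \<Longrightarrow> u i \<in> carrier R"
    and ann: "\<And>b. b \<in> B \<Longrightarrow> (\<Oplus>i\<in>I. u i \<otimes> (b \<otimes> e i)) = \<zero>"
    and i: "i \<in> I"
  shows "u i = \<zero>"
proof -
  obtain s where s: "\<And>i. i \<in> I \<Longrightarrow> s i \<in> bimod_ops B"
    "\<And>i j. i \<in> I \<Longrightarrow> j \<in> I \<Longrightarrow> s i (e j) = (if j = i then \<one> else \<zero>)"
    using jacobson_density[OF I e ind] by blast
  have "(\<Oplus>j\<in>I. u j \<otimes> s i (e j)) = (\<Oplus>j\<in>I. if i = j then u j else \<zero>)"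
    using u s(2)[OF i] by (intro finsum_cong') auto
  also have "\<dots> = u i" using I i u by (intro finsum_singleton) auto
  finally show ?thesis using annihilator_bimod_ops[OF I e u ann s(1)[OF i]] by simp
qed

end

section \<open>Bases over a subfield\<close>

definition left_spanning :: "'i set \<Rightarrow> ('i \<Rightarrow> 'a) \<Rightarrow> 'a set \<Rightarrow> bool" where
  "left_spanning I e C \<longleftrightarrow>
     (\<forall>x\<in>carrier R. \<exists>u. (\<forall>i\<in>I. u i \<in> C) \<and> x = (\<Oplus>i\<in>I. u i \<otimes> e i))"

lemma left_dependence_solve:
  assumes K: "subfield K R" and J: "finite J" "j \<in> J" and e: "\<And>i. i \<in> J \<Longrightarrow> e i \<in> carrier R"
    and u: "\<And>i. i \<in> J \<Longrightarrow> u i \<in> K" "(\<Oplus>i\<in>J. u i \<otimes> e i) = \<zero>" "u j \<noteq> \<zero>"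
  shows "\<exists>w. (\<forall>i\<in>J - {j}. w i \<in> K) \<and> e j = (\<Oplus>i\<in>J - {j}. w i \<otimes> e i)"
proof -
  note KE = subringE[OF subfieldE(1)[OF K]]
  have uc: "u i \<in> carrier R" if "i \<in> J" for i using u(1)[OF that] KE(1) by blast
  note iv = inv_nonzero[OF uc[OF J(2)] u(3)]
  have iK: "inv (u j) \<in> K" using subfield_m_inv[OF K, of "u j"] u(1)[OF J(2)] u(3) by simp
  let ?w = "\<lambda>i. \<ominus> (inv (u j)) \<otimes> u i"
  let ?S = "\<Oplus>i\<in>J - {j}. u i \<otimes> e i"
  have S: "?S \<in> carrier R" using uc e by (intro finsum_closed) auto
  have "(\<Oplus>i\<in>insert j (J - {j}). u i \<otimes> e i) = u j \<otimes> e j \<oplus> ?S"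
    using J uc e by (intro finsum_insert) auto
  then have "u j \<otimes> e j \<oplus> ?S = \<zero>" using u(2) J(2) by (simp add: insert_absorb)
  then have eq: "u j \<otimes> e j = \<ominus> ?S"
    using S uc[OF J(2)] e[OF J(2)] by (intro minus_equality[symmetric]) auto
  have "e j = inv (u j) \<otimes> (u j \<otimes> e j)"
    using iv uc[OF J(2)] e[OF J(2)] by (simp add: m_assoc[symmetric])
  also have "\<dots> = \<ominus> (inv (u j)) \<otimes> ?S" unfolding eq using iv S by (simp add: l_minus r_minus)
  also have "\<dots> = (\<Oplus>i\<in>J - {j}. \<ominus> (inv (u j)) \<otimes> (u i \<otimes> e i))"
    using iv uc e J by (intro finsum_rdistr) auto
  also have "\<dots> = (\<Oplus>i\<in>J - {j}. ?w i \<otimes> e i)"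
    using iv uc e by (intro finsum_cong') (auto simp: m_assoc)
  finally have "e j = (\<Oplus>i\<in>J - {j}. ?w i \<otimes> e i)" .
  moreover have "\<forall>i\<in>J - {j}. ?w i \<in> K" using u(1) iK KE(5,6) by blast
  ultimately show ?thesis by (intro exI[of _ ?w]) blast
qed

text \<open>A spanning subfamily of least size is independent, since a dependence relation would make one
  of its members superfluous.\<close>

lemma exists_left_basis:
  assumes K: "subfield K R" and I: "finite I" and e: "\<And>i. i \<in> I \<Longrightarrow> e i \<in> carrier R"
    and sp: "left_spanning I e K"
  obtains J where "J \<subseteq> I" "left_spanning J e K" "left_independent J e K"
proof -
  note KE = subringE[OF subfieldE(1)[OF K]]
  define P where "P n \<longleftrightarrow> (\<exists>J\<subseteq>I. left_spanning J e K \<and> card J = n)" for n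
  have "P (card I)" using sp unfolding P_def by blast
  then have "P (LEAST n. P n)" by (rule LeastI)
  then obtain J where J: "J \<subseteq> I" "left_spanning J e K" "card J = (LEAST n. P n)"
    unfolding P_def by blast
  have fJ: "finite J" using J(1) I by (rule finite_subset)
  have eJ: "e i \<in> carrier R" if "i \<in> J" for i using J(1) e that by blast
  have "left_independent J e K"
    unfolding left_independent_def
  proof (intro allI impI ballI)
    fix u j assume u: "(\<forall>i\<in>J. u i \<in> K) \<and> (\<Oplus>i\<in>J. u i \<otimes> e i) = \<zero>" and j: "j \<in> J"
    show "u j = \<zero>"
    proof (rule ccontr)
      assume "u j \<noteq> \<zero>"
      then obtain w where w: "\<forall>i\<in>J - {j}. w i \<in> K" "e j = (\<Oplus>i\<in>J - {j}. w i \<otimes> e i)"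
        using left_dependence_solve[where u = u and e = e and J = J and j = j, OF K fJ j] eJ u by blast
      have wc: "w i \<in> carrier R" if "i \<in> J - {j}" for i using w(1) KE(1) that by blast
      have "left_spanning (J - {j}) e K"
        unfolding left_spanning_def
      proof
        fix x assume "x \<in> carrier R"
        then obtain v where v: "\<forall>i\<in>J. v i \<in> K" "x = (\<Oplus>i\<in>J. v i \<otimes> e i)"
          using J(2) unfolding left_spanning_def by blast
        have vc: "v i \<in> carrier R" if "i \<in> J" for i using v(1) KE(1) that by blast
        have "x = (\<Oplus>i\<in>insert j (J - {j}). v i \<otimes> e i)" using v(2) j by (simp add: insert_absorb)
        also have "\<dots> = v j \<otimes> e j \<oplus> (\<Oplus>i\<in>J - {j}. v i \<otimes> e i)"
          using fJ vc eJ j by (intro finsum_insert) auto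
        also have "v j \<otimes> e j = v j \<otimes> (\<Oplus>i\<in>J - {j}. w i \<otimes> e i)" using w(2) by simp
        also have "\<dots> = (\<Oplus>i\<in>J - {j}. v j \<otimes> (w i \<otimes> e i))"
          using fJ vc[OF j] eJ wc by (intro finsum_rdistr) auto
        also have "\<dots> \<oplus> (\<Oplus>i\<in>J - {j}. v i \<otimes> e i) = (\<Oplus>i\<in>J - {j}. v j \<otimes> (w i \<otimes> e i) \<oplus> v i \<otimes> e i)"
          using vc j eJ wc by (intro finsum_addf[symmetric]) auto
        also have "\<dots> = (\<Oplus>i\<in>J - {j}. (v j \<otimes> w i \<oplus> v i) \<otimes> e i)"
          using vc j eJ wc by (intro finsum_cong') (auto simp: l_distr m_assoc)
        finally have xs: "x = (\<Oplus>i\<in>J - {j}. (v j \<otimes> w i \<oplus> v i) \<otimes> e i)" .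
        have "\<forall>i\<in>J - {j}. v j \<otimes> w i \<oplus> v i \<in> K"
        proof
          fix i assume "i \<in> J - {j}"
          then show "v j \<otimes> w i \<oplus> v i \<in> K" using v(1) w(1) j by (intro KE(6,7)) simp_all
        qed
        then show "\<exists>u. (\<forall>i\<in>J - {j}. u i \<in> K) \<and> x = (\<Oplus>i\<in>J - {j}. u i \<otimes> e i)"
          by (intro exI[of _ "\<lambda>i. v j \<otimes> w i \<oplus> v i"] conjI xs)
      qed
      then have "P (card (J - {j}))" using J(1) unfolding P_def by blast
      then have "card J \<le> card (J - {j})" unfolding J(3) by (rule Least_le)
      then show False using card_Diff1_less[OF fJ j] by simp
    qed
  qed
  then show ?thesis using that J by blast
qed

text \<open>The span of a list in the sense of the library, rewritten with indexed sums.\<close>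

lemma left_spanning_of_Span:
  assumes F: "subfield F R" and Us: "set Us \<subseteq> carrier R" and sp: "Span F Us = carrier R"
  shows "left_spanning {..<length Us} (\<lambda>i. Us ! i) F"
  unfolding left_spanning_def
proof
  fix x assume "x \<in> carrier R"
  then have "x \<in> Span F Us" using sp by simp
  then obtain Ks where Ks: "length Ks = length Us" "set Ks \<subseteq> F" "x = combine Ks Us"
    using Span_eq_combine_set_length_version[OF F Us] by blast
  have "combine Ks Us = (\<Oplus>i\<in>{..<length Us}. Ks ! i \<otimes> Us ! i)"
    using Ks(1,2) Us
  proof (induction Ks Us rule: list_induct2)
    case Nil
    then show ?case by simp
  next
    case (Cons k Ks u Us)
    have c: "Ks ! i \<otimes> Us ! i \<in> carrier R" if "i < length Us" for i
      using that Cons.hyps Cons.prems subfieldE(3)[OF F] by (auto simp: subset_iff)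
    have ku: "k \<otimes> u \<in> carrier R" using Cons.prems subfieldE(3)[OF F] by auto
    have "(\<Oplus>i\<in>{..<Suc (length Us)}. (k # Ks) ! i \<otimes> (u # Us) ! i) =
      (\<Oplus>i\<in>insert 0 (Suc ` {..<length Us}). (k # Ks) ! i \<otimes> (u # Us) ! i)"
      by (simp add: lessThan_Suc_eq_insert_0)
    also have "\<dots> = k \<otimes> u \<oplus> (\<Oplus>i\<in>Suc ` {..<length Us}. (k # Ks) ! i \<otimes> (u # Us) ! i)"
      using c ku by (subst finsum_insert) auto
    also have "(\<Oplus>i\<in>Suc ` {..<length Us}. (k # Ks) ! i \<otimes> (u # Us) ! i) =
      (\<Oplus>i\<in>{..<length Us}. Ks ! i \<otimes> Us ! i)"
      using c by (subst finsum_reindex) auto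
    finally show ?case using Cons.IH Cons.prems by simp
  qed
  moreover have "\<forall>i\<in>{..<length Us}. Ks ! i \<in> F" using Ks(1,2) by auto
  ultimately show "\<exists>u. (\<forall>i\<in>{..<length Us}. u i \<in> F) \<and> x = (\<Oplus>i\<in>{..<length Us}. u i \<otimes> Us ! i)"
    using Ks(3) by (intro exI[of _ "\<lambda>i. Ks ! i"]) simp
qed

lemma left_spanning_mono: "left_spanning I e F \<Longrightarrow> F \<subseteq> K \<Longrightarrow> left_spanning I e K"
  unfolding left_spanning_def by blast

lemma exists_enumerated_basis:
  assumes K: "subfield K R" and d: "\<And>i. i < (N::nat) \<Longrightarrow> d i \<in> carrier R" "left_spanning {..<N} d K"
  obtains n and e :: "nat \<Rightarrow> 'a" where "\<And>i. i < n \<Longrightarrow> e i \<in> carrier R"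
    "left_spanning {..<n} e K" "left_independent {..<n} e K"
proof -
  obtain J where J: "J \<subseteq> {..<N}" "left_spanning J d K" "left_independent J d K"
    using exists_left_basis[OF K _ _ d(2)] d(1) by auto
  have "finite J" using J(1) finite_subset by blast
  then obtain h where h: "bij_betw h {..<card J} J"
    using ex_bij_betw_nat_finite[of J] by (auto simp: lessThan_atLeast0)
  have dJ: "d j \<in> carrier R" if "j \<in> J" for j using J(1) d(1) that by auto
  have hJ: "h i \<in> J" if "i < card J" for i using h that unfolding bij_betw_def by auto
  have re: "(\<Oplus>j\<in>J. u j \<otimes> d j) = (\<Oplus>i\<in>{..<card J}. u (h i) \<otimes> d (h i))"
    if "\<And>j. j \<in> J \<Longrightarrow> u j \<in> carrier R" for u
    using finsum_reindex[of "\<lambda>j. u j \<otimes> d j" h "{..<card J}"] h that dJ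
    unfolding bij_betw_def by auto
  have Kc: "k \<in> carrier R" if "k \<in> K" for k using subfieldE(3)[OF K] that by blast
  have "left_spanning {..<card J} (\<lambda>i. d (h i)) K"
    unfolding left_spanning_def
  proof
    fix x assume "x \<in> carrier R"
    then obtain u where u: "\<forall>j\<in>J. u j \<in> K" "x = (\<Oplus>j\<in>J. u j \<otimes> d j)"
      using J(2) unfolding left_spanning_def by blast
    have "x = (\<Oplus>i\<in>{..<card J}. u (h i) \<otimes> d (h i))" unfolding u(2) using u(1) Kc by (intro re) blast
    then show "\<exists>u. (\<forall>i\<in>{..<card J}. u i \<in> K) \<and> x = (\<Oplus>i\<in>{..<card J}. u i \<otimes> d (h i))"
      using u(1) hJ by (intro exI[of _ "\<lambda>i. u (h i)"]) simp
  qed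
  moreover have "left_independent {..<card J} (\<lambda>i. d (h i)) K"
    unfolding left_independent_def
  proof (intro allI impI ballI)
    fix u i assume u: "(\<forall>i\<in>{..<card J}. u i \<in> K) \<and> (\<Oplus>i\<in>{..<card J}. u i \<otimes> d (h i)) = \<zero>"
      and i: "i \<in> {..<card J}"
    define g where "g = inv_into {..<card J} h"
    have gh: "g (h i) = i" if "i < card J" for i
      using h that unfolding g_def bij_betw_def by (simp add: inv_into_f_f)
    have gJ: "g j < card J" if "j \<in> J" for j
      using h that unfolding g_def bij_betw_def by (metis inv_into_into lessThan_iff)
    have "(\<Oplus>j\<in>J. u (g j) \<otimes> d j) = (\<Oplus>i\<in>{..<card J}. u (g (h i)) \<otimes> d (h i))"
      using u gJ Kc by (intro re) simp
    also have "\<dots> = (\<Oplus>i\<in>{..<card J}. u i \<otimes> d (h i))"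
      using u gh hJ dJ Kc by (intro finsum_cong') auto
    finally have "(\<Oplus>j\<in>J. u (g j) \<otimes> d j) = \<zero>" using u by simp
    then have "u (g (h i)) = \<zero>"
      using left_independentD[OF J(3), of "\<lambda>j. u (g j)" "h i"] u gJ hJ i by simp
    then show "u i = \<zero>" using gh i by simp
  qed
  ultimately show ?thesis using that[of "card J" "\<lambda>i. d (h i)"] hJ dJ by simp
qed

section \<open>A criterion for maximal subfields\<close>

lemma subring_finsum:
  assumes H: "subring H R" and "finite I" "\<And>i. i \<in> I \<Longrightarrow> f i \<in> H"
  shows "(\<Oplus>i\<in>I. f i) \<in> H"
  using assms(2,3)
proof (induction I)
  case empty
  then show ?case using subringE(2)[OF H] by simp
next
  case (insert i I)
  have "(\<Oplus>i\<in>insert i I. f i) = f i \<oplus> (\<Oplus>i\<in>I. f i)"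
    using insert subringE(1)[OF H] by (intro finsum_insert) auto
  then show ?case using insert subringE(7)[OF H] by simp
qed

text \<open>The additive group \<open>K v H\<close> generated by the products \<open>k \<otimes> v \<otimes> h\<close>.\<close>

inductive_set bispan :: "'a set \<Rightarrow> 'a \<Rightarrow> 'a set \<Rightarrow> 'a set" for K v H where
  zero: "\<zero> \<in> bispan K v H"
| step: "x \<in> bispan K v H \<Longrightarrow> k \<in> K \<Longrightarrow> h \<in> H \<Longrightarrow> x \<oplus> k \<otimes> v \<otimes> h \<in> bispan K v H"

lemma bispan_closed:
  assumes "K \<subseteq> carrier R" "v \<in> carrier R" "H \<subseteq> carrier R"
  shows "x \<in> bispan K v H \<Longrightarrow> x \<in> carrier R"
  by (induction rule: bispan.induct) (use assms in auto)

lemma bispan_add: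
  assumes "K \<subseteq> carrier R" "v \<in> carrier R" "H \<subseteq> carrier R"
  shows "y \<in> bispan K v H \<Longrightarrow> x \<in> bispan K v H \<Longrightarrow> x \<oplus> y \<in> bispan K v H"
proof (induction rule: bispan.induct)
  case zero
  then show ?case using bispan_closed[OF assms] by simp
next
  case (step y k h)
  have "x \<in> carrier R" "y \<in> carrier R" "k \<otimes> v \<otimes> h \<in> carrier R"
    using step bispan_closed[OF assms] assms by auto
  then have "x \<oplus> (y \<oplus> k \<otimes> v \<otimes> h) = (x \<oplus> y) \<oplus> k \<otimes> v \<otimes> h" by (simp add: a_assoc)
  then show ?case using bispan.step[OF step.IH[OF step.prems] step.hyps(2,3)] by simp
qed

lemma bispan_finite_sum:
  assumes "K \<subseteq> carrier R" "v \<in> carrier R" "H \<subseteq> carrier R"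
  shows "x \<in> bispan K v H \<Longrightarrow> \<exists>n k h. (\<forall>i<n. k i \<in> K \<and> h i \<in> H) \<and>
     x = (\<Oplus>i\<in>{..<n::nat}. k i \<otimes> v \<otimes> h i)"
proof (induction rule: bispan.induct)
  case zero
  show ?case by (intro exI[of _ 0]) simp
next
  case (step x k h)
  then obtain n k' h' where x: "\<forall>i<n. k' i \<in> K \<and> h' i \<in> H"
    "x = (\<Oplus>i\<in>{..<n::nat}. k' i \<otimes> v \<otimes> h' i)" by blast
  let ?k = "k'(n := k)" and ?h = "h'(n := h)"
  have c: "k' i \<in> carrier R" "h' i \<in> carrier R" if "i < n" for i using x(1) assms that by auto
  have kh: "k \<in> carrier R" "h \<in> carrier R" using step assms by auto
  have "(\<Oplus>i\<in>insert n {..<n}. ?k i \<otimes> v \<otimes> ?h i) = ?k n \<otimes> v \<otimes> ?h n \<oplus> (\<Oplus>i\<in>{..<n}. ?k i \<otimes> v \<otimes> ?h i)"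
    using c kh assms by (intro finsum_insert) auto
  also have "(\<Oplus>i\<in>{..<n}. ?k i \<otimes> v \<otimes> ?h i) = x"
    unfolding x(2) using c kh assms by (intro finsum_cong') auto
  also have "?k n \<otimes> v \<otimes> ?h n \<oplus> x = x \<oplus> k \<otimes> v \<otimes> h"
    using kh assms bispan_closed[OF assms step.hyps(1)] by (simp add: a_comm)
  finally have "x \<oplus> k \<otimes> v \<otimes> h = (\<Oplus>i\<in>{..<Suc n}. ?k i \<otimes> v \<otimes> ?h i)"
    by (simp add: lessThan_Suc)
  moreover have "\<forall>i<Suc n. ?k i \<in> K \<and> ?h i \<in> H" using x(1) step.hyps by (simp add: less_Suc_eq)
  ultimately show ?case by blast
qed

text \<open>Let \<open>H\<close> be the field generated by \<open>S\<close>. It must be shown that an element \<open>b\<close> commuting with \<open>H\<close>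
  lies in \<open>H\<close>. Write \<open>v b = \<Sum> k\<^sub>i v h\<^sub>i\<close>. Since \<open>K\<close> and \<open>H\<close> are commutative and \<open>b\<close>
  commutes with \<open>H\<close>, the identity \<open>x b = \<Sum> k\<^sub>i x h\<^sub>i\<close> spreads from \<open>x = v\<close> to all of
  \<open>K v H\<close>, that is, to all \<open>x\<close>. In such an identity with the fewest terms the \<open>h\<^sub>i\<close> are
  independent over the center. Comparing the identities for \<open>y x\<close> and \<open>x\<close> gives
  \<open>\<Sum> (k\<^sub>i y - y k\<^sub>i) x h\<^sub>i = 0\<close>, so the \<open>k\<^sub>i\<close> are central by \<open>annihilator_zero\<close>, and
  \<open>x = \<one>\<close> shows \<open>b \<in> H\<close>.\<close>

lemma maximal_subfield_if_bispan:
  assumes K: "centralizer K = K" and S: "S \<subseteq> carrier R" "ring_center R \<subseteq> S"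
      "\<And>x y. x \<in> S \<Longrightarrow> y \<in> S \<Longrightarrow> x \<otimes> y = y \<otimes> x"
    and v: "v \<in> carrier R" and sp: "carrier R \<subseteq> bispan K v (generate_field R S)"
  shows "maximal_subfield (generate_field R S) R"
proof -
  define H where "H = generate_field R S"
  have Hf: "subfield H R" unfolding H_def by (rule generate_field_subfield[OF S(1,3)])
  note HE = subringE[OF subfieldE(1)[OF Hf]]
  have Kf: "subfield K R" by (rule self_centralizing_subfield[OF K])
  note KE = subringE[OF subfieldE(1)[OF Kf]]
  have Kcomm: "x \<otimes> y = y \<otimes> x" if "x \<in> K" "y \<in> K" for x y
    using centralizerD[of x K y] that unfolding K by blast
  have Hcomm: "x \<otimes> y = y \<otimes> x" if "x \<in> H" "y \<in> H" for x y
    using subcring.sub_m_comm[OF subdomain.axioms(1)[OF subfield.axioms(1)[OF Hf]]] that .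
  let ?F = "ring_center R"
  have FK: "?F \<subseteq> K" using centralizer_anti[OF KE(1)] unfolding K center_eq_centralizer .
  have FH: "?F \<subseteq> H" unfolding H_def using S(2) by (auto intro: generate_field.incl)
  have Fcomm: "w \<otimes> x = x \<otimes> w" if "w \<in> ?F" "x \<in> carrier R" for w x
    using that unfolding ring_center_def by blast
  have main: "b \<in> H" if b: "b \<in> carrier R" "\<And>h. h \<in> H \<Longrightarrow> b \<otimes> h = h \<otimes> b" for b
  proof -
    \<comment> \<open>\<open>rep I\<close>: the identity holds for all \<open>x\<close> with terms indexed by \<open>I\<close>.\<close>
    define rep where "rep I \<longleftrightarrow> finite I \<and> (\<exists>k h. (\<forall>i\<in>I. k i \<in> K \<and> h i \<in> H) \<and>
      (\<forall>x\<in>carrier R. x \<otimes> b = (\<Oplus>i\<in>I. k i \<otimes> x \<otimes> h i)))" for I :: "nat set"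
    have repI: "rep J" if "finite J" "\<And>i. i \<in> J \<Longrightarrow> k i \<in> K" "\<And>i. i \<in> J \<Longrightarrow> h i \<in> H"
      "\<And>x. x \<in> carrier R \<Longrightarrow> x \<otimes> b = (\<Oplus>i\<in>J. k i \<otimes> x \<otimes> h i)" for J k h
      unfolding rep_def by (intro conjI that(1) exI[of _ k] exI[of _ h] ballI that(2,3,4))
    have "\<exists>n. rep {..<n}"
    proof -
      have "v \<otimes> b \<in> bispan K v H" using sp v b unfolding H_def by auto
      then obtain n k h where kh: "\<forall>i<n. k i \<in> K \<and> h i \<in> H"
        and vb: "v \<otimes> b = (\<Oplus>i\<in>{..<n::nat}. k i \<otimes> v \<otimes> h i)"
        using bispan_finite_sum[OF KE(1) v HE(1)] by blast
      have c: "k i \<in> carrier R" "h i \<in> carrier R" if "i < n" for i using kh KE(1) HE(1) that by auto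
      have "x \<otimes> b = (\<Oplus>i\<in>{..<n}. k i \<otimes> x \<otimes> h i)" if x: "x \<in> bispan K v H" for x
        using x
      proof (induction rule: bispan.induct)
        case zero
        have "(\<Oplus>i\<in>{..<n}. k i \<otimes> \<zero> \<otimes> h i) = (\<Oplus>i\<in>{..<n}. \<zero>)"
          using c by (intro finsum_cong') auto
        then show ?case using b by simp
      next
        case (step x k0 h0)
        have c0: "x \<in> carrier R" "k0 \<in> carrier R" "h0 \<in> carrier R"
          using step bispan_closed[OF KE(1) v HE(1)] KE(1) HE(1) by auto
        have "(k0 \<otimes> v \<otimes> h0) \<otimes> b = k0 \<otimes> v \<otimes> (h0 \<otimes> b)" using c0 b(1) v by (simp add: m_assoc)
        also have "\<dots> = k0 \<otimes> (v \<otimes> b) \<otimes> h0"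
          unfolding b(2)[OF step.hyps(3), symmetric] using c0 b(1) v by (simp add: m_assoc)
        also have "k0 \<otimes> (v \<otimes> b) = (\<Oplus>i\<in>{..<n}. k0 \<otimes> (k i \<otimes> v \<otimes> h i))"
          unfolding vb using c c0 v by (intro finsum_rdistr) auto
        also have "\<dots> \<otimes> h0 = (\<Oplus>i\<in>{..<n}. k0 \<otimes> (k i \<otimes> v \<otimes> h i) \<otimes> h0)"
          using c c0 v by (intro finsum_ldistr) auto
        also have "\<dots> = (\<Oplus>i\<in>{..<n}. k i \<otimes> (k0 \<otimes> v \<otimes> h0) \<otimes> h i)"
        proof (rule finsum_cong')
          fix i assume "i \<in> {..<n}"
          then have i: "k i \<in> K" "h i \<in> H" "k i \<in> carrier R" "h i \<in> carrier R" using kh c by auto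
          have "k0 \<otimes> (k i \<otimes> v \<otimes> h i) \<otimes> h0 = (k0 \<otimes> k i) \<otimes> v \<otimes> (h i \<otimes> h0)"
            using i c0 v by (simp add: m_assoc)
          also have "\<dots> = (k i \<otimes> k0) \<otimes> v \<otimes> (h0 \<otimes> h i)"
            unfolding Kcomm[OF step.hyps(2) i(1)] Hcomm[OF i(2) step.hyps(3)] ..
          also have "\<dots> = k i \<otimes> (k0 \<otimes> v \<otimes> h0) \<otimes> h i" using i c0 v by (simp add: m_assoc)
          finally show "k0 \<otimes> (k i \<otimes> v \<otimes> h i) \<otimes> h0 = k i \<otimes> (k0 \<otimes> v \<otimes> h0) \<otimes> h i" .
        qed (use c c0 v in auto)
        finally have 1: "(k0 \<otimes> v \<otimes> h0) \<otimes> b = (\<Oplus>i\<in>{..<n}. k i \<otimes> (k0 \<otimes> v \<otimes> h0) \<otimes> h i)" .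
        have "(\<Oplus>i\<in>{..<n}. k i \<otimes> (x \<oplus> k0 \<otimes> v \<otimes> h0) \<otimes> h i) =
          (\<Oplus>i\<in>{..<n}. k i \<otimes> x \<otimes> h i \<oplus> k i \<otimes> (k0 \<otimes> v \<otimes> h0) \<otimes> h i)"
          using c c0 v by (intro finsum_cong') (auto simp: l_distr r_distr)
        also have "\<dots> = x \<otimes> b \<oplus> (k0 \<otimes> v \<otimes> h0) \<otimes> b"
          unfolding 1 step.IH using c c0 v by (intro finsum_addf) auto
        finally show ?case using c0 v b(1) by (simp add: l_distr)
      qed
      then have "\<forall>x\<in>carrier R. x \<otimes> b = (\<Oplus>i\<in>{..<n}. k i \<otimes> x \<otimes> h i)"
        using sp unfolding H_def by blast
      moreover have "\<forall>i\<in>{..<n}. k i \<in> K \<and> h i \<in> H" using kh by simp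
      ultimately have "rep {..<n}" unfolding rep_def by blast
      then show ?thesis by blast
    qed
    then obtain n0 where n0: "rep {..<n0}" by blast
    define Q where "Q n \<longleftrightarrow> (\<exists>I. rep I \<and> card I = n)" for n
    have "Q (card {..<n0})" using n0 unfolding Q_def by blast
    then have "Q (LEAST n. Q n)" by (rule LeastI)
    then obtain I where I: "rep I" "card I = (LEAST n. Q n)" unfolding Q_def by blast
    have min: "card I \<le> card J" if "rep J" for J
      unfolding I(2) using that Q_def by (intro Least_le) blast
    have fI: "finite I" using I(1) unfolding rep_def by blast
    obtain k h where kh: "\<forall>i\<in>I. k i \<in> K \<and> h i \<in> H"
      and xb': "\<forall>x\<in>carrier R. x \<otimes> b = (\<Oplus>i\<in>I. k i \<otimes> x \<otimes> h i)"
      using I(1) unfolding rep_def by (elim conjE exE)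
    note xb = xb'[rule_format]
    have c: "k i \<in> carrier R" "h i \<in> carrier R" if "i \<in> I" for i
      using kh KE(1) HE(1) that by blast+
    \<comment> \<open>A dependence relation among the \<open>h i\<close> would allow a term to be dropped.\<close>
    have ind: "left_independent I h ?F"
      unfolding left_independent_def
    proof (intro allI impI ballI)
      fix u j assume u: "(\<forall>i\<in>I. u i \<in> ?F) \<and> (\<Oplus>i\<in>I. u i \<otimes> h i) = \<zero>" and j: "j \<in> I"
      show "u j = \<zero>"
      proof (rule ccontr)
        assume "u j \<noteq> \<zero>"
        then obtain w where w: "\<forall>i\<in>I - {j}. w i \<in> ?F" "h j = (\<Oplus>i\<in>I - {j}. w i \<otimes> h i)"
          using left_dependence_solve[where u = u and e = h and J = I and j = j, OF center_subfield fI j] c(2) u by blast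
        have wc: "w i \<in> carrier R" if "i \<in> I - {j}" for i
          using w(1) that unfolding ring_center_def by blast
        have rx: "x \<otimes> b = (\<Oplus>i\<in>I - {j}. (k j \<otimes> w i \<oplus> k i) \<otimes> x \<otimes> h i)" if x: "x \<in> carrier R" for x
        proof -
          have "x \<otimes> b = (\<Oplus>i\<in>insert j (I - {j}). k i \<otimes> x \<otimes> h i)"
            using xb[OF x] j by (simp add: insert_absorb)
          also have "\<dots> = k j \<otimes> x \<otimes> h j \<oplus> (\<Oplus>i\<in>I - {j}. k i \<otimes> x \<otimes> h i)"
            using fI c x j by (intro finsum_insert) auto
          also have "k j \<otimes> x \<otimes> h j = k j \<otimes> x \<otimes> (\<Oplus>i\<in>I - {j}. w i \<otimes> h i)" using w(2) by simp
          also have "\<dots> = (\<Oplus>i\<in>I - {j}. k j \<otimes> x \<otimes> (w i \<otimes> h i))"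
            using fI c j x wc by (intro finsum_rdistr) auto
          also have "\<dots> \<oplus> (\<Oplus>i\<in>I - {j}. k i \<otimes> x \<otimes> h i) =
              (\<Oplus>i\<in>I - {j}. k j \<otimes> x \<otimes> (w i \<otimes> h i) \<oplus> k i \<otimes> x \<otimes> h i)"
            using c j x wc by (intro finsum_addf[symmetric]) auto
          also have "\<dots> = (\<Oplus>i\<in>I - {j}. (k j \<otimes> w i \<oplus> k i) \<otimes> x \<otimes> h i)"
          proof (rule finsum_cong')
            fix i assume i: "i \<in> I - {j}"
            have cc: "k i \<in> carrier R" "h i \<in> carrier R" "k j \<in> carrier R" "w i \<in> carrier R"
              using i j c wc by auto
            have "k j \<otimes> x \<otimes> (w i \<otimes> h i) = k j \<otimes> (x \<otimes> w i) \<otimes> h i" using cc x by (simp add: m_assoc)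
            also have "x \<otimes> w i = w i \<otimes> x" using Fcomm[of "w i" x] w(1) i x by simp
            finally show "k j \<otimes> x \<otimes> (w i \<otimes> h i) \<oplus> k i \<otimes> x \<otimes> h i =
              (k j \<otimes> w i \<oplus> k i) \<otimes> x \<otimes> h i" using cc x by (simp add: m_assoc l_distr)
          qed (use c j x wc in auto)
          finally show ?thesis .
        qed
        moreover have "k j \<otimes> w i \<oplus> k i \<in> K" if "i \<in> I - {j}" for i
          using kh w(1) FK j KE(6,7) that by blast
        ultimately have "rep (I - {j})"
          using fI kh by (intro repI[of _ "\<lambda>i. k j \<otimes> w i \<oplus> k i" h]) simp_all
        then have "card I \<le> card (I - {j})" by (rule min)
        then show False using card_Diff1_less[OF fI j] by simp
      qed
    qed
    \<comment> \<open>Now the identities for \<open>y \<otimes> x\<close> and for \<open>x\<close> are compared.\<close>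
    have kF: "k i \<in> ?F" if i: "i \<in> I" for i
    proof -
      have "k i \<otimes> y = y \<otimes> k i" if y: "y \<in> carrier R" for y
      proof -
        let ?u = "\<lambda>i. k i \<otimes> y \<oplus> \<ominus> (y \<otimes> k i)"
        have "?u i = \<zero>"
        proof (rule annihilator_zero[OF carrier_is_subring fI c(2) _ _ _ i])
          show "left_independent I h (centralizer (carrier R))"
            using ind unfolding center_eq_centralizer .
          show "?u j \<in> carrier R" if "j \<in> I" for j using c(1)[OF that] y by simp
          fix x assume x: "x \<in> carrier R"
          have "(\<Oplus>i\<in>I. ?u i \<otimes> (x \<otimes> h i)) = (\<Oplus>i\<in>I. k i \<otimes> (y \<otimes> x) \<otimes> h i \<oplus> \<ominus> y \<otimes> (k i \<otimes> x \<otimes> h i))"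
            using c x y by (intro finsum_cong') (auto simp: l_distr l_minus m_assoc)
          also have "\<dots> = (\<Oplus>i\<in>I. k i \<otimes> (y \<otimes> x) \<otimes> h i) \<oplus> (\<Oplus>i\<in>I. \<ominus> y \<otimes> (k i \<otimes> x \<otimes> h i))"
            using c x y by (intro finsum_addf) auto
          also have "(\<Oplus>i\<in>I. \<ominus> y \<otimes> (k i \<otimes> x \<otimes> h i)) = \<ominus> y \<otimes> (\<Oplus>i\<in>I. k i \<otimes> x \<otimes> h i)"
            using c x y fI by (intro finsum_rdistr[symmetric]) auto
          also have "(\<Oplus>i\<in>I. k i \<otimes> x \<otimes> h i) = x \<otimes> b" using xb[OF x] by simp
          also have "(\<Oplus>i\<in>I. k i \<otimes> (y \<otimes> x) \<otimes> h i) = (y \<otimes> x) \<otimes> b" using xb[of "y \<otimes> x"] x y by simp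
          finally show "(\<Oplus>i\<in>I. ?u i \<otimes> (x \<otimes> h i)) = \<zero>"
            using x y b(1) by (simp add: l_minus m_assoc r_neg)
        qed
        from eq_of_minus_zero[OF _ _ this] show ?thesis using c(1)[OF i] y by simp
      qed
      then show ?thesis using c(1)[OF i] unfolding ring_center_def by blast
    qed
    have "b = (\<Oplus>i\<in>I. k i \<otimes> \<one> \<otimes> h i)" using xb[OF one_closed] b(1) by simp
    also have "\<dots> \<in> H"
    proof (rule subring_finsum[OF subfieldE(1)[OF Hf] fI])
      fix i assume i: "i \<in> I"
      then have "k i \<otimes> \<one> = k i" using c by simp
      then show "k i \<otimes> \<one> \<otimes> h i \<in> H" using kF[OF i] FH kh i HE(6) by auto
    qed
    finally show ?thesis .
  qed
  have "L = H" if L: "subfield L R" "H \<subseteq> L" for L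
  proof -
    have "L \<subseteq> H"
    proof
      fix b assume b: "b \<in> L"
      show "b \<in> H"
      proof (rule main)
        show "b \<in> carrier R" using b subfieldE(3)[OF L(1)] by blast
        show "b \<otimes> h = h \<otimes> b" if "h \<in> H" for h
          by (rule subcring.sub_m_comm[OF subdomain.axioms(1)[OF subfield.axioms(1)[OF L(1)]] b])
            (use that L(2) in auto)
      qed
    qed
    then show ?thesis using L(2) by blast
  qed
  then show ?thesis using Hf unfolding maximal_subfield_def H_def[symmetric] by simp
qed

end

section \<open>Moving coordinates into a smaller field\<close>

text \<open>The expressions \<open>\<Sum> y \<phi> T^k\<close> with integers \<open>k\<close>, coefficients \<open>y\<close> in the ring and
  \<open>\<phi> \<in> \<Phi>\<close>, as functions of a unit \<open>T\<close>. A cyclic vector will be encoded by an expression of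
  this kind that takes a unit as its value.\<close>

inductive (in ring) laurent :: "'a set \<Rightarrow> ('a \<Rightarrow> 'a) \<Rightarrow> bool" for \<Phi> where
  const: "\<phi> \<in> \<Phi> \<Longrightarrow> laurent \<Phi> (\<lambda>T. \<phi>)"
| add: "laurent \<Phi> f \<Longrightarrow> laurent \<Phi> g \<Longrightarrow> laurent \<Phi> (\<lambda>T. f T \<oplus> g T)"
| lmult: "y \<in> carrier R \<Longrightarrow> laurent \<Phi> f \<Longrightarrow> laurent \<Phi> (\<lambda>T. y \<otimes> f T)"
| rmult: "laurent \<Phi> f \<Longrightarrow> laurent \<Phi> (\<lambda>T. f T \<otimes> T)"
| rmult_inv: "laurent \<Phi> f \<Longrightarrow> laurent \<Phi> (\<lambda>T. f T \<otimes> inv T)"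

lemma (in germs) germ_laurent:
  assumes "laurent \<Phi> g" "\<Phi> \<subseteq> carrier R" "germ f" "f t0 \<in> Units R"
  shows "germ (\<lambda>t. g (f t))"
  using assms(1)
proof (induction rule: laurent.induct)
  case (const \<phi>)
  then show ?case using assms(2) by (intro germ_const) auto
next
  case (lmult y g)
  then show ?case by (intro germ_mult germ_const)
next
  case (rmult g)
  then show ?case using assms(3) by (intro germ_mult)
next
  case (rmult_inv g)
  then show ?case using germ_inv[OF assms(3,4)] by (intro germ_mult)
qed (rule germ_add)

context central_subfield
begin

text \<open>It is possible to change one coordinate at a time. As a function of a single coordinate, with
  the others held fixed, the \<open>a i\<close> and the value of \<open>g\<close> are germs of rational functions, so they
  remain units at all but finitely many places, and one of these lies in the infinite set \<open>F\<close>.\<close>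

lemma laurent_word_transfer:
  fixes N :: nat and b :: "nat \<Rightarrow> 'a" and I :: "nat set" and a :: "nat \<Rightarrow> 'a"
  assumes b_closed: "\<And>i. i < N \<Longrightarrow> b i \<in> carrier R"
    and b_span: "\<And>x. x \<in> carrier R \<Longrightarrow> \<exists>u. (\<forall>i<N. u i \<in> Z) \<and> x = (\<Oplus>i\<in>{..<N}. u i \<otimes> b i)"
    and F: "F \<subseteq> Z" "infinite F"
    and I: "finite I" and g: "laurent \<Phi> g" "\<Phi> \<subseteq> carrier R"
    and a: "\<And>i. i \<in> I \<Longrightarrow> a i \<in> Units R"
    and ga: "g (word_eval R (\<lambda>i. if i \<in> I then a i else \<one>) w) \<in> Units R"
  shows "\<exists>z. (\<forall>i\<in>I. \<forall>j<N. z i j \<in> F) \<and>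
     (\<forall>i\<in>I. (\<Oplus>j\<in>{..<N}. z i j \<otimes> b j) \<in> Units R) \<and>
     g (word_eval R (\<lambda>i. if i \<in> I then (\<Oplus>j\<in>{..<N}. z i j \<otimes> b j) else \<one>) w) \<in> Units R"
proof -
  define c where "c z i = (if i \<in> I then (\<Oplus>j\<in>{..<N}. z i j \<otimes> b j) else \<one>)" for z i
  define good where "good z \<longleftrightarrow> (\<forall>i\<in>I. \<forall>j<N. z i j \<in> Z) \<and> (\<forall>i\<in>I. c z i \<in> Units R) \<and>
      g (word_eval R (c z) w) \<in> Units R" for z
  have step: "\<exists>y\<in>F. good (z(p := (z p)(q := y)))" if z: "good z" and p: "p \<in> I" and q: "q < N" for z p q
  proof -
    define s where "s t = z(p := (z p)(q := t))" for t
    have zZ: "z i j \<in> Z" if "i \<in> I" "j < N" for i j using z that unfolding good_def by blast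
    interpret germs R Z N b "z p q"
      by unfold_locales (use b_closed b_span zZ[OF p q] in auto)
    have s0: "s (z p q) = z" unfolding s_def by simp
    have "germ (\<lambda>t. s t i j \<otimes> b j)" if "i \<in> I" "j < N" for i j
    proof (cases "i = p \<and> j = q")
      case True
      then have "(\<lambda>t. s t i j \<otimes> b j) = (\<lambda>t. t \<otimes> b q)" unfolding s_def by auto
      then show ?thesis using germ_scale[OF sgerm_id germ_const[OF b_closed[OF q]]] by simp
    next
      case False
      then have "(\<lambda>t. s t i j \<otimes> b j) = (\<lambda>t. z i j \<otimes> b j)" unfolding s_def by auto
      then show ?thesis
        using germ_scale[OF sgerm_const[OF zZ[OF that]] germ_const[OF b_closed[OF that(2)]]] by simp
    qed
    then have gc: "germ (\<lambda>t. c (s t) i)" for i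
      unfolding c_def by (cases "i \<in> I") (auto intro: germ_finsum germ_const)
    have cU: "c (s (z p q)) i \<in> Units R" for i
    proof (cases "i \<in> I")
      case True then show ?thesis using z unfolding s0 good_def by blast
    next
      case False then show ?thesis unfolding c_def by simp
    qed
    have gw: "germ (\<lambda>t. word_eval R (c (s t)) w)" by (rule germ_word_eval[OF gc cU])
    have wU: "word_eval R (c (s (z p q))) w \<in> Units R"
    proof -
      have "range (c z) \<subseteq> Units R" using cU unfolding s0 by auto
      from group.word_eval_closed[OF units_group, of "c z" w] this show ?thesis
        unfolding s0 by (simp add: units_of_carrier word_eval_units_of)
    qed
    have gg: "germ (\<lambda>t. g (word_eval R (c (s t)) w))"
      using germ_laurent[where f = "\<lambda>t. word_eval R (c (s t)) w", OF g gw wU] .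
    have n1: "locally (\<lambda>t. g (word_eval R (c (s t)) w) \<in> Units R)"
      by (rule germ_near_Units[OF gg]) (use z s0 in \<open>simp add: good_def\<close>)
    have n2: "locally (\<lambda>t. \<forall>i\<in>I. c (s t) i \<in> Units R)"
      using I t0 germ_near_Units[OF gc cU] by (intro near_ball)
    have n3: "locally (\<lambda>t. \<forall>i\<in>I. \<forall>j<N. s t i j \<in> Z)"
      by (rule near_always[OF t0]) (use zZ in \<open>auto simp: s_def\<close>)
    have "locally (\<lambda>t. good (s t))" unfolding good_def by (intro near_conj n1 n2 n3)
    then obtain y where "y \<in> F" "good (s y)" using near_infinite F by metis
    then show ?thesis unfolding s_def by blast
  qed
  have "\<forall>i. \<exists>u. i \<in> I \<longrightarrow> (\<forall>j<N. u j \<in> Z) \<and> a i = (\<Oplus>j\<in>{..<N}. u j \<otimes> b j)"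
    using b_span a Units_closed by blast
  from choice[OF this] obtain z0 where z0: "\<And>i j. i \<in> I \<Longrightarrow> j < N \<Longrightarrow> z0 i j \<in> Z"
      "\<And>i. i \<in> I \<Longrightarrow> a i = (\<Oplus>j\<in>{..<N}. z0 i j \<otimes> b j)" by blast
  have cz0: "c z0 = (\<lambda>i. if i \<in> I then a i else \<one>)"
    unfolding c_def using z0(2) by auto
  then have good0: "good z0" using z0(1) a ga unfolding good_def by simp
  have "\<exists>z. good z \<and> (\<forall>(i, j)\<in>P. z i j \<in> F)" if P: "finite P" "P \<subseteq> I \<times> {..<N}" for P
    using P
  proof (induction P)
    case empty
    then show ?case using good0 by blast
  next
    case (insert r P)
    obtain p q where r: "r = (p, q)" "p \<in> I" "q < N" using insert.prems by (cases r) auto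
    obtain z where z: "good z" "\<forall>(i, j)\<in>P. z i j \<in> F" using insert by auto
    obtain y where y: "y \<in> F" "good (z(p := (z p)(q := y)))" using step[OF z(1) r(2,3)] by blast
    have "\<forall>(i, j)\<in>insert r P. (z(p := (z p)(q := y))) i j \<in> F"
      using z(2) y(1) unfolding r(1) by auto
    then show ?case using y(2) by blast
  qed
  from this[of "I \<times> {..<N}"] obtain z where z: "good z" "\<And>i j. i \<in> I \<Longrightarrow> j < N \<Longrightarrow> z i j \<in> F"
    using I by auto
  show ?thesis
  proof (intro exI conjI)
    show "\<forall>i\<in>I. \<forall>j<N. z i j \<in> F" using z(2) by blast
    show "\<forall>i\<in>I. (\<Oplus>j\<in>{..<N}. z i j \<otimes> b j) \<in> Units R"
      using z(1) unfolding good_def c_def by simp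
    have "c z = (\<lambda>i. if i \<in> I then (\<Oplus>j\<in>{..<N}. z i j \<otimes> b j) else \<one>)" unfolding c_def by auto
    then show "g (word_eval R (\<lambda>i. if i \<in> I then (\<Oplus>j\<in>{..<N}. z i j \<otimes> b j) else \<one>) w) \<in> Units R"
      using z(1) unfolding good_def by simp
  qed
qed

end

section \<open>Linear endomorphisms of a division ring\<close>

context skew_field
begin

text \<open>The endomorphisms of the division ring as a left vector space over \<open>K\<close>. Products are composed
  from left to right, which makes \<open>rmul\<close> a homomorphism rather than an antihomomorphism; maps
  are made extensional so that equality is equality on the carrier.\<close>

definition endos :: "'a set \<Rightarrow> ('a \<Rightarrow> 'a) ring" where
  "endos K = \<lparr>carrier = {f \<in> carrier R \<rightarrow>\<^sub>E carrier R. (\<forall>x\<in>carrier R. \<forall>y\<in>carrier R. f (x \<oplus> y) = f x \<oplus> f y)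
       \<and> (\<forall>k\<in>K. \<forall>x\<in>carrier R. f (k \<otimes> x) = k \<otimes> f x)},
     monoid.mult = (\<lambda>f g. \<lambda>x\<in>carrier R. g (f x)), one = (\<lambda>x\<in>carrier R. x),
     ring.zero = (\<lambda>x\<in>carrier R. \<zero>), ring.add = (\<lambda>f g. \<lambda>x\<in>carrier R. f x \<oplus> g x)\<rparr>"

lemma endosI:
  assumes "f \<in> extensional (carrier R)" "\<And>x. x \<in> carrier R \<Longrightarrow> f x \<in> carrier R"
    "\<And>x y. x \<in> carrier R \<Longrightarrow> y \<in> carrier R \<Longrightarrow> f (x \<oplus> y) = f x \<oplus> f y"
    "\<And>k x. k \<in> K \<Longrightarrow> x \<in> carrier R \<Longrightarrow> f (k \<otimes> x) = k \<otimes> f x"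
  shows "f \<in> carrier (endos K)"
  unfolding endos_def using assms by (simp add: PiE_def Pi_def)

lemma endosD:
  assumes "f \<in> carrier (endos K)"
  shows "f \<in> extensional (carrier R)" "\<And>x. x \<in> carrier R \<Longrightarrow> f x \<in> carrier R"
    "\<And>x y. x \<in> carrier R \<Longrightarrow> y \<in> carrier R \<Longrightarrow> f (x \<oplus> y) = f x \<oplus> f y"
    "\<And>k x. k \<in> K \<Longrightarrow> x \<in> carrier R \<Longrightarrow> f (k \<otimes> x) = k \<otimes> f x"
  using assms unfolding endos_def by (simp_all add: PiE_def Pi_def)

lemma endos_zero: "f \<in> carrier (endos K) \<Longrightarrow> f \<zero> = \<zero>"
  using endosD(2,3)[of f K] by (metis add.l_cancel_one' zero_closed l_zero)

lemma endos_eqI: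
  assumes "f \<in> carrier (endos K)" "g \<in> carrier (endos K)" "\<And>x. x \<in> carrier R \<Longrightarrow> f x = g x"
  shows "f = g"
  using endosD(1)[OF assms(1)] endosD(1)[OF assms(2)] assms(3) by (rule extensionalityI)

lemma endos_apply:
  assumes "x \<in> carrier R"
  shows "(f \<otimes>\<^bsub>endos K\<^esub> g) x = g (f x)" "(f \<oplus>\<^bsub>endos K\<^esub> g) x = f x \<oplus> g x"
    "\<one>\<^bsub>endos K\<^esub> x = x" "\<zero>\<^bsub>endos K\<^esub> x = \<zero>"
  using assms unfolding endos_def by simp_all

lemma endos_closed:
  assumes K: "K \<subseteq> carrier R"
  shows "f \<in> carrier (endos K) \<Longrightarrow> g \<in> carrier (endos K) \<Longrightarrow> f \<otimes>\<^bsub>endos K\<^esub> g \<in> carrier (endos K)"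
    "f \<in> carrier (endos K) \<Longrightarrow> g \<in> carrier (endos K) \<Longrightarrow> f \<oplus>\<^bsub>endos K\<^esub> g \<in> carrier (endos K)"
    "\<one>\<^bsub>endos K\<^esub> \<in> carrier (endos K)" "\<zero>\<^bsub>endos K\<^esub> \<in> carrier (endos K)"
proof -
  have ext: "f \<otimes>\<^bsub>endos K\<^esub> g \<in> extensional (carrier R)" "f \<oplus>\<^bsub>endos K\<^esub> g \<in> extensional (carrier R)"
    "\<one>\<^bsub>endos K\<^esub> \<in> extensional (carrier R)" "\<zero>\<^bsub>endos K\<^esub> \<in> extensional (carrier R)" for f g
    unfolding endos_def by simp_all
  have Kc: "k \<in> carrier R" if "k \<in> K" for k using that K by blast
  note ap = endos_apply[where K = K]
  show "f \<otimes>\<^bsub>endos K\<^esub> g \<in> carrier (endos K)" if "f \<in> carrier (endos K)" "g \<in> carrier (endos K)"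
    using endosD(2-)[OF that(1)] endosD(2-)[OF that(2)] Kc by (intro endosI ext) (simp_all add: ap)
  show "f \<oplus>\<^bsub>endos K\<^esub> g \<in> carrier (endos K)" if "f \<in> carrier (endos K)" "g \<in> carrier (endos K)"
    using endosD(2-)[OF that(1)] endosD(2-)[OF that(2)] Kc
    by (intro endosI ext) (simp_all add: ap a_ac r_distr)
  show "\<one>\<^bsub>endos K\<^esub> \<in> carrier (endos K)" "\<zero>\<^bsub>endos K\<^esub> \<in> carrier (endos K)"
    using Kc by (intro endosI ext; simp add: ap)+
qed

lemma endos_ring:
  assumes K: "K \<subseteq> carrier R" shows "ring (endos K)"
proof -
  note cl = endos_closed[OF K] and ap = endos_apply[where K = K]
  have Kc: "k \<in> carrier R" if "k \<in> K" for k using that K by blast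
  have ag: "abelian_group (endos K)"
  proof (rule abelian_groupI)
    fix f assume f: "f \<in> carrier (endos K)"
    note fD = endosD(2-)[OF f]
    let ?g = "\<lambda>x\<in>carrier R. \<ominus> f x"
    have g: "?g \<in> carrier (endos K)"
      using fD Kc by (intro endosI) (simp_all add: minus_add r_minus)
    have "?g \<oplus>\<^bsub>endos K\<^esub> f = \<zero>\<^bsub>endos K\<^esub>"
      by (rule endos_eqI[OF cl(2)[OF g f] cl(4)]) (simp add: ap fD l_neg)
    then show "\<exists>g\<in>carrier (endos K). g \<oplus>\<^bsub>endos K\<^esub> f = \<zero>\<^bsub>endos K\<^esub>" using g by blast
    show "\<zero>\<^bsub>endos K\<^esub> \<oplus>\<^bsub>endos K\<^esub> f = f"
      by (rule endos_eqI[OF cl(2)[OF cl(4) f] f]) (simp add: ap fD)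
    fix g assume g: "g \<in> carrier (endos K)"
    note gD = endosD(2-)[OF g]
    show "f \<oplus>\<^bsub>endos K\<^esub> g = g \<oplus>\<^bsub>endos K\<^esub> f"
      by (rule endos_eqI[OF cl(2)[OF f g] cl(2)[OF g f]]) (simp add: ap fD gD a_comm)
    fix h assume h: "h \<in> carrier (endos K)"
    note hD = endosD(2-)[OF h]
    show "f \<oplus>\<^bsub>endos K\<^esub> g \<oplus>\<^bsub>endos K\<^esub> h = f \<oplus>\<^bsub>endos K\<^esub> (g \<oplus>\<^bsub>endos K\<^esub> h)"
      by (rule endos_eqI[OF cl(2)[OF cl(2)[OF f g] h] cl(2)[OF f cl(2)[OF g h]]])
        (simp add: ap fD gD hD a_assoc)
  qed (use cl in auto)
  have mn: "Group.monoid (endos K)"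
  proof (rule monoidI)
    fix f assume f: "f \<in> carrier (endos K)"
    note fD = endosD(2-)[OF f]
    show "\<one>\<^bsub>endos K\<^esub> \<otimes>\<^bsub>endos K\<^esub> f = f"
      by (rule endos_eqI[OF cl(1)[OF cl(3) f] f]) (simp add: ap fD)
    show "f \<otimes>\<^bsub>endos K\<^esub> \<one>\<^bsub>endos K\<^esub> = f"
      by (rule endos_eqI[OF cl(1)[OF f cl(3)] f]) (simp add: ap fD)
    fix g h assume g: "g \<in> carrier (endos K)" and h: "h \<in> carrier (endos K)"
    show "f \<otimes>\<^bsub>endos K\<^esub> g \<otimes>\<^bsub>endos K\<^esub> h = f \<otimes>\<^bsub>endos K\<^esub> (g \<otimes>\<^bsub>endos K\<^esub> h)"
      by (rule endos_eqI[OF cl(1)[OF cl(1)[OF f g] h] cl(1)[OF f cl(1)[OF g h]]])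
        (simp add: ap fD endosD(2)[OF g])
  qed (use cl in auto)
  show ?thesis
  proof (rule ringI[OF ag mn])
    fix f g h assume f: "f \<in> carrier (endos K)" and g: "g \<in> carrier (endos K)" and h: "h \<in> carrier (endos K)"
    show "(f \<oplus>\<^bsub>endos K\<^esub> g) \<otimes>\<^bsub>endos K\<^esub> h = f \<otimes>\<^bsub>endos K\<^esub> h \<oplus>\<^bsub>endos K\<^esub> g \<otimes>\<^bsub>endos K\<^esub> h"
      by (rule endos_eqI[OF cl(1)[OF cl(2)[OF f g] h] cl(2)[OF cl(1)[OF f h] cl(1)[OF g h]]])
        (simp add: ap endosD(2)[OF f] endosD(2)[OF g] endosD(3)[OF h])
    show "h \<otimes>\<^bsub>endos K\<^esub> (f \<oplus>\<^bsub>endos K\<^esub> g) = h \<otimes>\<^bsub>endos K\<^esub> f \<oplus>\<^bsub>endos K\<^esub> h \<otimes>\<^bsub>endos K\<^esub> g"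
      by (rule endos_eqI[OF cl(1)[OF h cl(2)[OF f g]] cl(2)[OF cl(1)[OF h f] cl(1)[OF h g]]])
        (simp add: ap endosD(2)[OF h])
  qed
qed

lemma endos_finsum_apply:
  assumes K: "K \<subseteq> carrier R" and "finite I" "\<And>i. i \<in> I \<Longrightarrow> f i \<in> carrier (endos K)" and x: "x \<in> carrier R"
  shows "(\<Oplus>\<^bsub>endos K\<^esub>i\<in>I. f i) x = (\<Oplus>i\<in>I. f i x)"
  using assms(2,3)
proof (induction I)
  interpret E: ring "endos K" by (rule endos_ring[OF K])
  case empty
  show ?case using x by (simp add: endos_apply)
next
  interpret E: ring "endos K" by (rule endos_ring[OF K])
  case (insert i I)
  have "(\<Oplus>\<^bsub>endos K\<^esub>i\<in>insert i I. f i) = f i \<oplus>\<^bsub>endos K\<^esub> (\<Oplus>\<^bsub>endos K\<^esub>i\<in>I. f i)"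
    using insert by (intro E.finsum_insert) auto
  moreover have "(\<Oplus>i\<in>insert i I. f i x) = f i x \<oplus> (\<Oplus>i\<in>I. f i x)"
    using insert x endosD(2) by (intro finsum_insert) auto
  ultimately show ?case using insert x by (simp add: endos_apply)
qed

definition lmul :: "'a \<Rightarrow> 'a \<Rightarrow> 'a" where "lmul k = (\<lambda>x\<in>carrier R. k \<otimes> x)"
definition rmul :: "'a \<Rightarrow> 'a \<Rightarrow> 'a" where "rmul d = (\<lambda>x\<in>carrier R. x \<otimes> d)"

lemma mul_apply [simp]: "x \<in> carrier R \<Longrightarrow> lmul k x = k \<otimes> x" "x \<in> carrier R \<Longrightarrow> rmul d x = x \<otimes> d"
  by (simp_all add: lmul_def rmul_def)

lemma rmul_closed:
  assumes "K \<subseteq> carrier R" "d \<in> carrier R" shows "rmul d \<in> carrier (endos K)"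
  using assms by (intro endosI) (auto simp: rmul_def l_distr m_assoc subset_iff)

lemma rmul_hom:
  assumes K: "K \<subseteq> carrier R" shows "rmul \<in> ring_hom R (endos K)"
proof (rule ring_hom_memI)
  note cl = endos_closed[OF K] and rc = rmul_closed[OF K]
  show "rmul x \<in> carrier (endos K)" if "x \<in> carrier R" for x using rc[OF that] .
  show "rmul (x \<otimes> y) = rmul x \<otimes>\<^bsub>endos K\<^esub> rmul y" if "x \<in> carrier R" "y \<in> carrier R" for x y
    by (rule endos_eqI[OF rc cl(1)[OF rc rc]]) (use that in \<open>simp_all add: endos_apply m_assoc\<close>)
  show "rmul (x \<oplus> y) = rmul x \<oplus>\<^bsub>endos K\<^esub> rmul y" if "x \<in> carrier R" "y \<in> carrier R" for x y
    by (rule endos_eqI[OF rc cl(2)[OF rc rc]]) (use that in \<open>simp_all add: endos_apply r_distr\<close>)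
  show "rmul \<one> = \<one>\<^bsub>endos K\<^esub>"
    by (rule endos_eqI[OF rc cl(3)]) (simp_all add: endos_apply)
qed

lemma lmul_closed:
  assumes K: "subfield K R" and k: "k \<in> K" shows "lmul k \<in> carrier (endos K)"
proof (rule endosI)
  have Kc: "x \<in> carrier R" if "x \<in> K" for x using subfieldE(3)[OF K] that by blast
  show "lmul k \<in> extensional (carrier R)" by (simp add: lmul_def)
  show "lmul k x \<in> carrier R" if "x \<in> carrier R" for x using that Kc[OF k] by simp
  show "lmul k (x \<oplus> y) = lmul k x \<oplus> lmul k y" if "x \<in> carrier R" "y \<in> carrier R" for x y
    using that Kc[OF k] by (simp add: r_distr)
  show "lmul k (l \<otimes> x) = l \<otimes> lmul k x" if l: "l \<in> K" and x: "x \<in> carrier R" for l x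
  proof -
    have c: "k \<otimes> l = l \<otimes> k"
      using subcring.sub_m_comm[OF subdomain.axioms(1)[OF subfield.axioms(1)[OF K]] k l] .
    have "k \<otimes> (l \<otimes> x) = (k \<otimes> l) \<otimes> x" using Kc[OF k] Kc[OF l] x by (simp add: m_assoc)
    also have "\<dots> = l \<otimes> (k \<otimes> x)" unfolding c using Kc[OF k] Kc[OF l] x by (simp add: m_assoc)
    finally show ?thesis using Kc[OF k] Kc[OF l] x by simp
  qed
qed

lemma lmul_central_subfield:
  assumes K: "subfield K R" shows "central_subfield (endos K) (lmul ` K)"
proof -
  have Ks: "K \<subseteq> carrier R" using subfieldE(3)[OF K] .
  have Kc: "x \<in> carrier R" if "x \<in> K" for x using Ks that by blast
  have comm: "x \<otimes> y = y \<otimes> x" if "x \<in> K" "y \<in> K" for x y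
    using subcring.sub_m_comm[OF subdomain.axioms(1)[OF subfield.axioms(1)[OF K]] that] .
  note KE = subringE[OF subfieldE(1)[OF K]]
  note cl = endos_closed[OF Ks] and lc = lmul_closed[OF K]
  interpret E: ring "endos K" by (rule endos_ring[OF Ks])
  interpret KF: field "R\<lparr>carrier := K\<rparr>" using subfield_iff(2)[OF K] .
  have hom: "lmul \<in> ring_hom (R\<lparr>carrier := K\<rparr>) (endos K)"
  proof (rule ring_hom_memI)
    show "lmul x \<in> carrier (endos K)" if "x \<in> carrier (R\<lparr>carrier := K\<rparr>)" for x
      using lc that by simp
    show "lmul (x \<otimes>\<^bsub>R\<lparr>carrier := K\<rparr>\<^esub> y) = lmul x \<otimes>\<^bsub>endos K\<^esub> lmul y"
      if "x \<in> carrier (R\<lparr>carrier := K\<rparr>)" "y \<in> carrier (R\<lparr>carrier := K\<rparr>)" for x y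
    proof -
      have xy: "x \<in> K" "y \<in> K" using that by simp_all
      have "lmul (x \<otimes> y) = lmul x \<otimes>\<^bsub>endos K\<^esub> lmul y"
      proof (rule endos_eqI[OF lc[OF KE(6)[OF xy]] cl(1)[OF lc[OF xy(1)] lc[OF xy(2)]]])
        fix z assume z: "z \<in> carrier R"
        show "lmul (x \<otimes> y) z = (lmul x \<otimes>\<^bsub>endos K\<^esub> lmul y) z"
          unfolding comm[OF xy] using z Kc xy by (simp add: endos_apply m_assoc)
      qed
      then show ?thesis by simp
    qed
    show "lmul (x \<oplus>\<^bsub>R\<lparr>carrier := K\<rparr>\<^esub> y) = lmul x \<oplus>\<^bsub>endos K\<^esub> lmul y"
      if "x \<in> carrier (R\<lparr>carrier := K\<rparr>)" "y \<in> carrier (R\<lparr>carrier := K\<rparr>)" for x y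
    proof -
      have xy: "x \<in> K" "y \<in> K" using that by simp_all
      have "lmul (x \<oplus> y) = lmul x \<oplus>\<^bsub>endos K\<^esub> lmul y"
        by (rule endos_eqI[OF lc[OF KE(7)[OF xy]] cl(2)[OF lc[OF xy(1)] lc[OF xy(2)]]])
          (use Kc xy in \<open>simp add: endos_apply l_distr\<close>)
      then show ?thesis by simp
    qed
    show "lmul \<one>\<^bsub>R\<lparr>carrier := K\<rparr>\<^esub> = \<one>\<^bsub>endos K\<^esub>"
      using endos_eqI[OF lc[OF KE(3)] cl(3)] by (simp add: endos_apply)
  qed
  interpret h: ring_hom_ring "R\<lparr>carrier := K\<rparr>" "endos K" lmul
    by (rule ring_hom_ringI2[OF KF.ring_axioms E.ring_axioms hom])
  have "\<one>\<^bsub>endos K\<^esub> \<one> \<noteq> \<zero>\<^bsub>endos K\<^esub> \<one>" by (simp add: endos_apply)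
  then have ne: "\<one>\<^bsub>endos K\<^esub> \<noteq> \<zero>\<^bsub>endos K\<^esub>" by auto
  show ?thesis
    unfolding central_subfield_def central_subfield_axioms_def
  proof (intro conjI allI impI)
    show "ring (endos K)" by (rule endos_ring[OF Ks])
    show "subfield (lmul ` K) (endos K)"
      using h.img_is_subfield(2)[of K] KF.carrier_is_subfield ne by simp
    fix z f assume "z \<in> lmul ` K" and f: "f \<in> carrier (endos K)"
    then obtain k where k: "k \<in> K" "z = lmul k" by blast
    show "z \<otimes>\<^bsub>endos K\<^esub> f = f \<otimes>\<^bsub>endos K\<^esub> z"
      unfolding k(2)
      by (rule endos_eqI[OF cl(1)[OF lc[OF k(1)] f] cl(1)[OF f lc[OF k(1)]]])
        (use k(1) lc Kc in \<open>simp add: endos_apply endosD[OF f]\<close>)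
  qed
qed

lemma lmul_inj:
  assumes "x \<in> carrier R" "y \<in> carrier R" "lmul x = lmul y" shows "x = y"
  using assms(1,2) fun_cong[OF assms(3), of \<one>] by simp

lemma endos_lincomb:
  assumes f: "f \<in> carrier (endos K)"
    and I: "finite I" "\<And>i. i \<in> I \<Longrightarrow> u i \<in> K" "\<And>i. i \<in> I \<Longrightarrow> u i \<in> carrier R" "\<And>i. i \<in> I \<Longrightarrow> e i \<in> carrier R"
  shows "f (\<Oplus>i\<in>I. u i \<otimes> e i) = (\<Oplus>i\<in>I. u i \<otimes> f (e i))"
  using I
proof (induction I)
  case empty
  then show ?case using endos_zero[OF f] by simp
next
  case (insert i I)
  have "(\<Oplus>i\<in>insert i I. u i \<otimes> e i) = u i \<otimes> e i \<oplus> (\<Oplus>i\<in>I. u i \<otimes> e i)"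
    using insert by (intro finsum_insert) auto
  moreover have "(\<Oplus>i\<in>insert i I. u i \<otimes> f (e i)) = u i \<otimes> f (e i) \<oplus> (\<Oplus>i\<in>I. u i \<otimes> f (e i))"
    using insert endosD(2)[OF f] by (intro finsum_insert) auto
  moreover have "u i \<otimes> e i \<in> carrier R" "(\<Oplus>i\<in>I. u i \<otimes> e i) \<in> carrier R"
    using insert by (auto intro!: finsum_closed)
  ultimately show ?case using insert endosD(3,4)[OF f] by simp
qed

lemma bimod_ops_endos:
  assumes K: "centralizer K = K" and g: "g \<in> bimod_ops K"
  shows "restrict g (carrier R) \<in> carrier (endos K)"
proof -
  have Kf: "subfield K R" by (rule self_centralizing_subfield[OF K])
  note Ks = subfieldE(1)[OF Kf]
  note KE = subringE[OF Ks]
  have Kc: "x \<in> carrier R" if "x \<in> K" for x using KE(1) that by blast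
  have comm: "x \<otimes> y = y \<otimes> x" if "x \<in> K" "y \<in> K" for x y
    using subcring.sub_m_comm[OF subdomain.axioms(1)[OF subfield.axioms(1)[OF Kf]] that] .
  have slin: "g (k \<otimes> x) = k \<otimes> g x" if "k \<in> K" "x \<in> carrier R" for k x
    using g
  proof (induction rule: bimod_ops.induct)
    case (ops_mult l c)
    have "l \<otimes> (k \<otimes> x) \<otimes> c = (l \<otimes> k) \<otimes> x \<otimes> c" using that Kc ops_mult by (simp add: m_assoc)
    also have "\<dots> = k \<otimes> (l \<otimes> x \<otimes> c)" unfolding comm[OF ops_mult(1) that(1)]
      using that Kc ops_mult by (simp add: m_assoc)
    finally show ?case .
  next
    case (ops_add g h)
    then show ?case
      using that Kc[OF that(1)] bimod_ops_closed[OF Ks] by (simp add: r_distr)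
  next
    case (ops_cong g h)
    then show ?case using that Kc[OF that(1)] by simp
  qed
  show ?thesis
    using bimod_ops_closed[OF Ks g] bimod_ops_add_hom[OF Ks g] slin Kc
    by (intro endosI) simp_all
qed

text \<open>With operators \<open>s j\<close> dual to a basis, \<open>f\<close> is \<open>x \<mapsto> \<Sum> s j x \<otimes> f (e j)\<close>, so it is a sum of
  maps \<open>x \<mapsto> k \<otimes> x \<otimes> c\<close>. Writing \<open>c\<close> in terms of the \<open>d i\<close> with central coefficients, which can
  be moved to the left of \<open>x\<close> into \<open>K\<close>, leaves only the right multiplications by the \<open>d i\<close>.\<close>

lemma endos_span_rmul:
  assumes K: "centralizer K = K"
    and J: "finite J" "\<And>j. j \<in> J \<Longrightarrow> e j \<in> carrier R" "left_spanning J e K" "left_independent J e K"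
    and d: "\<And>i. i < (N::nat) \<Longrightarrow> d i \<in> carrier R" "left_spanning {..<N} d (ring_center R)"
    and f: "f \<in> carrier (endos K)"
  shows "\<exists>u. (\<forall>i<N. u i \<in> lmul ` K) \<and> f = (\<Oplus>\<^bsub>endos K\<^esub>i\<in>{..<N}. u i \<otimes>\<^bsub>endos K\<^esub> rmul (d i))"
proof -
  have Kf: "subfield K R" by (rule self_centralizing_subfield[OF K])
  note KE = subringE[OF subfieldE(1)[OF Kf]]
  have Kc: "x \<in> carrier R" if "x \<in> K" for x using KE(1) that by blast
  have comm: "x \<otimes> y = y \<otimes> x" if "x \<in> K" "y \<in> K" for x y
    using subcring.sub_m_comm[OF subdomain.axioms(1)[OF subfield.axioms(1)[OF Kf]] that] .
  interpret E: ring "endos K" by (rule endos_ring[OF KE(1)])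
  have FK: "ring_center R \<subseteq> K" using centralizer_anti[OF KE(1)] unfolding K center_eq_centralizer .
  have coords: "\<exists>\<kappa>. (\<forall>i<N. \<kappa> i \<in> K) \<and> (\<forall>x\<in>carrier R. g x = (\<Oplus>i\<in>{..<N}. \<kappa> i \<otimes> x \<otimes> d i))"
    if "g \<in> bimod_ops K" for g
    using that
  proof (induction rule: bimod_ops.induct)
    case (ops_mult k c)
    obtain u where u: "\<forall>i\<in>{..<N}. u i \<in> ring_center R" "c = (\<Oplus>i\<in>{..<N}. u i \<otimes> d i)"
      using d(2) ops_mult(2) unfolding left_spanning_def by blast
    have uK: "u i \<in> K" "u i \<in> carrier R" if "i < N" for i using u(1) FK Kc that by blast+
    have "k \<otimes> x \<otimes> c = (\<Oplus>i\<in>{..<N}. (k \<otimes> u i) \<otimes> x \<otimes> d i)" if x: "x \<in> carrier R" for x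
    proof -
      have "k \<otimes> x \<otimes> c = (\<Oplus>i\<in>{..<N}. k \<otimes> x \<otimes> (u i \<otimes> d i))"
        unfolding u(2) using Kc[OF ops_mult(1)] x uK d(1) by (intro finsum_rdistr) auto
      also have "\<dots> = (\<Oplus>i\<in>{..<N}. (k \<otimes> u i) \<otimes> x \<otimes> d i)"
      proof (rule finsum_cong')
        fix i assume i: "i \<in> {..<N}"
        have "x \<otimes> u i = u i \<otimes> x"
          using u(1) i x unfolding ring_center_def by simp
        have c: "k \<in> carrier R" "u i \<in> carrier R" "d i \<in> carrier R" using i uK d Kc ops_mult(1) by auto
        have "k \<otimes> x \<otimes> (u i \<otimes> d i) = k \<otimes> (x \<otimes> u i) \<otimes> d i" using c x by (simp add: m_assoc)
        also have "\<dots> = (k \<otimes> u i) \<otimes> x \<otimes> d i"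
          unfolding \<open>x \<otimes> u i = u i \<otimes> x\<close> using c x by (simp add: m_assoc)
        finally show "k \<otimes> x \<otimes> (u i \<otimes> d i) = (k \<otimes> u i) \<otimes> x \<otimes> d i" .
      qed (use uK d(1) x Kc[OF ops_mult(1)] in auto)
      finally show ?thesis .
    qed
    moreover have "\<forall>i<N. k \<otimes> u i \<in> K" using KE(6) ops_mult(1) uK by blast
    ultimately show ?case by (intro exI[of _ "\<lambda>i. k \<otimes> u i"] conjI ballI) auto
  next
    case (ops_add g h)
    obtain \<kappa> where \<kappa>: "\<forall>i<N. \<kappa> i \<in> K" "\<forall>x\<in>carrier R. g x = (\<Oplus>i\<in>{..<N}. \<kappa> i \<otimes> x \<otimes> d i)"
      using ops_add.IH(1) by (elim exE conjE)
    obtain \<mu> where \<mu>: "\<forall>i<N. \<mu> i \<in> K" "\<forall>x\<in>carrier R. h x = (\<Oplus>i\<in>{..<N}. \<mu> i \<otimes> x \<otimes> d i)"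
      using ops_add.IH(2) by (elim exE conjE)
    have c: "\<kappa> i \<in> carrier R" "\<mu> i \<in> carrier R" if "i < N" for i using \<kappa>(1) \<mu>(1) Kc that by blast+
    have "g x \<oplus> h x = (\<Oplus>i\<in>{..<N}. (\<kappa> i \<oplus> \<mu> i) \<otimes> x \<otimes> d i)" if x: "x \<in> carrier R" for x
    proof -
      have "(\<Oplus>i\<in>{..<N}. (\<kappa> i \<oplus> \<mu> i) \<otimes> x \<otimes> d i) = (\<Oplus>i\<in>{..<N}. \<kappa> i \<otimes> x \<otimes> d i \<oplus> \<mu> i \<otimes> x \<otimes> d i)"
        using c d(1) x by (intro finsum_cong') (auto simp: l_distr)
      also have "\<dots> = (\<Oplus>i\<in>{..<N}. \<kappa> i \<otimes> x \<otimes> d i) \<oplus> (\<Oplus>i\<in>{..<N}. \<mu> i \<otimes> x \<otimes> d i)"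
        using c d(1) x by (intro finsum_addf) auto
      finally show ?thesis using \<kappa>(2) \<mu>(2) x by simp
    qed
    moreover have "\<forall>i<N. \<kappa> i \<oplus> \<mu> i \<in> K" using KE(7) \<kappa>(1) \<mu>(1) by blast
    ultimately show ?case by (intro exI[of _ "\<lambda>i. \<kappa> i \<oplus> \<mu> i"] conjI ballI) auto
  next
    case (ops_cong g h)
    then show ?case by auto
  qed
  obtain s where s: "\<And>i. i \<in> J \<Longrightarrow> s i \<in> bimod_ops K"
    "\<And>i j. i \<in> J \<Longrightarrow> j \<in> J \<Longrightarrow> s i (e j) = (if j = i then \<one> else \<zero>)"
    using jacobson_density[where e = e, OF subfieldE(1)[OF Kf] J(1)] J(2,4) unfolding K by blast
  have sc: "s i x \<in> carrier R" if "i \<in> J" "x \<in> carrier R" for i x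
    using bimod_ops_closed[OF subfieldE(1)[OF Kf] s(1)] that by blast
  define g where "g x = (\<Oplus>j\<in>J. s j x \<otimes> f (e j))" for x
  have fe: "f (e j) \<in> carrier R" if "j \<in> J" for j using endosD(2)[OF f] J(2) that by blast
  have "(\<lambda>x. \<Oplus>j\<in>J. s j x \<otimes> f (e j)) \<in> bimod_ops K"
    using bimod_ops_finsum[OF subfieldE(1)[OF Kf] J(1), of "\<lambda>j x. s j x \<otimes> f (e j)"]
      bimod_ops_rmult[OF subfieldE(1)[OF Kf] s(1) fe] by blast
  then have gops: "g \<in> bimod_ops K" unfolding g_def .
  have fg: "f x = g x" if x: "x \<in> carrier R" for x
  proof -
    obtain u where u: "\<forall>i\<in>J. u i \<in> K" "x = (\<Oplus>i\<in>J. u i \<otimes> e i)"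
      using J(3) x unfolding left_spanning_def by blast
    have uc: "u i \<in> carrier R" if "i \<in> J" for i using u(1) Kc that by blast
    have sx: "s j x = u j" if j: "j \<in> J" for j
    proof -
      have "s j x = restrict (s j) (carrier R) (\<Oplus>i\<in>J. u i \<otimes> e i)"
        using x unfolding u(2) by simp
      also have "\<dots> = (\<Oplus>i\<in>J. u i \<otimes> restrict (s j) (carrier R) (e i))"
        using endos_lincomb[OF bimod_ops_endos[OF K s(1)[OF j]], of J u e] J(1,2) u(1) uc by simp
      also have "\<dots> = (\<Oplus>i\<in>J. if j = i then u i else \<zero>)"
        using s(2)[OF j] uc J(2) by (intro finsum_cong') auto
      also have "\<dots> = u j" using J(1) j uc by (intro finsum_singleton) auto
      finally show ?thesis .
    qed
    have "f x = (\<Oplus>i\<in>J. u i \<otimes> f (e i))"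
      unfolding u(2) using endos_lincomb[OF f, of J u e] J(1,2) u(1) uc by simp
    also have "\<dots> = g x" unfolding g_def using sx uc fe by (intro finsum_cong') auto
    finally show ?thesis .
  qed
  obtain \<kappa> where \<kappa>: "\<forall>i<N. \<kappa> i \<in> K" "\<forall>x\<in>carrier R. g x = (\<Oplus>i\<in>{..<N}. \<kappa> i \<otimes> x \<otimes> d i)"
    using coords[OF gops] by (elim exE conjE)
  note lc = lmul_closed[OF Kf] and rc = rmul_closed[OF KE(1) d(1)]
  have mc: "lmul (\<kappa> i) \<otimes>\<^bsub>endos K\<^esub> rmul (d i) \<in> carrier (endos K)" if "i < N" for i
    using lc rc \<kappa>(1) that by (intro E.m_closed) auto
  have "f = (\<Oplus>\<^bsub>endos K\<^esub>i\<in>{..<N}. lmul (\<kappa> i) \<otimes>\<^bsub>endos K\<^esub> rmul (d i))"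
  proof (rule endos_eqI[OF f])
    show "(\<Oplus>\<^bsub>endos K\<^esub>i\<in>{..<N}. lmul (\<kappa> i) \<otimes>\<^bsub>endos K\<^esub> rmul (d i)) \<in> carrier (endos K)"
      using mc by (intro E.finsum_closed) auto
    fix x assume x: "x \<in> carrier R"
    have "(\<Oplus>\<^bsub>endos K\<^esub>i\<in>{..<N}. lmul (\<kappa> i) \<otimes>\<^bsub>endos K\<^esub> rmul (d i)) x =
      (\<Oplus>i\<in>{..<N}. (lmul (\<kappa> i) \<otimes>\<^bsub>endos K\<^esub> rmul (d i)) x)"
      using mc x by (intro endos_finsum_apply[OF KE(1)]) auto
    also have "\<dots> = (\<Oplus>i\<in>{..<N}. \<kappa> i \<otimes> x \<otimes> d i)"
      using \<kappa>(1) Kc x d(1) by (intro finsum_cong') (auto simp: endos_apply)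
    finally show "f x = (\<Oplus>\<^bsub>endos K\<^esub>i\<in>{..<N}. lmul (\<kappa> i) \<otimes>\<^bsub>endos K\<^esub> rmul (d i)) x"
      using fg[OF x] \<kappa>(2) x by simp
  qed
  then show ?thesis using \<kappa>(1) by (intro exI[of _ "\<lambda>i. lmul (\<kappa> i)"]) auto
qed

end

section \<open>Cyclic reduction of words\<close>

lemma word_eq_cancel: "word_eq [(i, - l), (i, l)] []"
  using word_eq.trans[OF word_eq.add[of i "- l" l]] word_eq.zero by simp

lemma word_eq_rotate:
  assumes "word_eq ((i, l + k) # u) []" shows "word_eq ((i, k) # u @ [(i, l)]) []"
proof -
  let ?w = "(i, k) # u @ [(i, l)]"
  have 1: "word_eq ([(i, l), (i, k)] @ u) []"
    using word_eq.trans[OF word_eq.append[OF word_eq.add word_eq.refl]] assms by simp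
  have "word_eq ([] @ ?w) ([(i, - l), (i, l)] @ ?w)"
    by (intro word_eq.append word_eq.refl word_eq.sym[OF word_eq_cancel])
  moreover have "word_eq ([(i, - l)] @ (([(i, l), (i, k)] @ u) @ [(i, l)])) ([(i, - l)] @ ([] @ [(i, l)]))"
    by (intro word_eq.append word_eq.refl 1)
  ultimately have "word_eq ?w [(i, - l), (i, l)]" using word_eq.trans by fastforce
  then show ?thesis using word_eq_cancel word_eq.trans by blast
qed

definition cyclically_reduced :: "gword \<Rightarrow> bool" where
  "cyclically_reduced w \<longleftrightarrow> w \<noteq> [] \<and> (\<forall>p\<in>set w. snd p \<noteq> 0) \<and>
     successively (\<lambda>p q. fst p \<noteq> fst q) w \<and> (length w \<ge> 2 \<longrightarrow> fst (hd w) \<noteq> fst (last w))"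

lemma not_successively_split:
  assumes "\<not> successively P w" shows "\<exists>u x y v. w = u @ [x, y] @ v \<and> \<not> P x y"
  using assms
proof (induction w rule: induct_list012)
  case (3 x y w)
  show ?case
  proof (cases "P x y")
    case True
    then obtain u a b v where "y # w = u @ [a, b] @ v \<and> \<not> P a b" using 3 by auto
    then have "x # y # w = (x # u) @ [a, b] @ v \<and> \<not> P a b" by simp
    then show ?thesis by blast
  next
    case False
    then have "x # y # w = [] @ [x, y] @ w \<and> \<not> P x y" by simp
    then show ?thesis by blast
  qed
qed simp_all

text \<open>A word that is not cyclically reduced can be shortened by deleting a trivial syllable, by
  merging two neighbours, or by merging the last syllable into the first one. The last step is a
  conjugation, so it is kept as a separate premise.\<close>

lemma conjugate_reduction_induct:
  assumes "\<And>w. cyclically_reduced w \<Longrightarrow> P w"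
    and "\<And>w w'. word_eq w w' \<Longrightarrow> P w' \<Longrightarrow> P w"
    and "\<And>i k l u. P ((i, l + k) # u) \<Longrightarrow> P ((i, k) # u @ [(i, l)])"
    and "\<not> word_eq w []"
  shows "P w"
  using assms(4)
proof (induction "length w" arbitrary: w rule: less_induct)
  case less
  consider "cyclically_reduced w" | p where "p \<in> set w" "snd p = 0"
    | "\<not> successively (\<lambda>p q. fst p \<noteq> fst q) w"
    | "length w \<ge> 2" "fst (hd w) = fst (last w)"
    using less.prems word_eq.refl unfolding cyclically_reduced_def by blast
  then show ?case
  proof cases
    case 1 then show ?thesis by (rule assms(1))
  next
    case 2
    then obtain u v i where w: "w = u @ [(i, 0)] @ v" by (metis append_Cons append_Nil prod.collapse split_list)
    have e: "word_eq w (u @ [] @ v)" unfolding w by (intro word_eq.append word_eq.refl word_eq.zero)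
    have "P (u @ [] @ v)" using less e word_eq.trans by (intro less.hyps) (auto simp: w)
    then show ?thesis using assms(2)[OF e] by blast
  next
    case 3
    then obtain u p q v where pq: "w = u @ [p, q] @ v" "fst p = fst q"
      using not_successively_split[OF 3] by auto
    obtain i k l where w: "w = u @ [(i, k), (i, l)] @ v" using pq by (cases p; cases q) auto
    have e: "word_eq w (u @ [(i, k + l)] @ v)" unfolding w by (intro word_eq.append word_eq.refl word_eq.add)
    have "P (u @ [(i, k + l)] @ v)" using less e word_eq.trans by (intro less.hyps) (auto simp: w)
    then show ?thesis using assms(2)[OF e] by blast
  next
    case 4
    obtain p v where wv: "w = p # v" using 4(1) by (cases w) auto
    moreover have "v \<noteq> []" using 4(1) wv by auto
    ultimately have pv: "w = p # v" "v \<noteq> []" .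
    obtain i k where p: "p = (i, k)" by fastforce
    obtain l where l: "last v = (i, l)" using 4(2) pv p by (cases "last v") auto
    have w: "w = (i, k) # butlast v @ [(i, l)]" using pv p l append_butlast_last_id[OF pv(2)] by simp
    have "P ((i, l + k) # butlast v)"
      using less.prems word_eq_rotate[of i l k "butlast v"] by (intro less.hyps) (auto simp: w)
    then show ?thesis unfolding w by (rule assms(3))
  qed
qed

section \<open>Word traces on two by two matrices\<close>

type_synonym 'x mat2 = "'x \<times> 'x \<times> 'x \<times> 'x"

context field
begin

fun mat_mult :: "'a mat2 \<Rightarrow> 'a mat2 \<Rightarrow> 'a mat2" where
  "mat_mult (a, b, c, d) (a', b', c', d') =
     (a \<otimes> a' \<oplus> b \<otimes> c', a \<otimes> b' \<oplus> b \<otimes> d', c \<otimes> a' \<oplus> d \<otimes> c', c \<otimes> b' \<oplus> d \<otimes> d')"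

fun mat_trace :: "'a mat2 \<Rightarrow> 'a" where "mat_trace (a, b, c, d) = a \<oplus> d"

fun mat_scale :: "'a \<Rightarrow> 'a mat2 \<Rightarrow> 'a mat2" where
  "mat_scale s (a, b, c, d) = (s \<otimes> a, s \<otimes> b, s \<otimes> c, s \<otimes> d)"

definition M2 :: "'a mat2 set" where
  "M2 = carrier R \<times> carrier R \<times> carrier R \<times> carrier R"

definition SL2 :: "('a mat2) monoid" where
  "SL2 = \<lparr>carrier = {(a, b, c, d). a \<in> carrier R \<and> b \<in> carrier R \<and> c \<in> carrier R \<and> d \<in> carrier R \<and>
      a \<otimes> d = \<one> \<oplus> b \<otimes> c}, monoid.mult = mat_mult, one = (\<one>, \<zero>, \<zero>, \<one>)\<rparr>"

lemma SL2_simps [simp]: "x \<otimes>\<^bsub>SL2\<^esub> y = mat_mult x y" "\<one>\<^bsub>SL2\<^esub> = (\<one>, \<zero>, \<zero>, \<one>)"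
  by (simp_all add: SL2_def)

lemma SL2_carrier: "(a, b, c, d) \<in> carrier SL2 \<longleftrightarrow>
   a \<in> carrier R \<and> b \<in> carrier R \<and> c \<in> carrier R \<and> d \<in> carrier R \<and> a \<otimes> d = \<one> \<oplus> b \<otimes> c"
  by (simp add: SL2_def)

lemma M2_simps [simp]: "(a, b, c, d) \<in> M2 \<longleftrightarrow> a \<in> carrier R \<and> b \<in> carrier R \<and> c \<in> carrier R \<and> d \<in> carrier R"
  by (simp add: M2_def)

lemma SL2_M2: "x \<in> carrier SL2 \<Longrightarrow> x \<in> M2"
  by (cases x) (simp add: SL2_carrier)

lemma mat_mult_closed: "x \<in> M2 \<Longrightarrow> y \<in> M2 \<Longrightarrow> mat_mult x y \<in> M2"
  by (cases x; cases y) simp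

lemma mat_mult_assoc: "x \<in> M2 \<Longrightarrow> y \<in> M2 \<Longrightarrow> z \<in> M2 \<Longrightarrow> mat_mult (mat_mult x y) z = mat_mult x (mat_mult y z)"
  by (cases x; cases y; cases z) (simp add: l_distr r_distr m_assoc a_ac)

lemma mat_mult_one: "x \<in> M2 \<Longrightarrow> mat_mult (\<one>, \<zero>, \<zero>, \<one>) x = x" "x \<in> M2 \<Longrightarrow> mat_mult x (\<one>, \<zero>, \<zero>, \<one>) = x"
  by (cases x; simp)+

lemma mat_trace_comm: "x \<in> M2 \<Longrightarrow> y \<in> M2 \<Longrightarrow> mat_trace (mat_mult x y) = mat_trace (mat_mult y x)"
  by (cases x; cases y) (simp add: m_comm a_ac)

lemma mat_trace_closed: "x \<in> M2 \<Longrightarrow> mat_trace x \<in> carrier R"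
  by (cases x) simp

lemma mat_scale_closed: "x \<in> M2 \<Longrightarrow> s \<in> carrier R \<Longrightarrow> mat_scale s x \<in> M2"
  by (cases x) simp

lemma mat_trace_sm: "x \<in> M2 \<Longrightarrow> s \<in> carrier R \<Longrightarrow> mat_trace (mat_scale s x) = s \<otimes> mat_trace x"
  by (cases x) (simp add: r_distr)

lemma mat_scale_mm: "x \<in> M2 \<Longrightarrow> y \<in> M2 \<Longrightarrow> s \<in> carrier R \<Longrightarrow> t \<in> carrier R \<Longrightarrow>
    mat_mult (mat_scale s x) (mat_scale t y) = mat_scale (s \<otimes> t) (mat_mult x y)"
  by (cases x; cases y) (simp add: r_distr m_ac)

lemma SL2_adjugate:
  assumes "(a, b, c, d) \<in> carrier SL2"
  shows "(d, \<ominus> b, \<ominus> c, a) \<in> carrier SL2"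
    "mat_mult (d, \<ominus> b, \<ominus> c, a) (a, b, c, d) = (\<one>, \<zero>, \<zero>, \<one>)"
proof -
  have cl: "a \<in> carrier R" "b \<in> carrier R" "c \<in> carrier R" "d \<in> carrier R"
    and dt: "a \<otimes> d = \<one> \<oplus> b \<otimes> c" using assms by (auto simp: SL2_carrier)
  show "(d, \<ominus> b, \<ominus> c, a) \<in> carrier SL2" using cl dt by (simp add: SL2_carrier m_comm l_minus r_minus)
  have "d \<otimes> a \<oplus> \<ominus> b \<otimes> c = \<one>" "\<ominus> c \<otimes> b \<oplus> a \<otimes> d = \<one>"
    using cl dt by (simp_all add: m_comm[of d a] m_comm[of c b] l_minus a_assoc r_neg a_comm[of "\<ominus> (b \<otimes> c)"])
  moreover have "d \<otimes> b \<oplus> \<ominus> b \<otimes> d = \<zero>" "\<ominus> c \<otimes> a \<oplus> a \<otimes> c = \<zero>"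
    using cl by (simp_all add: m_comm[of d b] m_comm[of c a] l_minus r_neg l_neg)
  ultimately show "mat_mult (d, \<ominus> b, \<ominus> c, a) (a, b, c, d) = (\<one>, \<zero>, \<zero>, \<one>)" by simp
qed

lemma SL2_group: "group SL2"
proof (rule groupI)
  show "\<one>\<^bsub>SL2\<^esub> \<in> carrier SL2" by (simp add: SL2_carrier)
  fix x assume x: "x \<in> carrier SL2"
  obtain a b c d where xa: "x = (a, b, c, d)" by (cases x)
  have cl: "a \<in> carrier R" "b \<in> carrier R" "c \<in> carrier R" "d \<in> carrier R"
    and dt: "a \<otimes> d = \<one> \<oplus> b \<otimes> c" using x by (auto simp: xa SL2_carrier)
  show "\<one>\<^bsub>SL2\<^esub> \<otimes>\<^bsub>SL2\<^esub> x = x" using mat_mult_one(1)[OF SL2_M2[OF x]] by simp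
  show "\<exists>y\<in>carrier SL2. y \<otimes>\<^bsub>SL2\<^esub> x = \<one>\<^bsub>SL2\<^esub>"
    unfolding SL2_simps using SL2_adjugate[of a b c d] x unfolding xa by (intro bexI[rotated])
  fix y assume y: "y \<in> carrier SL2"
  obtain a' b' c' d' where ya: "y = (a', b', c', d')" by (cases y)
  have cl': "a' \<in> carrier R" "b' \<in> carrier R" "c' \<in> carrier R" "d' \<in> carrier R"
    and dt': "a' \<otimes> d' = \<one> \<oplus> b' \<otimes> c'" using y by (auto simp: ya SL2_carrier)
  have "(a \<otimes> a' \<oplus> b \<otimes> c') \<otimes> (c \<otimes> b' \<oplus> d \<otimes> d') =
    (a \<otimes> d) \<otimes> (a' \<otimes> d') \<oplus> (b \<otimes> c) \<otimes> (b' \<otimes> c') \<oplus> (a \<otimes> a' \<otimes> c \<otimes> b' \<oplus> b \<otimes> c' \<otimes> d \<otimes> d')"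
    using cl cl' by (simp add: l_distr r_distr m_ac a_ac)
  also have "\<dots> = \<one> \<oplus> (a \<otimes> d) \<otimes> (b' \<otimes> c') \<oplus> (b \<otimes> c) \<otimes> (a' \<otimes> d') \<oplus> (a \<otimes> a' \<otimes> c \<otimes> b' \<oplus> b \<otimes> c' \<otimes> d \<otimes> d')"
    unfolding dt dt' using cl cl' by (simp add: l_distr r_distr m_ac a_ac)
  also have "\<dots> = \<one> \<oplus> (a \<otimes> b' \<oplus> b \<otimes> d') \<otimes> (c \<otimes> a' \<oplus> d \<otimes> c')"
    using cl cl' by (simp add: l_distr r_distr m_ac a_ac)
  finally show "x \<otimes>\<^bsub>SL2\<^esub> y \<in> carrier SL2" using cl cl' by (simp add: xa ya SL2_carrier)
  fix z assume "z \<in> carrier SL2"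
  then show "x \<otimes>\<^bsub>SL2\<^esub> y \<otimes>\<^bsub>SL2\<^esub> z = x \<otimes>\<^bsub>SL2\<^esub> (y \<otimes>\<^bsub>SL2\<^esub> z)"
    using mat_mult_assoc SL2_M2 x y by simp
qed

lemma SL2_inv:
  assumes "(a, b, c, d) \<in> carrier SL2"
  shows "inv\<^bsub>SL2\<^esub> (a, b, c, d) = (d, \<ominus> b, \<ominus> c, a)"
  using group.inv_equality[OF SL2_group, of "(d, \<ominus> b, \<ominus> c, a)" "(a, b, c, d)"]
    SL2_adjugate[OF assms] assms unfolding SL2_simps by blast

text \<open>The matrix with eigenvalue \<open>y\<close> on the column \<open>(\<one>, p)\<close> and eigenvalue \<open>x\<close> on \<open>(\<one>, \<one> \<oplus> p)\<close>; the
  change of basis has determinant one in every characteristic.\<close>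

definition torus :: "'a \<Rightarrow> 'a \<Rightarrow> 'a \<Rightarrow> 'a mat2" where
  "torus p y x = mat_mult (mat_mult (\<one>, \<one>, p, \<one> \<oplus> p) (y, \<zero>, \<zero>, x)) (\<one> \<oplus> p, \<ominus> \<one>, \<ominus> p, \<one>)"

lemma torus_SL2:
  assumes "p \<in> carrier R" "x \<in> carrier R" "y \<in> carrier R" "y \<otimes> x = \<one>"
  shows "torus p y x \<in> carrier SL2"
proof -
  interpret G: group SL2 by (rule SL2_group)
  have "(\<one>, \<one>, p, \<one> \<oplus> p) \<in> carrier SL2" "(y, \<zero>, \<zero>, x) \<in> carrier SL2"
    using assms by (simp_all add: SL2_carrier)
  moreover have "(\<one> \<oplus> p, \<ominus> \<one>, \<ominus> p, \<one>) \<in> carrier SL2"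
    using assms by (simp add: SL2_carrier l_minus r_minus)
  ultimately show ?thesis unfolding torus_def SL2_simps(1)[symmetric] by (intro G.m_closed)
qed

lemma torus_scale:
  "p \<in> carrier R \<Longrightarrow> x \<in> carrier R \<Longrightarrow> y \<in> carrier R \<Longrightarrow> s \<in> carrier R \<Longrightarrow>
   mat_scale s (torus p y x) = torus p (s \<otimes> y) (s \<otimes> x)"
  unfolding torus_def by (simp add: r_distr m_ac)

lemma torus_one: "p \<in> carrier R \<Longrightarrow> torus p \<one> \<one> = (\<one>, \<zero>, \<zero>, \<one>)"
  unfolding torus_def
  by (simp add: r_distr l_distr l_minus r_minus a_assoc r_neg l_neg)
    (simp add: a_assoc[symmetric] r_neg l_neg a_comm)

lemma torus_mult:
  assumes "p \<in> carrier R" "x \<in> carrier R" "y \<in> carrier R" "x' \<in> carrier R" "y' \<in> carrier R"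
  shows "mat_mult (torus p y x) (torus p y' x') = torus p (y \<otimes> y') (x \<otimes> x')"
proof -
  let ?P = "(\<one>, \<one>, p, \<one> \<oplus> p)" and ?Q = "(\<one> \<oplus> p, \<ominus> \<one>, \<ominus> p, \<one>)"
  let ?D = "(y, \<zero>, \<zero>, x)" and ?D' = "(y', \<zero>, \<zero>, x')"
  have M: "?P \<in> M2" "?Q \<in> M2" "?D \<in> M2" "?D' \<in> M2" using assms by simp_all
  have QP: "mat_mult ?Q ?P = (\<one>, \<zero>, \<zero>, \<one>)"
    using assms by (simp add: l_minus r_minus a_assoc r_neg l_neg)
      (simp add: a_assoc[symmetric] r_neg l_neg a_comm)
  have "mat_mult (torus p y x) (torus p y' x') = mat_mult (mat_mult ?P (mat_mult ?D (mat_mult (mat_mult ?Q ?P) ?D'))) ?Q"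
    unfolding torus_def by (simp only: mat_mult_assoc mat_mult_closed M)
  also have "\<dots> = mat_mult (mat_mult ?P (mat_mult ?D ?D')) ?Q" unfolding QP mat_mult_one(1)[OF M(4)] ..
  also have "mat_mult ?D ?D' = (y \<otimes> y', \<zero>, \<zero>, x \<otimes> x')" using assms by simp
  finally show ?thesis unfolding torus_def .
qed

lemma torus_nat_pow:
  assumes "p \<in> carrier R" "x \<in> carrier R" "y \<in> carrier R"
  shows "torus p y x [^]\<^bsub>SL2\<^esub> (n::nat) = torus p (y [^] n) (x [^] n)"
proof (induction n)
  case 0
  show ?case using torus_one[OF assms(1)] by simp
next
  case (Suc n)
  interpret G: group SL2 by (rule SL2_group)
  show ?case using torus_mult[of p "x [^] n" "y [^] n" x y] assms Suc by simp
qed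

lemma torus_inv:
  assumes "p \<in> carrier R" "x \<in> carrier R" "y \<in> carrier R" "y \<otimes> x = \<one>"
  shows "inv\<^bsub>SL2\<^esub> (torus p y x) = torus p x y"
proof -
  interpret G: group SL2 by (rule SL2_group)
  have xy: "x \<otimes> y = \<one>" using assms m_comm by simp
  show ?thesis
    using G.inv_equality[OF _ torus_SL2[OF assms] torus_SL2[OF assms(1,3,2) xy]]
      torus_mult[OF assms(1,3,2,2,3)] torus_one[OF assms(1)] xy assms(4) by simp
qed

text \<open>This is \<open>r^|k|\<close> times the \<open>k\<close>-th power of \<open>torus p (inv r) r\<close>. The factor clears the
  denominators, so the entries are polynomials in \<open>r\<close> and \<open>r = \<zero>\<close> becomes a legitimate value.\<close>

definition scaled :: "'a \<Rightarrow> int \<Rightarrow> 'a \<Rightarrow> 'a mat2" where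
  "scaled p k r = (let s = r [^] nat \<bar>k\<bar> \<otimes> r [^] nat \<bar>k\<bar> in
     if k < 0 then torus p s \<one> else torus p \<one> s)"

lemma scaled_eq:
  assumes p: "p \<in> carrier R" and r: "r \<in> carrier R" "r \<noteq> \<zero>"
  shows "mat_scale (r [^] nat \<bar>k\<bar>) (torus p (inv r) r [^]\<^bsub>SL2\<^esub> k) = scaled p k r"
proof -
  have i: "inv r \<in> carrier R" "inv r \<otimes> r = \<one>" using r by (simp_all add: field_Units)
  define m where "m = nat \<bar>k\<bar>"
  have ri: "r [^] m \<otimes> inv r [^] m = \<one>"
    using i r nat_pow_distrib[of r "inv r" m] m_comm[of r "inv r"] by simp
  have ii: "inv r [^] m \<otimes> r [^] m = \<one>" using ri i r m_comm by simp
  have pw: "torus p (inv r) r [^]\<^bsub>SL2\<^esub> m = torus p (inv r [^] m) (r [^] m)"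
    by (rule torus_nat_pow[OF p r(1) i(1)])
  have c: "r [^] m \<in> carrier R" "inv r [^] m \<in> carrier R" using r i by simp_all
  show ?thesis
  proof (cases "k < 0")
    case True
    have mk: "nat (- k) = m" using True by (simp add: m_def)
    have "torus p (inv r) r [^]\<^bsub>SL2\<^esub> k = inv\<^bsub>SL2\<^esub> (torus p (inv r) r [^]\<^bsub>SL2\<^esub> m)"
      by (simp only: int_pow_def2 True if_True mk)
    also have "\<dots> = torus p (r [^] m) (inv r [^] m)"
      unfolding pw by (rule torus_inv[OF p c ii])
    finally have "mat_scale (r [^] m) (torus p (inv r) r [^]\<^bsub>SL2\<^esub> k) = torus p (r [^] m \<otimes> r [^] m) \<one>"
      using torus_scale[OF p c(2,1,1)] ri by simp
    moreover have "scaled p k r = torus p (r [^] m \<otimes> r [^] m) \<one>"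
      unfolding scaled_def Let_def m_def[symmetric] using True by simp
    ultimately show ?thesis unfolding m_def[symmetric] by simp
  next
    case False
    have mk: "nat k = m" using False by (simp add: m_def)
    have "torus p (inv r) r [^]\<^bsub>SL2\<^esub> k = torus p (inv r) r [^]\<^bsub>SL2\<^esub> m"
      by (simp only: int_pow_def2 False if_False mk)
    then have "mat_scale (r [^] m) (torus p (inv r) r [^]\<^bsub>SL2\<^esub> k) = torus p \<one> (r [^] m \<otimes> r [^] m)"
      unfolding pw using torus_scale[OF p c c(1)] ri by simp
    moreover have "scaled p k r = torus p \<one> (r [^] m \<otimes> r [^] m)"
      unfolding scaled_def Let_def m_def[symmetric] using False by simp
    ultimately show ?thesis unfolding m_def[symmetric] by simp
  qed
qed

text \<open>Requiring an equation of functions, not only of values on the carrier, keeps the closure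
  properties free of side conditions.\<close>

definition poly_mat :: "('a \<Rightarrow> 'a mat2) \<Rightarrow> bool" where
  "poly_mat M \<longleftrightarrow> (\<exists>a b c d. polyfn a \<and> polyfn b \<and> polyfn c \<and> polyfn d \<and> M = (\<lambda>r. (a r, b r, c r, d r)))"

lemma poly_matI: "polyfn a \<Longrightarrow> polyfn b \<Longrightarrow> polyfn c \<Longrightarrow> polyfn d \<Longrightarrow> poly_mat (\<lambda>r. (a r, b r, c r, d r))"
  unfolding poly_mat_def by blast

lemma poly_mat_mult:
  assumes "poly_mat M" "poly_mat M'" shows "poly_mat (\<lambda>r. mat_mult (M r) (M' r))"
proof -
  obtain a b c d where M: "polyfn a" "polyfn b" "polyfn c" "polyfn d" "M = (\<lambda>r. (a r, b r, c r, d r))"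
    using assms(1) unfolding poly_mat_def by blast
  obtain a' b' c' d' where M': "polyfn a'" "polyfn b'" "polyfn c'" "polyfn d'"
    "M' = (\<lambda>r. (a' r, b' r, c' r, d' r))"
    using assms(2) unfolding poly_mat_def by blast
  show ?thesis unfolding M(5) M'(5) mat_mult.simps
    by (intro poly_matI polyfn_add polyfn_mult M(1-4) M'(1-4))
qed

lemma poly_mat_torus:
  assumes "p \<in> carrier R" "polyfn x" "polyfn y" shows "poly_mat (\<lambda>r. torus p (y r) (x r))"
  unfolding torus_def
  by (intro poly_mat_mult poly_matI polyfn_const assms) (use assms in auto)

lemma poly_mat_scaled:
  assumes "p \<in> carrier R" shows "poly_mat (scaled p k)"
proof -
  have s: "polyfn (\<lambda>r. r [^] nat \<bar>k\<bar> \<otimes> r [^] nat \<bar>k\<bar>)" by (intro polyfn_mult polyfn_pow)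
  have "scaled p k = (\<lambda>r. torus p (r [^] nat \<bar>k\<bar> \<otimes> r [^] nat \<bar>k\<bar>) \<one>) \<or>
    scaled p k = (\<lambda>r. torus p \<one> (r [^] nat \<bar>k\<bar> \<otimes> r [^] nat \<bar>k\<bar>))"
    unfolding scaled_def Let_def by (cases "k < 0") auto
  then show ?thesis
    using poly_mat_torus[OF assms polyfn_const[OF one_closed] s]
      poly_mat_torus[OF assms s polyfn_const[OF one_closed]] by auto
qed

lemma poly_mat_trace: "poly_mat M \<Longrightarrow> polyfn (\<lambda>r. mat_trace (M r))"
  unfolding poly_mat_def by (auto intro: polyfn_add)

text \<open>The matrix with image spanned by the column \<open>(\<one>, l)\<close> and kernel spanned by \<open>(\<one>, m)\<close>, so that
  products of such matrices vanish only when an image meets a kernel.\<close>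

definition rank1 :: "'a \<Rightarrow> 'a \<Rightarrow> 'a mat2" where
  "rank1 l m = (\<ominus> m, \<one>, \<ominus> (l \<otimes> m), l)"

lemma rank1_closed: "l \<in> carrier R \<Longrightarrow> m \<in> carrier R \<Longrightarrow> rank1 l m \<in> M2"
  by (simp add: rank1_def)

lemma rank1_mult:
  assumes "l \<in> carrier R" "m \<in> carrier R" "l' \<in> carrier R" "m' \<in> carrier R"
  shows "mat_mult (rank1 l m) (rank1 l' m') = mat_scale (l' \<oplus> \<ominus> m) (rank1 l m')"
  using assms by (simp add: rank1_def l_distr r_distr l_minus r_minus m_ac a_ac)

lemma mat_trace_rank1: "l \<in> carrier R \<Longrightarrow> m \<in> carrier R \<Longrightarrow> mat_trace (rank1 l m) = l \<oplus> \<ominus> m"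
  by (simp add: rank1_def a_comm)

text \<open>The slope of the eigenline on which the \<open>k\<close>-th power of \<open>torus p (inv r) r\<close> dominates as \<open>r\<close>
  tends to \<open>0\<close>; the other eigenline has slope \<open>attractor p (- k)\<close>.\<close>

definition attractor :: "'a \<Rightarrow> int \<Rightarrow> 'a" where "attractor p k = (if k < 0 then \<one> \<oplus> p else p)"

lemma attractor_closed: "p \<in> carrier R \<Longrightarrow> attractor p k \<in> carrier R"
  by (simp add: attractor_def)

text \<open>In the limit only the dominant eigenline survives, so the matrix degenerates to rank one.\<close>

lemma scaled_zero:
  assumes "p \<in> carrier R" "k \<noteq> 0"
  shows "scaled p k \<zero> = mat_scale (if k < 0 then \<one> else \<ominus> \<one>) (rank1 (attractor p k) (attractor p (- k)))"
proof -
  define m where "m = nat \<bar>k\<bar>"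
  have z: "\<zero> [^] m = \<zero>" using assms(2) unfolding m_def by (intro nat_pow_zero) simp
  have "scaled p k \<zero> = (if k < 0 then torus p \<zero> \<one> else torus p \<one> \<zero>)"
    unfolding scaled_def Let_def m_def[symmetric] z by simp
  then show ?thesis
    using assms by (auto simp: attractor_def torus_def rank1_def l_minus r_minus)
qed

definition word_scaled :: "(nat \<Rightarrow> 'a) \<Rightarrow> gword \<Rightarrow> 'a \<Rightarrow> 'a mat2" where
  "word_scaled p w r = foldr (\<lambda>(i, k) y. mat_mult (scaled (p i) k r) y) w (\<one>, \<zero>, \<zero>, \<one>)"

definition word_size :: "gword \<Rightarrow> nat" where
  "word_size w = (\<Sum>(i, k)\<leftarrow>w. nat \<bar>k\<bar>)"

lemma word_scaled_eq:
  assumes p: "\<And>i. p i \<in> carrier R" and r: "r \<in> carrier R" "r \<noteq> \<zero>"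
  shows "mat_scale (r [^] word_size w) (word_eval SL2 (\<lambda>i. torus (p i) (inv r) r) w) = word_scaled p w r"
proof (induction w)
  case Nil
  show ?case by (simp add: word_eval_def word_scaled_def word_size_def)
next
  case (Cons q w)
  interpret G: group SL2 by (rule SL2_group)
  obtain i k where q: "q = (i, k)" by fastforce
  have iv: "inv r \<in> carrier R" "inv r \<otimes> r = \<one>" using r by (simp_all add: field_Units)
  have T: "torus (p i) (inv r) r \<in> carrier SL2" for i by (rule torus_SL2[OF p r(1) iv])
  have M: "torus (p i) (inv r) r [^]\<^bsub>SL2\<^esub> k \<in> M2"
    "word_eval SL2 (\<lambda>i. torus (p i) (inv r) r) w \<in> M2"
    using T G.word_eval_closed[of "\<lambda>i. torus (p i) (inv r) r" w] by (auto intro!: SL2_M2)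
  have e: "word_eval SL2 (\<lambda>i. torus (p i) (inv r) r) (q # w) =
     mat_mult (torus (p i) (inv r) r [^]\<^bsub>SL2\<^esub> k) (word_eval SL2 (\<lambda>i. torus (p i) (inv r) r) w)"
    by (simp add: word_eval_def q)
  have "word_size (q # w) = nat \<bar>k\<bar> + word_size w" by (simp add: word_size_def q)
  then have "mat_scale (r [^] word_size (q # w)) (word_eval SL2 (\<lambda>i. torus (p i) (inv r) r) (q # w)) =
     mat_mult (mat_scale (r [^] nat \<bar>k\<bar>) (torus (p i) (inv r) r [^]\<^bsub>SL2\<^esub> k))
        (mat_scale (r [^] word_size w) (word_eval SL2 (\<lambda>i. torus (p i) (inv r) r) w))"
    unfolding e using mat_scale_mm[OF M] r(1) nat_pow_mult[OF r(1), of "nat \<bar>k\<bar>" "word_size w"] nat_pow_closed[OF r(1)]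
    by metis
  also have "\<dots> = word_scaled p (q # w) r"
    unfolding Cons scaled_eq[OF p r] by (simp add: word_scaled_def q)
  finally show ?case .
qed

lemma poly_mat_word_scaled:
  assumes "\<And>i. p i \<in> carrier R" shows "poly_mat (word_scaled p w)"
proof (induction w)
  case Nil
  have "word_scaled p [] = (\<lambda>r. (\<one>, \<zero>, \<zero>, \<one>))" by (simp add: word_scaled_def fun_eq_iff)
  then show ?case by (auto intro!: poly_matI polyfn_const)
next
  case (Cons q w)
  obtain i k where q: "q = (i, k)" by fastforce
  have "word_scaled p (q # w) = (\<lambda>r. mat_mult (scaled (p i) k r) (word_scaled p w r))"
    by (simp add: word_scaled_def q fun_eq_iff)
  then show ?case using poly_mat_mult[OF poly_mat_scaled[OF assms] Cons] by simp
qed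

text \<open>Ping-pong at \<open>r = 0\<close>. The product of the rank one matrices belonging to the syllables is a
  nonzero multiple of the rank one matrix with the image of the first and the kernel of the last
  one, because neighbouring syllables belong to different letters and their lines are different.\<close>

lemma word_scaled_zero:
  assumes p: "\<And>i. p i \<in> carrier R"
    and gen: "\<And>i j k l. i \<noteq> j \<Longrightarrow> attractor (p i) k \<noteq> attractor (p j) l"
    and "w \<noteq> []" "\<forall>q\<in>set w. snd q \<noteq> 0" "successively (\<lambda>q q'. fst q \<noteq> fst q') w"
  shows "\<exists>c. c \<in> carrier R \<and> c \<noteq> \<zero> \<and> word_scaled p w \<zero> =
    mat_scale c (rank1 (attractor (p (fst (hd w))) (snd (hd w))) (attractor (p (fst (last w))) (- snd (last w))))"
  using assms(3-5)
proof (induction w rule: induct_list012)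
  case (2 q)
  obtain i k where q: "q = (i, k)" by fastforce
  have k: "k \<noteq> 0" using 2 q by simp
  have "scaled (p i) k \<zero> \<in> M2"
    unfolding scaled_zero[OF p k] using attractor_closed[OF p] by (intro mat_scale_closed rank1_closed) auto
  then have "word_scaled p [q] \<zero> = scaled (p i) k \<zero>"
    using mat_mult_one(2) by (simp add: word_scaled_def q)
  then show ?case unfolding scaled_zero[OF p k]
    by (intro exI[of _ "if k < 0 then \<one> else \<ominus> \<one>"]) (auto simp: q)
next
  case (3 q q' w)
  obtain i k where q: "q = (i, k)" by fastforce
  obtain j l where q': "q' = (j, l)" by fastforce
  have k: "k \<noteq> 0" "i \<noteq> j" using 3 by (simp_all add: q q')
  let ?W = "q' # w"
  let ?L = "attractor (p (fst (last ?W))) (- snd (last ?W))"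
  obtain c where c: "c \<in> carrier R" "c \<noteq> \<zero>"
    "word_scaled p ?W \<zero> = mat_scale c (rank1 (attractor (p j) l) ?L)"
    using 3 by (auto simp: q')
  define s where "s = (if k < 0 then \<one> else \<ominus> \<one>)"
  have s: "s \<in> carrier R" "s \<noteq> \<zero>" by (auto simp: s_def)
  define t where "t = attractor (p j) l \<oplus> \<ominus> attractor (p i) (- k)"
  note lc = attractor_closed[OF p]
  have t: "t \<in> carrier R" "t \<noteq> \<zero>"
  proof -
    show "t \<in> carrier R" unfolding t_def using lc by simp
    have "attractor (p j) l \<noteq> attractor (p i) (- k)" using gen[of j i] k(2) by blast
    then show "t \<noteq> \<zero>" unfolding t_def using lc r_right_minus_eq minus_eq by metis
  qed
  have "word_scaled p (q # ?W) \<zero> = mat_mult (scaled (p i) k \<zero>) (word_scaled p ?W \<zero>)"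
    by (simp add: word_scaled_def q)
  also have "\<dots> = mat_mult (mat_scale s (rank1 (attractor (p i) k) (attractor (p i) (- k)))) (mat_scale c (rank1 (attractor (p j) l) ?L))"
    unfolding c(3) scaled_zero[OF p k(1)] s_def ..
  also have "\<dots> = mat_scale (s \<otimes> c) (mat_scale t (rank1 (attractor (p i) k) ?L))"
    unfolding t_def using mat_scale_mm[OF rank1_closed[OF lc lc] rank1_closed[OF lc lc] s(1) c(1)]
      rank1_mult[OF lc lc lc lc] by simp
  also have "\<dots> = mat_scale (s \<otimes> c \<otimes> t) (rank1 (attractor (p i) k) ?L)"
    using s c t lc by (simp add: rank1_def m_assoc)
  finally have "word_scaled p (q # ?W) \<zero> = mat_scale (s \<otimes> c \<otimes> t) (rank1 (attractor (p i) k) ?L)" .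
  moreover have "s \<otimes> c \<otimes> t \<in> carrier R" "s \<otimes> c \<otimes> t \<noteq> \<zero>" using s c t by (simp_all add: integral_iff)
  ultimately show ?case by (intro exI[of _ "s \<otimes> c \<otimes> t"]) (simp add: q)
qed simp

text \<open>Slopes are only ever of the form \<open>p i\<close> or \<open>\<one> \<oplus> p i\<close>, so every earlier choice excludes three
  values.\<close>

lemma exists_generic_sequence:
  assumes "infinite (carrier R)"
  obtains p :: "nat \<Rightarrow> 'a" where "\<And>i. p i \<in> carrier R"
    "\<And>i j k l. i \<noteq> j \<Longrightarrow> attractor (p i) k \<noteq> attractor (p j) l"
proof -
  define bad where "bad y = {y, \<one> \<oplus> y, y \<oplus> \<ominus> \<one>}" for y
  have "\<exists>p. \<forall>n::nat. p n \<in> carrier R \<and> (\<forall>i<n. p n \<notin> bad (p i))"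
  proof (rule dependent_wellorder_choice)
    fix n :: nat and f :: "nat \<Rightarrow> 'a"
    have "finite (\<Union>i<n. bad (f i))" unfolding bad_def by simp
    then have "infinite (carrier R - (\<Union>i<n. bad (f i)))" using assms by simp
    then obtain r where "r \<in> carrier R - (\<Union>i<n. bad (f i))"
      using infinite_imp_nonempty by blast
    then show "\<exists>r. r \<in> carrier R \<and> (\<forall>i<n. r \<notin> bad (f i))" by blast
  next
    fix r :: 'a and f g :: "nat \<Rightarrow> 'a" and n :: nat assume eq: "\<And>i. i < n \<Longrightarrow> f i = g i"
    have "(\<forall>i<n. r \<notin> bad (f i)) = (\<forall>i<n. r \<notin> bad (g i))"
    proof -
      have "bad (f i) = bad (g i)" if "i < n" for i by (rule arg_cong[OF eq[OF that]])
      then show ?thesis by simp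
    qed
    then show "(r \<in> carrier R \<and> (\<forall>i<n. r \<notin> bad (f i))) = (r \<in> carrier R \<and> (\<forall>i<n. r \<notin> bad (g i)))"
      by (rule arg_cong)
  qed
  then obtain p where pp: "\<forall>n::nat. p n \<in> carrier R \<and> (\<forall>i<n. p n \<notin> bad (p i))" by (rule exE)
  then have p: "\<And>n. p n \<in> carrier R" "\<And>i n. i < n \<Longrightarrow> p n \<notin> bad (p i)" by simp_all
  have main: "attractor (p i) k \<noteq> attractor (p j) l" if "i < j" for i j k l
  proof -
    have nb: "p j \<noteq> p i" "p j \<noteq> \<one> \<oplus> p i" "p j \<noteq> p i \<oplus> \<ominus> \<one>"
      using p(2)[OF that] unfolding bad_def by blast+
    have "p i \<noteq> \<one> \<oplus> p j"
    proof
      assume "p i = \<one> \<oplus> p j"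
      then have "p i = p j \<oplus> \<one>" using a_comm[OF one_closed p(1)[of j]] by simp
      then have "p i \<oplus> \<ominus> \<one> = p j" using p(1)[of j] by (simp add: a_assoc r_neg)
      then show False using nb(3) by simp
    qed
    then show ?thesis using nb p(1) unfolding attractor_def by auto
  qed
  have "attractor (p i) k \<noteq> attractor (p j) l" if "i \<noteq> j" for i j k l
    using main[of i j k l] main[of j i l k] that by (cases "i < j") auto
  then show ?thesis using that p(1) by blast
qed

text \<open>With \<open>N\<close> the sum of the absolute values of the exponents, \<open>r^N\<close> times the trace is a
  polynomial \<open>T\<close> in \<open>r\<close>, and \<open>T \<zero> \<noteq> \<zero>\<close> by \<open>word_scaled_zero\<close>: the line of the first syllable
  differs from the kernel of the last one, by cyclic reducedness or, for a word with one
  syllable, because the two eigenlines are distinct. For each forbidden value \<open>\<sigma>\<close> the polynomial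
  \<open>T r - \<sigma> r^N\<close> is therefore nonzero at \<open>r = \<zero>\<close>, and a common nonroot exists since the field is
  infinite.\<close>

lemma word_trace_avoids_reduced:
  assumes inf: "infinite (carrier R)" and S: "finite S" "S \<subseteq> carrier R" and w: "cyclically_reduced w"
  shows "\<exists>A. range A \<subseteq> carrier SL2 \<and> mat_trace (word_eval SL2 A w) \<notin> S"
proof -
  interpret G: group SL2 by (rule SL2_group)
  obtain p :: "nat \<Rightarrow> 'a" where p: "\<And>i. p i \<in> carrier R"
    and gen: "\<And>i j k l. i \<noteq> j \<Longrightarrow> attractor (p i) k \<noteq> attractor (p j) l"
    using exists_generic_sequence[OF inf] by blast
  note lc = attractor_closed[OF p]
  have w': "w \<noteq> []" "\<forall>q\<in>set w. snd q \<noteq> 0" "successively (\<lambda>q q'. fst q \<noteq> fst q') w"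
    "length w \<ge> 2 \<Longrightarrow> fst (hd w) \<noteq> fst (last w)"
    using w unfolding cyclically_reduced_def by blast+
  obtain c where c: "c \<in> carrier R" "c \<noteq> \<zero>" "word_scaled p w \<zero> =
    mat_scale c (rank1 (attractor (p (fst (hd w))) (snd (hd w))) (attractor (p (fst (last w))) (- snd (last w))))"
    using word_scaled_zero[of p w] p gen w'(1-3) by blast
  define T where "T r = mat_trace (word_scaled p w r)" for r
  have Tp: "polyfn T" unfolding T_def by (rule poly_mat_trace[OF poly_mat_word_scaled[OF p]])
  have ne: "attractor (p (fst (hd w))) (snd (hd w)) \<noteq> attractor (p (fst (last w))) (- snd (last w))"
  proof (cases "length w \<ge> 2")
    case True
    show ?thesis by (rule gen[OF w'(4)[OF True]])
  next
    case False
    then obtain q where q: "w = [q]" using w'(1) by (cases w; cases "tl w") auto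
    then have "snd q \<noteq> 0" using w'(2) by simp
    then have "attractor (p (fst q)) (snd q) \<noteq> attractor (p (fst q)) (- snd q)"
      using p[of "fst q"] unfolding attractor_def by auto
    then show ?thesis unfolding q by simp
  qed
  have T0: "T \<zero> \<noteq> \<zero>"
  proof -
    have "T \<zero> = c \<otimes> (attractor (p (fst (hd w))) (snd (hd w)) \<oplus> \<ominus> attractor (p (fst (last w))) (- snd (last w)))"
      unfolding T_def c(3) using mat_trace_sm[OF rank1_closed[OF lc lc] c(1)] mat_trace_rank1[OF lc lc] by simp
    moreover have "attractor (p (fst (hd w))) (snd (hd w)) \<oplus> \<ominus> attractor (p (fst (last w))) (- snd (last w)) \<noteq> \<zero>"
      using ne lc r_right_minus_eq minus_eq by metis
    ultimately show ?thesis using c(1,2) lc by (simp add: integral_iff)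
  qed
  define N where "N = word_size w"
  have N: "N \<noteq> 0"
  proof -
    obtain q v where "w = q # v" using w'(1) by (cases w) auto
    moreover obtain i k where "q = (i, k)" by fastforce
    ultimately show ?thesis using w'(2) by (simp add: N_def word_size_def)
  qed
  define h where "h \<sigma> r = T r \<oplus> \<ominus> \<sigma> \<otimes> r [^] N" for \<sigma> r
  have fin: "finite {r \<in> carrier R. h \<sigma> r = \<zero>}" if \<sigma>: "\<sigma> \<in> S" for \<sigma>
  proof (rule polyfn_finite_zeros[of "h \<sigma>" \<zero>])
    have sc: "\<sigma> \<in> carrier R" using S(2) \<sigma> by blast
    show "polyfn (h \<sigma>)" unfolding h_def
      using sc by (intro polyfn_add Tp polyfn_mult polyfn_const polyfn_pow) simp
    show "h \<sigma> \<zero> \<noteq> \<zero>"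
      unfolding h_def nat_pow_zero[OF N] using T0 sc polyfn_closed[OF Tp zero_closed] by simp
  qed simp
  have "finite (insert \<zero> (\<Union>\<sigma>\<in>S. {r \<in> carrier R. h \<sigma> r = \<zero>}))" using S(1) fin by simp
  then have "infinite (carrier R - insert \<zero> (\<Union>\<sigma>\<in>S. {r \<in> carrier R. h \<sigma> r = \<zero>}))"
    using inf by simp
  then obtain r where "r \<in> carrier R - insert \<zero> (\<Union>\<sigma>\<in>S. {r \<in> carrier R. h \<sigma> r = \<zero>})"
    using infinite_imp_nonempty by blast
  then have r: "r \<in> carrier R" "r \<noteq> \<zero>" "\<And>\<sigma>. \<sigma> \<in> S \<Longrightarrow> h \<sigma> r \<noteq> \<zero>" by auto
  let ?A = "\<lambda>i. torus (p i) (inv r) r"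
  have iv: "inv r \<in> carrier R" "inv r \<otimes> r = \<one>" using r by (simp_all add: field_Units)
  have A: "range ?A \<subseteq> carrier SL2" using torus_SL2[OF p r(1) iv] by blast
  have WM: "word_eval SL2 ?A w \<in> M2" by (rule SL2_M2[OF G.word_eval_closed[OF A]])
  have "mat_trace (word_eval SL2 ?A w) \<notin> S"
  proof
    assume s: "mat_trace (word_eval SL2 ?A w) \<in> S"
    have "T r = r [^] N \<otimes> mat_trace (word_eval SL2 ?A w)"
      unfolding T_def N_def word_scaled_eq[OF p r(1,2), symmetric]
      using mat_trace_sm[OF WM] r(1) by simp
    then have "h (mat_trace (word_eval SL2 ?A w)) r = \<zero>"
      unfolding h_def using r(1) mat_trace_closed[OF WM] by (simp add: l_minus r_minus m_comm r_neg)
    then show False using r(3)[OF s] by blast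
  qed
  then show ?thesis using A by blast
qed

text \<open>The trace is invariant under conjugation, so cyclically reduced words suffice.\<close>

lemma word_trace_avoids:
  assumes inf: "infinite (carrier R)" and S: "finite S" "S \<subseteq> carrier R" and w: "nontrivial_word w"
  shows "\<exists>A. range A \<subseteq> carrier SL2 \<and> mat_trace (word_eval SL2 A w) \<notin> S"
proof -
  interpret G: group SL2 by (rule SL2_group)
  let ?P = "\<lambda>w. \<exists>A. range A \<subseteq> carrier SL2 \<and> mat_trace (word_eval SL2 A w) \<notin> S"
  show ?thesis
  proof (rule conjugate_reduction_induct[of ?P])
    show "?P w" if "cyclically_reduced w" for w by (rule word_trace_avoids_reduced[OF inf S that])
    show "?P w" if ww: "word_eq w w'" "?P w'" for w w'
    proof -
      obtain A where A: "range A \<subseteq> carrier SL2" "mat_trace (word_eval SL2 A w') \<notin> S" using ww(2) by blast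
      then have "mat_trace (word_eval SL2 A w) \<notin> S" using G.word_eval_cong[OF ww(1) A(1)] by simp
      then show ?thesis using A(1) by blast
    qed
    show "?P ((i, k) # u @ [(i, l)])" if rot: "?P ((i, l + k) # u)" for i k l u
    proof -
      obtain A where A: "range A \<subseteq> carrier SL2" "mat_trace (word_eval SL2 A ((i, l + k) # u)) \<notin> S"
        using rot by blast
      note cl = SL2_M2[OF G.word_eval_closed[OF A(1)]]
      have "mat_trace (word_eval SL2 A ((i, k) # u @ [(i, l)])) = mat_trace (word_eval SL2 A (((i, k) # u) @ [(i, l)]))"
        by simp
      also have "\<dots> = mat_trace (word_eval SL2 A ([(i, l)] @ ((i, k) # u)))"
        unfolding G.word_eval_append[OF A(1)] SL2_simps by (rule mat_trace_comm[OF cl cl])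
      also have "word_eval SL2 A ([(i, l)] @ ((i, k) # u)) = word_eval SL2 A ([(i, l + k)] @ u)"
        using word_eq.append[OF word_eq.add word_eq.refl, of i l k u]
        by (intro G.word_eval_cong[OF _ A(1)]) simp
      finally have "mat_trace (word_eval SL2 A ((i, k) # u @ [(i, l)])) \<notin> S" using A(2) by simp
      then show ?thesis using A(1) by blast
    qed
    show "\<not> word_eq w []" using w unfolding nontrivial_word_def .
  qed
qed

end

section \<open>Block operators\<close>

lemma hom_word_eval:
  assumes "group G" "group H" "h \<in> hom G H" "range c \<subseteq> carrier G"
  shows "h (word_eval G c w) = word_eval H (\<lambda>i. h (c i)) w"
proof -
  interpret group_hom G H h
    using assms by (simp add: group_hom_def group_hom_axioms_def)
  show ?thesis
  proof (induction w)
    case Nil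
    then show ?case by (simp add: word_eval_def)
  next
    case (Cons q w)
    obtain i k where q: "q = (i, k)" by fastforce
    have ci: "c i \<in> carrier G" using assms(4) by auto
    have "word_eval G c (q # w) = c i [^]\<^bsub>G\<^esub> k \<otimes>\<^bsub>G\<^esub> word_eval G c w"
      by (simp add: word_eval_def q)
    then have "h (word_eval G c (q # w)) = h (c i) [^]\<^bsub>H\<^esub> k \<otimes>\<^bsub>H\<^esub> h (word_eval G c w)"
      using ci G.word_eval_closed[OF assms(4)] hom_int_pow by simp
    then show ?case using Cons by (simp add: word_eval_def q)
  qed
qed

lemma word_eval_letters_cong:
  assumes "\<And>i. i \<in> fst ` set w \<Longrightarrow> c i = c' i" shows "word_eval G c w = word_eval G c' w"
  using assms
proof (induction w)
  case (Cons q w)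
  obtain i k where q: "q = (i, k)" by fastforce
  have "word_eval G c w = word_eval G c' w" using Cons by simp
  moreover have "c i = c' i" using Cons(2) q by force
  ultimately show ?case by (simp add: word_eval_def q)
qed (simp add: word_eval_def)

text \<open>A maximal commutative subset \<open>K\<close> together with a finite basis over it. The ring \<open>E\<close> of
  \<open>K\<close>-linear endomorphisms is then a matrix ring over \<open>K\<close>.\<close>

locale splitting = skew_field R for R (structure) +
  fixes K :: "'a set" and n :: nat and e :: "nat \<Rightarrow> 'a"
  assumes K: "centralizer K = K"
    and e_closed: "\<And>i. i < n \<Longrightarrow> e i \<in> carrier R"
    and e_span: "left_spanning {..<n} e K" and e_ind: "left_independent {..<n} e K"
begin

abbreviation E where "E \<equiv> endos K"

lemma K_subfield: "subfield K R" by (rule self_centralizing_subfield[OF K])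

lemmas K_subring = subfieldE(1)[OF K_subfield]
lemmas K_sub = subringE[OF K_subring]

lemma K_carrier: "k \<in> K \<Longrightarrow> k \<in> carrier R" using K_sub(1) by blast

lemma K_comm: "k \<in> K \<Longrightarrow> l \<in> K \<Longrightarrow> k \<otimes> l = l \<otimes> k"
  using subcring.sub_m_comm[OF subdomain.axioms(1)[OF subfield.axioms(1)[OF K_subfield]]] .

lemma K_inv: "k \<in> K \<Longrightarrow> k \<noteq> \<zero> \<Longrightarrow> inv k \<in> K"
  using subfield_m_inv[OF K_subfield, of k] by simp

sublocale L: field "R\<lparr>carrier := K\<rparr>" using subfield_iff(2)[OF K_subfield] .

sublocale E: central_subfield "endos K" "lmul ` K" by (rule lmul_central_subfield[OF K_subfield])

lemmas E_closed = endos_closed[OF K_sub(1)]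
lemmas E_apply = endos_apply[where K = K]

lemma E_eq_on_basis:
  assumes "f \<in> carrier E" "g \<in> carrier E" "\<And>i. i < n \<Longrightarrow> f (e i) = g (e i)"
  shows "f = g"
proof (rule endos_eqI[OF assms(1,2)])
  fix x assume "x \<in> carrier R"
  then obtain u where u: "\<forall>i\<in>{..<n}. u i \<in> K" "x = (\<Oplus>i\<in>{..<n}. u i \<otimes> e i)"
    using e_span unfolding left_spanning_def by blast
  have c: "u i \<in> K" "u i \<in> carrier R" "e i \<in> carrier R" if "i < n" for i
    using u(1) K_carrier e_closed that by auto
  have lin: "h x = (\<Oplus>i\<in>{..<n}. u i \<otimes> h (e i))" if h: "h \<in> carrier E" for h
    unfolding u(2)
    using endos_lincomb[OF h, of "{..<n}" u e] c by simp
  show "f x = g x"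
    unfolding lin[OF assms(1)] lin[OF assms(2)]
    using c assms(3) endosD(2)[OF assms(2)] by (intro finsum_cong') auto
qed

text \<open>The dual operators provided by density, multiplied on the right by the \<open>y i\<close>, add up to the
  linear map with prescribed values on the basis.\<close>

lemma basis_map_exists:
  assumes y: "\<And>i. i < n \<Longrightarrow> y i \<in> carrier R"
  shows "\<exists>f. f \<in> carrier E \<and> (\<forall>i<n. f (e i) = y i)"
proof -
  obtain s where s: "\<And>i. i \<in> {..<n} \<Longrightarrow> s i \<in> bimod_ops K"
    "\<And>i j. i \<in> {..<n} \<Longrightarrow> j \<in> {..<n} \<Longrightarrow> s i (e j) = (if j = i then \<one> else \<zero>)"
    using jacobson_density[OF K_subring, of "{..<n}" e] e_closed e_ind unfolding K by auto
  have sc: "s i x \<in> carrier R" if "i < n" "x \<in> carrier R" for i x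
    using bimod_ops_closed[OF K_subring s(1)] that by simp
  define g where "g x = (\<Oplus>i\<in>{..<n}. s i x \<otimes> y i)" for x
  have "g \<in> bimod_ops K"
    unfolding g_def
    using bimod_ops_finsum[OF K_subring, of "{..<n}" "\<lambda>i x. s i x \<otimes> y i"]
      bimod_ops_rmult[OF K_subring s(1) y] by simp
  then have "restrict g (carrier R) \<in> carrier E" by (rule bimod_ops_endos[OF K])
  moreover have "restrict g (carrier R) (e j) = y j" if j: "j < n" for j
  proof -
    have "g (e j) = (\<Oplus>i\<in>{..<n}. if j = i then y i else \<zero>)"
      unfolding g_def using s(2) j y by (intro finsum_cong') auto
    also have "\<dots> = y j" using j y by (intro finsum_singleton) auto
    finally show ?thesis using e_closed[OF j] by simp
  qed
  ultimately show ?thesis by blast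
qed

definition basis_map :: "(nat \<Rightarrow> 'a) \<Rightarrow> 'a \<Rightarrow> 'a" where
  "basis_map y = (SOME f. f \<in> carrier E \<and> (\<forall>i<n. f (e i) = y i))"

lemma basis_map:
  assumes "\<And>i. i < n \<Longrightarrow> y i \<in> carrier R"
  shows "basis_map y \<in> carrier E" "\<And>i. i < n \<Longrightarrow> basis_map y (e i) = y i"
  using someI_ex[OF basis_map_exists[of y]] assms unfolding basis_map_def by blast+

text \<open>The image of the basis vector \<open>e i\<close> under the block diagonal operator with the \<open>2 \<times> 2\<close> blocks
  \<open>M s\<close> on the pairs \<open>e (2 * s)\<close>, \<open>e (Suc (2 * s))\<close>. If the dimension is odd, the last basis
  vector is fixed. Matrices act on rows, in accordance with the order of composition in \<open>E\<close>.\<close>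

definition block_image :: "(nat \<Rightarrow> 'a mat2) \<Rightarrow> nat \<Rightarrow> 'a" where
  "block_image M i = (case M (i div 2) of (a, b, c, d) \<Rightarrow>
     if odd i then c \<otimes> e (i - 1) \<oplus> d \<otimes> e i
     else if Suc i < n then a \<otimes> e i \<oplus> b \<otimes> e (Suc i) else e i)"

definition block_op :: "(nat \<Rightarrow> 'a mat2) \<Rightarrow> 'a \<Rightarrow> 'a" where
  "block_op M = basis_map (block_image M)"

lemma block_image_closed:
  assumes "M (i div 2) \<in> L.M2" "i < n" shows "block_image M i \<in> carrier R"
proof -
  obtain a b c d where M: "M (i div 2) = (a, b, c, d)" by (cases "M (i div 2)")
  then have abcd: "a \<in> carrier R" "b \<in> carrier R" "c \<in> carrier R" "d \<in> carrier R"
    using assms(1) K_carrier by auto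
  have "e i \<in> carrier R" "e (i - 1) \<in> carrier R" using assms(2) by (auto intro: e_closed)
  then show ?thesis using abcd e_closed[of "Suc i"] by (simp add: block_image_def M)
qed

lemma block_op:
  assumes "\<And>s. M s \<in> L.M2"
  shows "block_op M \<in> carrier E" "\<And>i. i < n \<Longrightarrow> block_op M (e i) = block_image M i"
proof -
  have c: "block_image M i \<in> carrier R" if "i < n" for i
    by (rule block_image_closed[OF assms that])
  show "block_op M \<in> carrier E" unfolding block_op_def by (rule basis_map(1)[OF c])
  show "block_op M (e i) = block_image M i" if "i < n" for i
    unfolding block_op_def by (rule basis_map(2)[of "block_image M", OF c that])
qed

lemma block_op_pair:
  assumes "\<And>s. M s \<in> L.M2" "M s = (a, b, c, d)" "Suc (2 * s) < n"
  shows "block_op M (e (2 * s)) = a \<otimes> e (2 * s) \<oplus> b \<otimes> e (Suc (2 * s))"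
    "block_op M (e (Suc (2 * s))) = c \<otimes> e (2 * s) \<oplus> d \<otimes> e (Suc (2 * s))"
  using block_op(2)[OF assms(1), of "2 * s"] block_op(2)[OF assms(1), of "Suc (2 * s)"] assms(2,3)
  by (simp_all add: block_image_def)

lemma block_op_last:
  assumes "\<And>s. M s \<in> L.M2" "2 * s < n" "\<not> Suc (2 * s) < n"
  shows "block_op M (e (2 * s)) = e (2 * s)"
  using block_op(2)[OF assms(1), of "2 * s"] assms(2,3)
  by (simp add: block_image_def split: prod.splits)

lemma basis_cases:
  assumes "i < n"
  obtains s where "Suc (2 * s) < n" "i = 2 * s" | s where "Suc (2 * s) < n" "i = Suc (2 * s)"
    | s where "2 * s < n" "\<not> Suc (2 * s) < n" "i = 2 * s"
proof (cases "even i")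
  case True
  then obtain s where "i = 2 * s" by (auto elim: evenE)
  then show ?thesis using that(1)[of s] that(3)[of s] assms by blast
next
  case False
  then obtain s where "i = Suc (2 * s)" by (auto elim: oddE)
  then show ?thesis using that(2)[of s] assms by blast
qed

lemma block_op_mult:
  assumes M: "\<And>s. M s \<in> L.M2" and M': "\<And>s. M' s \<in> L.M2"
  shows "block_op (\<lambda>s. L.mat_mult (M s) (M' s)) = block_op M \<otimes>\<^bsub>E\<^esub> block_op M'"
proof (rule E_eq_on_basis)
  have MM: "L.mat_mult (M s) (M' s) \<in> L.M2" for s by (rule L.mat_mult_closed[OF M M'])
  note B = block_op(1)[of M, OF M] and B' = block_op(1)[of M', OF M']
  show "block_op (\<lambda>s. L.mat_mult (M s) (M' s)) \<in> carrier E" by (rule block_op(1)[of "\<lambda>s. L.mat_mult (M s) (M' s)", OF MM])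
  show "block_op M \<otimes>\<^bsub>E\<^esub> block_op M' \<in> carrier E" by (rule E_closed(1)[OF B B'])
  fix i assume i: "i < n"
  have ei: "e i \<in> carrier R" by (rule e_closed[OF i])
  have ap: "(block_op M \<otimes>\<^bsub>E\<^esub> block_op M') (e i) = block_op M' (block_op M (e i))"
    by (rule E_apply(1)[OF ei])
  have lin: "block_op M' (x \<otimes> y \<oplus> x' \<otimes> y') = x \<otimes> block_op M' y \<oplus> x' \<otimes> block_op M' y'"
    if "x \<in> K" "x' \<in> K" "y \<in> carrier R" "y' \<in> carrier R" for x x' y y'
    using that endosD(3,4)[OF B'] K_carrier by simp
  have pair: "x \<otimes> (p \<otimes> u \<oplus> q \<otimes> v) \<oplus> x' \<otimes> (p' \<otimes> u \<oplus> q' \<otimes> v) =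
      (x \<otimes> p \<oplus> x' \<otimes> p') \<otimes> u \<oplus> (x \<otimes> q \<oplus> x' \<otimes> q') \<otimes> v"
    if "x \<in> carrier R" "x' \<in> carrier R" "p \<in> carrier R" "q \<in> carrier R" "p' \<in> carrier R" "q' \<in> carrier R"
      "u \<in> carrier R" "v \<in> carrier R" for x x' p q p' q' u v
    using that by (simp add: r_distr l_distr m_assoc a_ac)
  show "block_op (\<lambda>s. L.mat_mult (M s) (M' s)) (e i) = (block_op M \<otimes>\<^bsub>E\<^esub> block_op M') (e i)"
    unfolding ap
  proof (rule basis_cases[OF i])
    fix s assume s: "Suc (2 * s) < n"
    obtain a b c d where m: "M s = (a, b, c, d)" by (cases "M s")
    obtain a' b' c' d' where m': "M' s = (a', b', c', d')" by (cases "M' s")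
    have cl: "a \<in> K" "b \<in> K" "c \<in> K" "d \<in> K" using M[of s] m by auto
    have cl': "a' \<in> K" "b' \<in> K" "c' \<in> K" "d' \<in> K" using M'[of s] m' by auto
    have ec: "e (2 * s) \<in> carrier R" "e (Suc (2 * s)) \<in> carrier R" using s by (auto intro: e_closed)
    have mm: "L.mat_mult (M s) (M' s) = (a \<otimes> a' \<oplus> b \<otimes> c', a \<otimes> b' \<oplus> b \<otimes> d', c \<otimes> a' \<oplus> d \<otimes> c', c \<otimes> b' \<oplus> d \<otimes> d')"
      by (simp add: m m')
    note p1 = block_op_pair[of "\<lambda>s. L.mat_mult (M s) (M' s)", OF MM mm s]
    note p2 = block_op_pair[of M, OF M m s] and p3 = block_op_pair[of M', OF M' m' s]
    show "block_op (\<lambda>s. L.mat_mult (M s) (M' s)) (e i) = block_op M' (block_op M (e i))" if "i = 2 * s"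
      unfolding that p1 p2 lin[OF cl(1,2) ec] p3
      using cl cl' ec K_carrier by (intro pair[symmetric]) auto
    show "block_op (\<lambda>s. L.mat_mult (M s) (M' s)) (e i) = block_op M' (block_op M (e i))" if "i = Suc (2 * s)"
      unfolding that p1 p2 lin[OF cl(3,4) ec] p3
      using cl cl' ec K_carrier by (intro pair[symmetric]) auto
  next
    fix s assume s: "2 * s < n" "\<not> Suc (2 * s) < n" "i = 2 * s"
    show "block_op (\<lambda>s. L.mat_mult (M s) (M' s)) (e i) = block_op M' (block_op M (e i))"
      unfolding s(3) block_op_last[of "\<lambda>s. L.mat_mult (M s) (M' s)", OF MM s(1,2)]
        block_op_last[of M, OF M s(1,2)] block_op_last[of M', OF M' s(1,2)] ..
  qed
qed

lemma block_op_one: "block_op (\<lambda>s. (\<one>, \<zero>, \<zero>, \<one>)) = \<one>\<^bsub>E\<^esub>"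
proof (rule E_eq_on_basis)
  have M: "(\<one>, \<zero>, \<zero>, \<one>) \<in> L.M2" using K_sub(2,3) by simp
  show "block_op (\<lambda>s. (\<one>, \<zero>, \<zero>, \<one>)) \<in> carrier E" by (rule block_op(1)[of "\<lambda>s. (\<one>, \<zero>, \<zero>, \<one>)", OF M])
  show "\<one>\<^bsub>E\<^esub> \<in> carrier E" by (rule E_closed(3))
  fix i assume i: "i < n"
  have "e i \<in> carrier R" "Suc i < n \<Longrightarrow> e (Suc i) \<in> carrier R" "e (i - 1) \<in> carrier R"
    using i by (auto intro: e_closed)
  then show "block_op (\<lambda>s. (\<one>, \<zero>, \<zero>, \<one>)) (e i) = \<one>\<^bsub>E\<^esub> (e i)"
    using block_op(2)[of "\<lambda>s. (\<one>, \<zero>, \<zero>, \<one>)", OF M i] by (simp add: block_image_def E_apply)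
qed

text \<open>One block for each natural number: only the first ones matter for an operator, but with all of
  them evaluation at \<open>s\<close> is a homomorphism and no bounds are carried along.\<close>

definition block_group :: "(nat \<Rightarrow> 'a mat2) monoid" where
  "block_group = \<lparr>carrier = {M. \<forall>s. M s \<in> carrier L.SL2}, monoid.mult = (\<lambda>M M' s. L.mat_mult (M s) (M' s)),
     one = (\<lambda>s. (\<one>, \<zero>, \<zero>, \<one>))\<rparr>"

lemma block_group_simps: "M \<in> carrier block_group \<longleftrightarrow> (\<forall>s. M s \<in> carrier L.SL2)"
  "M \<otimes>\<^bsub>block_group\<^esub> M' = (\<lambda>s. L.mat_mult (M s) (M' s))" "\<one>\<^bsub>block_group\<^esub> = (\<lambda>s. (\<one>, \<zero>, \<zero>, \<one>))"
  by (simp_all add: block_group_def)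

lemma block_group_group: "group block_group"
proof (rule groupI)
  interpret G: group L.SL2 by (rule L.SL2_group)
  have one: "\<one>\<^bsub>L.SL2\<^esub> = (\<one>, \<zero>, \<zero>, \<one>)" by simp
  show "\<one>\<^bsub>block_group\<^esub> \<in> carrier block_group" using G.one_closed by (simp add: block_group_simps)
  fix M assume M: "M \<in> carrier block_group"
  show "\<one>\<^bsub>block_group\<^esub> \<otimes>\<^bsub>block_group\<^esub> M = M" using G.l_one M by (simp add: block_group_simps fun_eq_iff)
  have "(\<lambda>s. inv\<^bsub>L.SL2\<^esub> (M s)) \<in> carrier block_group" using M by (simp add: block_group_simps)
  moreover have "(\<lambda>s. inv\<^bsub>L.SL2\<^esub> (M s)) \<otimes>\<^bsub>block_group\<^esub> M = \<one>\<^bsub>block_group\<^esub>"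
    using G.l_inv M by (simp add: block_group_simps fun_eq_iff)
  ultimately show "\<exists>M'\<in>carrier block_group. M' \<otimes>\<^bsub>block_group\<^esub> M = \<one>\<^bsub>block_group\<^esub>" by blast
  fix M' assume M': "M' \<in> carrier block_group"
  show "M \<otimes>\<^bsub>block_group\<^esub> M' \<in> carrier block_group" using G.m_closed M M' by (simp add: block_group_simps)
  fix M'' assume M'': "M'' \<in> carrier block_group"
  show "M \<otimes>\<^bsub>block_group\<^esub> M' \<otimes>\<^bsub>block_group\<^esub> M'' = M \<otimes>\<^bsub>block_group\<^esub> (M' \<otimes>\<^bsub>block_group\<^esub> M'')"
    using G.m_assoc M M' M'' by (simp add: block_group_simps fun_eq_iff)
qed

lemma block_group_M2: "M \<in> carrier block_group \<Longrightarrow> M s \<in> L.M2"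
  using L.SL2_M2 by (simp add: block_group_simps)

lemma block_op_Units: "M \<in> carrier block_group \<Longrightarrow> block_op M \<in> Units E"
  and block_op_inv: "M \<in> carrier block_group \<Longrightarrow> inv\<^bsub>E\<^esub> (block_op M) = block_op (inv\<^bsub>block_group\<^esub> M)"
proof -
  interpret G: group block_group by (rule block_group_group)
  assume M: "M \<in> carrier block_group"
  note I = G.inv_closed[OF M]
  have "block_op M \<otimes>\<^bsub>E\<^esub> block_op (inv\<^bsub>block_group\<^esub> M) = block_op (M \<otimes>\<^bsub>block_group\<^esub> inv\<^bsub>block_group\<^esub> M)"
    unfolding block_group_simps by (rule block_op_mult[of M "inv\<^bsub>block_group\<^esub> M", symmetric, OF block_group_M2[OF M] block_group_M2[OF I]])
  then have 1: "block_op M \<otimes>\<^bsub>E\<^esub> block_op (inv\<^bsub>block_group\<^esub> M) = \<one>\<^bsub>E\<^esub>"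
    unfolding G.r_inv[OF M] block_group_simps(3) block_op_one .
  have "block_op (inv\<^bsub>block_group\<^esub> M) \<otimes>\<^bsub>E\<^esub> block_op M = block_op (inv\<^bsub>block_group\<^esub> M \<otimes>\<^bsub>block_group\<^esub> M)"
    unfolding block_group_simps by (rule block_op_mult[of "inv\<^bsub>block_group\<^esub> M" M, symmetric, OF block_group_M2[OF I] block_group_M2[OF M]])
  then have 2: "block_op (inv\<^bsub>block_group\<^esub> M) \<otimes>\<^bsub>E\<^esub> block_op M = \<one>\<^bsub>E\<^esub>"
    unfolding G.l_inv[OF M] block_group_simps(3) block_op_one .
  note c = block_op(1)[of M, OF block_group_M2[OF M]] block_op(1)[of "inv\<^bsub>block_group\<^esub> M", OF block_group_M2[OF I]]
  show "block_op M \<in> Units E" unfolding Units_def using 1 2 c by blast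
  show "inv\<^bsub>E\<^esub> (block_op M) = block_op (inv\<^bsub>block_group\<^esub> M)" using E.inv_unique'[OF c 1 2] by simp
qed

text \<open>A word is evaluated blockwise, since both \<open>block_op\<close> and the projection to a block are
  homomorphisms.\<close>

lemma block_op_word:
  assumes "\<And>i. C i \<in> carrier block_group"
  shows "word_eval E (\<lambda>i. block_op (C i)) w = block_op (\<lambda>s. word_eval L.SL2 (\<lambda>i. C i s) w)"
proof -
  interpret G: group block_group by (rule block_group_group)
  have rC: "range C \<subseteq> carrier block_group" using assms by blast
  have h: "block_op \<in> hom block_group (units_of E)"
    using block_op_Units block_op_mult[OF block_group_M2 block_group_M2]
    by (intro homI) (simp_all add: units_of_carrier units_of_mult block_group_simps(2))
  have "word_eval E (\<lambda>i. block_op (C i)) w = word_eval (units_of E) (\<lambda>i. block_op (C i)) w"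
    using block_op_Units[OF assms] by (intro E.word_eval_units_of[symmetric]) blast
  also have "\<dots> = block_op (word_eval block_group C w)"
    by (rule hom_word_eval[symmetric, OF block_group_group E.units_group h rC])
  also have "word_eval block_group C w = (\<lambda>s. word_eval L.SL2 (\<lambda>i. C i s) w)"
  proof
    fix s
    have "(\<lambda>M. M s) \<in> hom block_group L.SL2" by (intro homI) (simp_all add: block_group_simps)
    from hom_word_eval[OF block_group_group L.SL2_group this rC]
    show "word_eval block_group C w s = word_eval L.SL2 (\<lambda>i. C i s) w" .
  qed
  finally show ?thesis .
qed

section \<open>Cyclic vectors\<close>

definition subspace :: "'a set \<Rightarrow> bool" where
  "subspace W \<longleftrightarrow> W \<subseteq> carrier R \<and> (\<forall>x\<in>W. \<forall>y\<in>W. x \<oplus> y \<in> W) \<and> (\<forall>k\<in>K. \<forall>x\<in>W. k \<otimes> x \<in> W)"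

lemma subspaceD:
  assumes "subspace W"
  shows "x \<in> W \<Longrightarrow> x \<in> carrier R" "x \<in> W \<Longrightarrow> y \<in> W \<Longrightarrow> x \<oplus> y \<in> W"
    "k \<in> K \<Longrightarrow> x \<in> W \<Longrightarrow> k \<otimes> x \<in> W"
  using assms unfolding subspace_def by auto

lemma subspace_minus:
  assumes W: "subspace W" and "x \<in> W" shows "\<ominus> x \<in> W"
proof -
  have "(\<ominus> \<one>) \<otimes> x \<in> W" using subspaceD(3)[OF W K_sub(5)[OF K_sub(3)] assms(2)] .
  then show ?thesis using subspaceD(1)[OF W assms(2)] by (simp add: l_minus)
qed

lemma subspace_cancel:
  assumes W: "subspace W" and k: "k \<in> K" "k \<noteq> \<zero>" and x: "x \<in> carrier R" "k \<otimes> x \<in> W"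
  shows "x \<in> W"
proof -
  note kc = K_carrier[OF k(1)]
  have "inv k \<otimes> (k \<otimes> x) \<in> W" using subspaceD(3)[OF W K_inv[OF k] x(2)] .
  moreover have "inv k \<otimes> (k \<otimes> x) = x"
    using inv_nonzero[OF kc k(2)] kc x(1) by (simp add: m_assoc[symmetric])
  ultimately show ?thesis by simp
qed

text \<open>Applying \<open>U - \<tau>\<close> with the last eigenvalue \<open>\<tau>\<close> removes the last summand and multiplies each
  other one by a nonzero scalar.\<close>

lemma eigenvectors_in_subspace:
  fixes m :: nat
  assumes W: "subspace W" and U: "U \<in> carrier E" "\<And>x. x \<in> W \<Longrightarrow> U x \<in> W"
    and \<tau>: "\<And>s. s < m \<Longrightarrow> \<tau> s \<in> K" "\<And>s t. s < t \<Longrightarrow> t < m \<Longrightarrow> \<tau> s \<noteq> \<tau> t"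
    and v: "\<And>s. s < m \<Longrightarrow> v s \<in> carrier R" "\<And>s. s < m \<Longrightarrow> U (v s) = \<tau> s \<otimes> v s"
    and sum: "(\<Oplus>s\<in>{..<m}. v s) \<in> W" and s: "s < m"
  shows "v s \<in> W"
  using \<tau> v sum s
proof (induction m arbitrary: v s)
  case (Suc m)
  note \<tau> = Suc.prems(1,2) and v = Suc.prems(3,4)
  let ?x = "\<Oplus>s\<in>{..<m}. v s"
  have vc: "v s \<in> carrier R" "\<tau> s \<in> carrier R" if "s < Suc m" for s using v(1) \<tau>(1) K_carrier that by blast+
  have xc: "?x \<in> carrier R" using vc by (intro finsum_closed) auto
  have xm: "(\<Oplus>s\<in>{..<Suc m}. v s) = v m \<oplus> ?x"
    unfolding lessThan_Suc using vc by (intro finsum_insert) auto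
  have xW: "v m \<oplus> ?x \<in> W" using Suc.prems(5) unfolding xm .
  let ?v = "\<lambda>s. (\<tau> s \<oplus> \<ominus> \<tau> m) \<otimes> v s"
  have Ux: "U ?x = (\<Oplus>s\<in>{..<m}. \<tau> s \<otimes> v s)"
  proof -
    have "U ?x = U (\<Oplus>s\<in>{..<m}. \<one> \<otimes> v s)"
      using vc by (intro arg_cong[where f = U] finsum_cong') auto
    also have "\<dots> = (\<Oplus>s\<in>{..<m}. \<one> \<otimes> U (v s))"
      using endos_lincomb[OF U(1), of "{..<m}" "\<lambda>s. \<one>" v] vc K_sub(3) K_sub(1) by auto
    also have "\<dots> = (\<Oplus>s\<in>{..<m}. \<tau> s \<otimes> v s)"
      using v vc by (intro finsum_cong') auto
    finally show ?thesis .
  qed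
  have "U (v m \<oplus> ?x) \<oplus> (\<ominus> \<tau> m) \<otimes> (v m \<oplus> ?x) \<in> W"
    using subspaceD(2,3)[OF W] U(2)[OF xW] xW K_sub(5)[OF \<tau>(1)[of m]] by simp
  also have "U (v m \<oplus> ?x) \<oplus> (\<ominus> \<tau> m) \<otimes> (v m \<oplus> ?x) = (\<Oplus>s\<in>{..<m}. ?v s)"
  proof -
    let ?y = "\<Oplus>s\<in>{..<m}. \<tau> s \<otimes> v s"
    have yc: "?y \<in> carrier R" using vc by (intro finsum_closed) auto
    have "U (v m \<oplus> ?x) = \<tau> m \<otimes> v m \<oplus> ?y"
      using endosD(3)[OF U(1) vc(1)[of m] xc] v(2)[of m] Ux by simp
    then have "U (v m \<oplus> ?x) \<oplus> (\<ominus> \<tau> m) \<otimes> (v m \<oplus> ?x) =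
       (\<tau> m \<otimes> v m \<oplus> ?y) \<oplus> (\<ominus> (\<tau> m \<otimes> v m) \<oplus> (\<ominus> \<tau> m) \<otimes> ?x)"
      using vc[of m] xc by (simp add: r_distr l_minus)
    also have "\<dots> = (\<tau> m \<otimes> v m \<oplus> \<ominus> (\<tau> m \<otimes> v m)) \<oplus> (?y \<oplus> (\<ominus> \<tau> m) \<otimes> ?x)"
      using vc[of m] xc yc by (simp add: a_ac)
    also have "\<dots> = ?y \<oplus> (\<ominus> \<tau> m) \<otimes> ?x" using vc[of m] xc yc by (simp add: r_neg)
    also have "(\<ominus> \<tau> m) \<otimes> ?x = (\<Oplus>s\<in>{..<m}. (\<ominus> \<tau> m) \<otimes> v s)"
      using vc by (intro finsum_rdistr) auto
    also have "?y \<oplus> \<dots> = (\<Oplus>s\<in>{..<m}. \<tau> s \<otimes> v s \<oplus> (\<ominus> \<tau> m) \<otimes> v s)"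
      using vc by (intro finsum_addf[symmetric]) auto
    also have "\<dots> = (\<Oplus>s\<in>{..<m}. ?v s)"
      using vc by (intro finsum_cong') (auto simp: l_distr)
    finally show ?thesis .
  qed
  finally have sum': "(\<Oplus>s\<in>{..<m}. ?v s) \<in> W" .
  have vs: "v s \<in> W" if s: "s < m" for s
  proof -
    have dK: "\<tau> t \<oplus> \<ominus> \<tau> m \<in> K" if "t < m" for t
      using \<tau>(1)[of t] \<tau>(1)[of m] that K_sub(5,7) by simp
    have "?v s \<in> W"
    proof (rule Suc.IH[of ?v s])
      show "\<tau> s \<in> K" if "s < m" for s using \<tau>(1) that by simp
      show "\<tau> s \<noteq> \<tau> t" if "s < t" "t < m" for s t using \<tau>(2) that by simp
      show "?v t \<in> carrier R" if "t < m" for t using vc that by simp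
      show "U (?v t) = \<tau> t \<otimes> ?v t" if t: "t < m" for t
      proof -
        have "U (?v t) = (\<tau> t \<oplus> \<ominus> \<tau> m) \<otimes> (\<tau> t \<otimes> v t)"
          using endosD(4)[OF U(1) dK[OF t], of "v t"] vc[of t] v(2)[of t] t by simp
        also have "\<dots> = ((\<tau> t \<oplus> \<ominus> \<tau> m) \<otimes> \<tau> t) \<otimes> v t" using vc t by (simp add: m_assoc)
        also have "\<dots> = (\<tau> t \<otimes> (\<tau> t \<oplus> \<ominus> \<tau> m)) \<otimes> v t" using K_comm[OF dK[OF t] \<tau>(1)[of t]] t by simp
        also have "\<dots> = \<tau> t \<otimes> ?v t" using vc t by (simp add: m_assoc)
        finally show ?thesis .
      qed
    qed (use sum' s in auto)
    moreover have "\<tau> s \<oplus> \<ominus> \<tau> m \<noteq> \<zero>"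
      using eq_of_minus_zero[OF vc(2)[of s] vc(2)[of m]] \<tau>(2)[of s m] s by auto
    ultimately show ?thesis using subspace_cancel[OF W dK[OF s]] vc s by simp
  qed
  show ?case
  proof (cases "s < m")
    case True then show ?thesis by (rule vs)
  next
    case False
    then have sm: "s = m" using Suc.prems(6) by simp
    have "?x \<in> W"
    proof -
      have "(\<Oplus>s\<in>{..<k}. v s) \<in> W" if "k \<le> m" for k
        using that
      proof (induction k)
        case 0
        have "\<zero> \<otimes> (v m \<oplus> ?x) \<in> W" using subspaceD(3)[OF W K_sub(2) xW] .
        then show ?case using subspaceD(1)[OF W xW] by simp
      next
        case (Suc k)
        have "(\<Oplus>s\<in>{..<Suc k}. v s) = v k \<oplus> (\<Oplus>s\<in>{..<k}. v s)"
          unfolding lessThan_Suc using vc Suc by (intro finsum_insert) auto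
        then show ?case using subspaceD(2)[OF W vs[of k]] Suc by simp
      qed
      then show ?thesis by simp
    qed
    then have "(v m \<oplus> ?x) \<oplus> \<ominus> ?x \<in> W" using subspaceD(2)[OF W xW subspace_minus[OF W]] by simp
    then show ?thesis unfolding sm using vc[of m] xc by (simp add: a_assoc r_neg)
  qed
qed simp

lemma L_minus: "k \<in> K \<Longrightarrow> \<ominus>\<^bsub>R\<lparr>carrier := K\<rparr>\<^esub> k = \<ominus> k"
  using minus_equality[of "\<ominus>\<^bsub>R\<lparr>carrier := K\<rparr>\<^esub> k" k] L.l_neg[of k] L.a_inv_closed[of k] K_carrier
  by simp

text \<open>By the theorem of Cayley and Hamilton a matrix of determinant one plus its inverse is its
  trace.\<close>

lemma block_op_plus_inv:
  assumes W: "W \<in> carrier block_group" and i: "i < n"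
  shows "(block_op W \<oplus>\<^bsub>E\<^esub> inv\<^bsub>E\<^esub> (block_op W)) (e i) =
    (if Suc (2 * (i div 2)) < n then L.mat_trace (W (i div 2)) else \<one> \<oplus> \<one>) \<otimes> e i"
proof -
  interpret G: group block_group by (rule block_group_group)
  let ?V = "inv\<^bsub>block_group\<^esub> W"
  have V: "?V \<in> carrier block_group" by (rule G.inv_closed[OF W])
  note M = block_group_M2[OF W] and M' = block_group_M2[OF V]
  have ei: "e i \<in> carrier R" by (rule e_closed[OF i])
  have U: "(block_op W \<oplus>\<^bsub>E\<^esub> inv\<^bsub>E\<^esub> (block_op W)) (e i) = block_op W (e i) \<oplus> block_op ?V (e i)"
    unfolding block_op_inv[OF W] by (rule E_apply(2)[OF ei])
  have Vs: "?V s = (d, \<ominus> b, \<ominus> c, a)" if s: "W s = (a, b, c, d)" for s a b c d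
  proof -
    have Ws: "(a, b, c, d) \<in> carrier L.SL2" using W s unfolding block_group_simps by metis
    then have cl: "b \<in> K" "c \<in> K" by (auto simp: L.SL2_carrier)
    have h: "(\<lambda>M. M s) \<in> hom block_group L.SL2" by (intro homI) (simp_all add: block_group_simps)
    interpret H: group_hom block_group L.SL2 "\<lambda>M. M s"
      using block_group_group L.SL2_group h by (simp add: group_hom_def group_hom_axioms_def)
    have "?V s = inv\<^bsub>L.SL2\<^esub> (W s)" by (rule H.hom_inv[OF W])
    then show ?thesis unfolding s L.SL2_inv[OF Ws] L_minus[OF cl(1)] L_minus[OF cl(2)] .
  qed
  show ?thesis unfolding U
  proof (rule basis_cases[OF i])
    fix s assume s: "Suc (2 * s) < n"
    obtain a b c d where m: "W s = (a, b, c, d)" by (cases "W s")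
    have cl: "a \<in> carrier R" "b \<in> carrier R" "c \<in> carrier R" "d \<in> carrier R"
      using M[of s] K_carrier unfolding m by auto
    have ec: "e (2 * s) \<in> carrier R" "e (Suc (2 * s)) \<in> carrier R" using s by (auto intro: e_closed)
    note p = block_op_pair[of W, OF M m s] and q = block_op_pair[of ?V, OF M' Vs[OF m] s]
    have A: "(x \<otimes> u \<oplus> y \<otimes> v) \<oplus> (z \<otimes> u \<oplus> (\<ominus> y) \<otimes> v) = (x \<oplus> z) \<otimes> u"
      if "x \<in> carrier R" "y \<in> carrier R" "z \<in> carrier R" "u \<in> carrier R" "v \<in> carrier R" for x y z u v
    proof -
      have "(x \<otimes> u \<oplus> y \<otimes> v) \<oplus> (z \<otimes> u \<oplus> (\<ominus> y) \<otimes> v) = (x \<otimes> u \<oplus> z \<otimes> u) \<oplus> (y \<otimes> v \<oplus> \<ominus> (y \<otimes> v))"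
        using that by (simp add: l_minus a_ac)
      then show ?thesis using that by (simp add: r_neg l_distr)
    qed
    show "block_op W (e i) \<oplus> block_op ?V (e i) =
      (if Suc (2 * (i div 2)) < n then L.mat_trace (W (i div 2)) else \<one> \<oplus> \<one>) \<otimes> e i" if ieq: "i = 2 * s"
      using s unfolding ieq p q by (simp add: m A[OF cl(1,2,4) ec])
    show "block_op W (e i) \<oplus> block_op ?V (e i) =
      (if Suc (2 * (i div 2)) < n then L.mat_trace (W (i div 2)) else \<one> \<oplus> \<one>) \<otimes> e i" if ieq: "i = Suc (2 * s)"
    proof -
      have "(c \<otimes> e (2 * s) \<oplus> d \<otimes> e (Suc (2 * s))) \<oplus> ((\<ominus> c) \<otimes> e (2 * s) \<oplus> a \<otimes> e (Suc (2 * s))) =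
        (d \<otimes> e (Suc (2 * s)) \<oplus> c \<otimes> e (2 * s)) \<oplus> (a \<otimes> e (Suc (2 * s)) \<oplus> (\<ominus> c) \<otimes> e (2 * s))"
        using cl ec by (simp add: a_comm)
      also have "\<dots> = (d \<oplus> a) \<otimes> e (Suc (2 * s))" by (rule A[OF cl(4,3,1) ec(2,1)])
      finally show ?thesis using s unfolding ieq p q by (simp add: m a_comm[OF cl(4,1)])
    qed
  next
    fix s assume s: "2 * s < n" "\<not> Suc (2 * s) < n" "i = 2 * s"
    show "block_op W (e i) \<oplus> block_op ?V (e i) =
      (if Suc (2 * (i div 2)) < n then L.mat_trace (W (i div 2)) else \<one> \<oplus> \<one>) \<otimes> e i"
      using s(1,2) e_closed[OF s(1)]
      unfolding s(3) block_op_last[of W, OF M s(1,2)] block_op_last[of ?V, OF M' s(1,2)]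
      by (simp add: l_distr)
  qed
qed

text \<open>The vector is cyclic for the action of \<open>T\<close> on the block number \<open>s\<close>.\<close>

definition generates_block :: "('a \<Rightarrow> 'a) \<Rightarrow> nat \<Rightarrow> 'a \<Rightarrow> bool" where
  "generates_block T s v \<longleftrightarrow> (\<forall>S. subspace S \<and> (\<forall>x\<in>S. T x \<in> S) \<and> v \<in> S \<longrightarrow>
     e (2 * s) \<in> S \<and> (Suc (2 * s) < n \<longrightarrow> e (Suc (2 * s)) \<in> S))"

text \<open>\<open>T\<close> plus its inverse is a scalar on the block, so every vector of the block is an eigenvector
  of it, and a cyclic vector for \<open>T\<close> has to be found. Only scalar matrices have none; a scalar
  matrix of determinant one is \<open>\<one>\<close> or \<open>\<ominus> \<one>\<close>, with the two excluded traces.\<close>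

lemma block_eigenvector:
  assumes W: "W \<in> carrier block_group" and s: "2 * s < n"
    and \<tau>: "Suc (2 * s) < n \<Longrightarrow> L.mat_trace (W s) \<noteq> \<one> \<oplus> \<one> \<and> L.mat_trace (W s) \<noteq> \<ominus> (\<one> \<oplus> \<one>)"
  shows "\<exists>v\<in>carrier R. (block_op W \<oplus>\<^bsub>E\<^esub> inv\<^bsub>E\<^esub> (block_op W)) v =
      (if Suc (2 * s) < n then L.mat_trace (W s) else \<one> \<oplus> \<one>) \<otimes> v \<and> generates_block (block_op W) s v"
proof (cases "Suc (2 * s) < n")
  case False
  have "generates_block (block_op W) s (e (2 * s))" using False unfolding generates_block_def by blast
  then show ?thesis using block_op_plus_inv[OF W s] e_closed[OF s] False by auto
next
  case True
  let ?T = "block_op W" and ?U = "block_op W \<oplus>\<^bsub>E\<^esub> inv\<^bsub>E\<^esub> (block_op W)"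
  let ?e = "e (2 * s)" and ?f = "e (Suc (2 * s))"
  note M = block_group_M2[OF W]
  obtain a b c d where m: "W s = (a, b, c, d)" by (cases "W s")
  have "(a, b, c, d) \<in> carrier L.SL2" using W m unfolding block_group_simps by metis
  then have abcd: "a \<in> K" "b \<in> K" "c \<in> K" "d \<in> K" "a \<otimes> d = \<one> \<oplus> b \<otimes> c"
    by (auto simp: L.SL2_carrier)
  have cl: "a \<in> carrier R" "b \<in> carrier R" "c \<in> carrier R" "d \<in> carrier R" using abcd K_carrier by auto
  have ec: "?e \<in> carrier R" "?f \<in> carrier R" using True by (auto intro: e_closed)
  note T = block_op_pair[of W, OF M m True]
  have TE: "?T \<in> carrier E" by (rule block_op(1)[of W, OF M])
  have UE: "?U \<in> carrier E"
    using block_op_Units[OF W] E.Units_closed E.Units_inv_closed by (intro E_closed(2)) auto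
  let ?t = "a \<oplus> d"
  have tr: "L.mat_trace (W s) = ?t" by (simp add: m)
  have Ue: "?U ?e = ?t \<otimes> ?e" "?U ?f = ?t \<otimes> ?f"
    using block_op_plus_inv[OF W s] block_op_plus_inv[OF W True] True tr by simp_all
  have shift: "T x \<oplus> (\<ominus> k) \<otimes> x \<in> S" if "subspace S" "\<And>x. x \<in> S \<Longrightarrow> T x \<in> S" "x \<in> S" "k \<in> K" for T x k S
    using that subspaceD(2,3)[OF that(1)] K_sub(5) by simp
  have "\<exists>v\<in>carrier R. ?U v = ?t \<otimes> v \<and> generates_block ?T s v"
  proof -
    consider "b \<noteq> \<zero>" | "c \<noteq> \<zero>" | "b = \<zero>" "c = \<zero>" "a \<noteq> d" | "b = \<zero>" "c = \<zero>" "a = d" by blast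
    then show ?thesis
    proof cases
      case 1
      have "generates_block ?T s ?e" unfolding generates_block_def
      proof (intro allI impI conjI; elim conjE)
        fix S assume S: "subspace S" "\<forall>x\<in>S. ?T x \<in> S" "?e \<in> S"
        show "?e \<in> S" by (rule S(3))
        have "?T ?e \<oplus> (\<ominus> a) \<otimes> ?e \<in> S" using S by (intro shift abcd) auto
        also have "?T ?e \<oplus> (\<ominus> a) \<otimes> ?e = b \<otimes> ?f"
          unfolding T(1) using cl ec a_comm[of "a \<otimes> ?e" "b \<otimes> ?f"] by (simp add: l_minus a_assoc r_neg)
        finally show "?f \<in> S" by (rule subspace_cancel[OF S(1) abcd(2) 1 ec(2)])
      qed
      then show ?thesis using Ue(1) ec by blast
    next
      case 2
      have "generates_block ?T s ?f" unfolding generates_block_def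
      proof (intro allI impI conjI; elim conjE)
        fix S assume S: "subspace S" "\<forall>x\<in>S. ?T x \<in> S" "?f \<in> S"
        show "?f \<in> S" by (rule S(3))
        have "?T ?f \<oplus> (\<ominus> d) \<otimes> ?f \<in> S" using S by (intro shift abcd) auto
        also have "?T ?f \<oplus> (\<ominus> d) \<otimes> ?f = c \<otimes> ?e"
          unfolding T(2) using cl ec by (simp add: l_minus a_assoc r_neg)
        finally show "?e \<in> S" by (rule subspace_cancel[OF S(1) abcd(3) 2 ec(1)])
      qed
      then show ?thesis using Ue(2) ec by blast
    next
      case 3
      let ?v = "?e \<oplus> ?f"
      have Uv: "?U ?v = ?t \<otimes> ?v" using endosD(3)[OF UE ec] Ue cl ec by (simp add: r_distr)
      have "generates_block ?T s ?v" unfolding generates_block_def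
      proof (intro allI impI; elim conjE)
        fix S assume S: "subspace S" "\<forall>x\<in>S. ?T x \<in> S" "?v \<in> S"
        have "?T ?v \<oplus> (\<ominus> a) \<otimes> ?v \<in> S" using S by (intro shift abcd) auto
        also have "?T ?v \<oplus> (\<ominus> a) \<otimes> ?v = (d \<oplus> \<ominus> a) \<otimes> ?f"
        proof -
          have "?T ?v = a \<otimes> ?e \<oplus> d \<otimes> ?f"
            using endosD(3)[OF TE ec] T 3(1,2) cl ec by simp
          then have "?T ?v \<oplus> (\<ominus> a) \<otimes> ?v = (a \<otimes> ?e \<oplus> \<ominus> (a \<otimes> ?e)) \<oplus> (d \<otimes> ?f \<oplus> \<ominus> (a \<otimes> ?f))"
            using cl ec by (simp add: l_minus r_distr minus_add a_ac)
          then show ?thesis using cl ec by (simp add: r_neg l_distr l_minus)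
        qed
        finally have f: "(d \<oplus> \<ominus> a) \<otimes> ?f \<in> S" .
        have "d \<oplus> \<ominus> a \<noteq> \<zero>" using eq_of_minus_zero[OF cl(4,1)] 3(3) by auto
        then have fS: "?f \<in> S"
          using subspace_cancel[OF S(1) K_sub(7)[OF abcd(4) K_sub(5)[OF abcd(1)]] _ ec(2) f] by blast
        have "?v \<oplus> \<ominus> ?f \<in> S" using subspaceD(2)[OF S(1,3) subspace_minus[OF S(1) fS]] .
        then have "?e \<in> S" using ec by (simp add: a_assoc r_neg)
        then show "?e \<in> S \<and> (Suc (2 * s) < n \<longrightarrow> ?f \<in> S)" using fS by blast
      qed
      then show ?thesis using Uv ec by blast
    next
      case 4
      have sq: "a \<otimes> a = \<one>" using abcd(5) cl 4 by simp
      have "(a \<oplus> \<ominus> \<one>) \<otimes> (a \<oplus> \<one>) = \<zero>"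
      proof -
        have "(a \<oplus> \<ominus> \<one>) \<otimes> (a \<oplus> \<one>) = (a \<otimes> a \<oplus> \<ominus> a) \<oplus> (a \<oplus> \<ominus> \<one>)"
          using cl by (simp add: l_distr r_distr l_minus)
        also have "\<dots> = (\<one> \<oplus> \<ominus> \<one>) \<oplus> (a \<oplus> \<ominus> a)" unfolding sq using cl by (simp add: a_ac)
        finally show ?thesis using cl by (simp add: r_neg)
      qed
      then have "a \<oplus> \<ominus> \<one> = \<zero> \<or> a \<oplus> \<one> = \<zero>"
        using nonzero_mult[of "a \<oplus> \<ominus> \<one>" "a \<oplus> \<one>"] cl by blast
      then have "a = \<one> \<or> a = \<ominus> \<one>"
        using eq_of_minus_zero[of a \<one>] minus_equality[of a \<one>] cl by auto
      then have "?t = \<one> \<oplus> \<one> \<or> ?t = \<ominus> (\<one> \<oplus> \<one>)" using 4(3) by (auto simp: minus_add)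
      then show ?thesis using \<tau>[OF True] tr by simp
    qed
  qed
  then show ?thesis using True tr by simp
qed

text \<open>Operators with image in the line \<open>K v\<close>. Preceded by an arbitrary endomorphism and followed by
  powers of \<open>T\<close> they have image in the translates of this line by \<open>T\<close>.\<close>

definition line_ops :: "'a \<Rightarrow> ('a \<Rightarrow> 'a) set" where
  "line_ops v = {f \<in> carrier E. \<forall>x\<in>carrier R. \<exists>k\<in>K. f x = k \<otimes> v}"

text \<open>Choose for each block \<open>s\<close> elements of the special linear group at which the trace of the word
  is different from the traces on the earlier blocks and from plus and minus two. Let \<open>T\<close> be the
  value of the word at the resulting block operators. The operator \<open>T\<close> plus its inverse has
  distinct eigenvalues on the blocks, so the sum \<open>v\<close> of cyclic vectors for the blocks is a
  cyclic vector for \<open>T\<close>: an invariant subspace containing \<open>v\<close> contains each summand, hence each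
  block. That every basis vector is a combination of the \<open>T^k v\<close> means that the identity is a
  combination of operators \<open>y \<phi> T^k\<close> with \<open>\<phi>\<close> having image in \<open>K v\<close>, which is how cyclicity is
  recorded.\<close>

lemma exists_cyclic_word:
  assumes K_infinite: "infinite K" and w: "nontrivial_word w"
  shows "\<exists>a v g. (\<forall>i. a i \<in> Units E) \<and> v \<in> carrier R \<and> ring.laurent E (line_ops v) g \<and>
     g (word_eval E a w) = \<one>\<^bsub>E\<^esub>"
proof -
  have infL: "infinite (carrier (R\<lparr>carrier := K\<rparr>))" using K_infinite by simp
  \<comment> \<open>The trace on the last block of size one is taken to be two, the value of \<open>T\<close> plus its inverse there.\<close>
  define two where "two = \<one> \<oplus> \<one>"
  have twoK: "two \<in> K" "\<ominus> two \<in> K" unfolding two_def using K_sub(3,5,7) by blast+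
  let ?t = "\<lambda>A. L.mat_trace (word_eval L.SL2 A w)"
  have tK: "?t A \<in> K" if "range A \<subseteq> carrier L.SL2" for A
    using L.mat_trace_closed[OF L.SL2_M2[OF group.word_eval_closed[OF L.SL2_group that]]] by simp
  \<comment> \<open>Intersecting with \<open>K\<close> keeps the excluded set inside the field for every candidate sequence.\<close>
  have "\<exists>A. \<forall>s::nat. range (A s) \<subseteq> carrier L.SL2 \<and> ?t (A s) \<notin> {two, \<ominus> two} \<union> (\<Union>r<s. {?t (A r)} \<inter> K)"
  proof (rule dependent_wellorder_choice)
    fix s :: nat and A :: "nat \<Rightarrow> nat \<Rightarrow> 'a mat2"
    have "finite ({two, \<ominus> two} \<union> (\<Union>r<s. {?t (A r)} \<inter> K))" by simp
    moreover have "{two, \<ominus> two} \<union> (\<Union>r<s. {?t (A r)} \<inter> K) \<subseteq> carrier (R\<lparr>carrier := K\<rparr>)"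
      using twoK by auto
    ultimately show "\<exists>r. range r \<subseteq> carrier L.SL2 \<and> ?t r \<notin> {two, \<ominus> two} \<union> (\<Union>r<s. {?t (A r)} \<inter> K)"
      by (rule L.word_trace_avoids[OF infL _ _ w])
  next
    fix r :: "nat \<Rightarrow> 'a mat2" and A B :: "nat \<Rightarrow> nat \<Rightarrow> 'a mat2" and s :: nat
    assume eq: "\<And>i. i < s \<Longrightarrow> A i = B i"
    have "(\<Union>r<s. {?t (A r)} \<inter> K) = (\<Union>r<s. {?t (B r)} \<inter> K)" using eq by simp
    then show "(range r \<subseteq> carrier L.SL2 \<and> ?t r \<notin> {two, \<ominus> two} \<union> (\<Union>r<s. {?t (A r)} \<inter> K)) =
      (range r \<subseteq> carrier L.SL2 \<and> ?t r \<notin> {two, \<ominus> two} \<union> (\<Union>r<s. {?t (B r)} \<inter> K))" by simp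
  qed
  then obtain A where A: "\<forall>s::nat. range (A s) \<subseteq> carrier L.SL2 \<and>
      ?t (A s) \<notin> {two, \<ominus> two} \<union> (\<Union>r<s. {?t (A r)} \<inter> K)" by (rule exE)
  have A1: "range (A s) \<subseteq> carrier L.SL2" for s using A by blast
  have A2: "?t (A s) \<noteq> two" "?t (A s) \<noteq> \<ominus> two" for s using A by blast+
  have A3: "?t (A s) \<noteq> ?t (A r)" if "r < s" for r s using A tK[OF A1[of r]] that by blast
  define C where "C i s = A s i" for i s
  have C: "C i \<in> carrier block_group" for i using A1 unfolding block_group_simps C_def by blast
  define W where "W = (\<lambda>s. word_eval L.SL2 (A s) w)"
  have W: "W \<in> carrier block_group"
    unfolding block_group_simps W_def using group.word_eval_closed[OF L.SL2_group A1] by blast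
  define a where "a i = block_op (C i)" for i
  have aU: "a i \<in> Units E" for i unfolding a_def by (rule block_op_Units[OF C])
  define T where "T = block_op W"
  have T_word: "word_eval E a w = T"
    unfolding a_def[abs_def] block_op_word[OF C] T_def W_def C_def ..
  have TU: "T \<in> Units E" unfolding T_def by (rule block_op_Units[OF W])
  have TE: "T \<in> carrier E" "inv\<^bsub>E\<^esub> T \<in> carrier E" using TU by auto
  define U where "U = T \<oplus>\<^bsub>E\<^esub> inv\<^bsub>E\<^esub> T"
  have UE: "U \<in> carrier E" unfolding U_def using TE by (rule E_closed(2))
  define m where "m = (n + 1) div 2"
  have m: "s < m \<longleftrightarrow> 2 * s < n" for s unfolding m_def by auto
  define \<tau> where "\<tau> s = (if Suc (2 * s) < n then L.mat_trace (W s) else two)" for s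
  have \<tau>K: "\<tau> s \<in> K" for s unfolding \<tau>_def W_def using tK[OF A1] twoK by simp
  have \<tau>ne: "\<tau> s \<noteq> \<tau> t" if "s < t" "t < m" for s t
  proof -
    have "Suc (2 * s) < n" using that m by auto
    then show ?thesis unfolding \<tau>_def W_def using A3[OF that(1)] A2(1)[of s] by auto
  qed
  have "\<forall>s. \<exists>v. s < m \<longrightarrow> v \<in> carrier R \<and> U v = \<tau> s \<otimes> v \<and> generates_block T s v"
  proof
    fix s
    show "\<exists>v. s < m \<longrightarrow> v \<in> carrier R \<and> U v = \<tau> s \<otimes> v \<and> generates_block T s v"
    proof (cases "s < m")
      case True
      then have s: "2 * s < n" using m by blast
      have "L.mat_trace (W s) \<noteq> \<one> \<oplus> \<one> \<and> L.mat_trace (W s) \<noteq> \<ominus> (\<one> \<oplus> \<one>)"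
        using A2[of s] unfolding W_def two_def by blast
      from block_eigenvector[OF W s this] show ?thesis
        unfolding \<tau>_def U_def T_def two_def by blast
    qed simp
  qed
  from choice[OF this] obtain vs where vs: "\<And>s. s < m \<Longrightarrow> vs s \<in> carrier R"
    "\<And>s. s < m \<Longrightarrow> U (vs s) = \<tau> s \<otimes> vs s" "\<And>s. s < m \<Longrightarrow> generates_block T s (vs s)" by blast
  define v where "v = (\<Oplus>s\<in>{..<m}. vs s)"
  have vc: "v \<in> carrier R" unfolding v_def using vs(1) by (intro finsum_closed) auto
  \<comment> \<open>\<open>v\<close> is a cyclic vector for \<open>T\<close> and its inverse.\<close>
  have cyclic: "e i \<in> S" if S: "subspace S" "\<And>x. x \<in> S \<Longrightarrow> T x \<in> S" "\<And>x. x \<in> S \<Longrightarrow> (inv\<^bsub>E\<^esub> T) x \<in> S" "v \<in> S"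
    and i: "i < n" for S i
  proof -
    have US: "U x \<in> S" if "x \<in> S" for x
      unfolding U_def E_apply(2)[OF subspaceD(1)[OF S(1) that]]
      using subspaceD(2)[OF S(1)] S(2,3) that by blast
    have vsS: "vs s \<in> S" if "s < m" for s
      by (rule eigenvectors_in_subspace[of S U m \<tau> vs])
        (use S(1,4) UE US \<tau>K \<tau>ne vs that in \<open>auto simp: v_def\<close>)
    have gb: "e (2 * s) \<in> S \<and> (Suc (2 * s) < n \<longrightarrow> e (Suc (2 * s)) \<in> S)" if "s < m" for s
      using vs(3)[OF that] vsS[OF that] S(1,2) unfolding generates_block_def by blast
    show ?thesis by (rule basis_cases[OF i]) (use gb m in auto)
  qed
  define \<Phi> where "\<Phi> = line_ops v"
  \<comment> \<open>The values at \<open>T\<close> of expressions, which form a left ideal that is stable under right multiplication by \<open>T\<close>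
      and its inverse.\<close>
  define J where "J = {f \<in> carrier E. \<exists>g. E.laurent \<Phi> g \<and> g T = f}"
  have J_const: "f \<in> J" if "f \<in> \<Phi>" for f
    unfolding J_def using that E.laurent.const[OF that] unfolding \<Phi>_def line_ops_def by blast
  have J_add: "f \<oplus>\<^bsub>E\<^esub> g \<in> J" if "f \<in> J" "g \<in> J" for f g
    using that E.laurent.add E_closed(2)[of f g] unfolding J_def by blast
  have J_lmult: "f \<otimes>\<^bsub>E\<^esub> g \<in> J" if "f \<in> carrier E" "g \<in> J" for f g
    using that E.laurent.lmult[of f] E_closed(1)[of f g] unfolding J_def by blast
  have J_rmult: "f \<otimes>\<^bsub>E\<^esub> T \<in> J" "f \<otimes>\<^bsub>E\<^esub> inv\<^bsub>E\<^esub> T \<in> J" if "f \<in> J" for f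
    using that E.laurent.rmult E.laurent.rmult_inv E_closed(1)[of f] TE unfolding J_def by blast+
  \<comment> \<open>\<open>\<epsilon> j x\<close> is the operator that sends \<open>e j\<close> to \<open>x\<close> and kills the other basis vectors.\<close>
  define \<epsilon> where "\<epsilon> j x = basis_map (\<lambda>i. if i = j then x else \<zero>)" for j x
  have \<epsilon>: "\<epsilon> j x \<in> carrier E" "\<And>i. i < n \<Longrightarrow> \<epsilon> j x (e i) = (if i = j then x else \<zero>)"
    if "x \<in> carrier R" for j x
    unfolding \<epsilon>_def using basis_map[of "\<lambda>i. if i = j then x else \<zero>"] that by auto
  have J_unit: "\<epsilon> j (e j) \<in> J" if j: "j < n" for j
  proof -
    \<comment> \<open>The \<open>x\<close> for which this operator is the value of an expression form an invariant subspace containing \<open>v\<close>.\<close>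
    define S where "S = {x \<in> carrier R. \<epsilon> j x \<in> J}"
    have "subspace S"
      unfolding subspace_def
    proof (intro conjI ballI)
      show "S \<subseteq> carrier R" unfolding S_def by blast
      fix x assume x: "x \<in> S"
      then have xc: "x \<in> carrier R" "\<epsilon> j x \<in> J" unfolding S_def by blast+
      show "x \<oplus> y \<in> S" if "y \<in> S" for y
      proof -
        have yc: "y \<in> carrier R" "\<epsilon> j y \<in> J" using that unfolding S_def by blast+
        have "\<epsilon> j (x \<oplus> y) = \<epsilon> j x \<oplus>\<^bsub>E\<^esub> \<epsilon> j y"
          by (rule E_eq_on_basis[OF \<epsilon>(1) E_closed(2)[OF \<epsilon>(1) \<epsilon>(1)]])
            (use xc yc e_closed in \<open>simp_all add: E_apply \<epsilon>(2)\<close>)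
        then show ?thesis unfolding S_def using xc yc J_add by simp
      qed
      show "k \<otimes> x \<in> S" if k: "k \<in> K" for k
      proof -
        note lk = lmul_closed[OF K_subfield k]
        have kx: "k \<otimes> x \<in> carrier R" using xc K_carrier[OF k] by simp
        have "\<epsilon> j (k \<otimes> x) = \<epsilon> j x \<otimes>\<^bsub>E\<^esub> lmul k"
          by (rule E_eq_on_basis[OF \<epsilon>(1)[OF kx] E_closed(1)[OF \<epsilon>(1)[OF xc(1)] lk]])
            (use xc kx K_carrier[OF k] e_closed in \<open>simp_all add: E_apply \<epsilon>(2)\<close>)
        also have "\<dots> = lmul k \<otimes>\<^bsub>E\<^esub> \<epsilon> j x" using E.central[of "lmul k"] k \<epsilon>(1)[OF xc(1)] by simp
        finally show ?thesis unfolding S_def using J_lmult[OF lk xc(2)] kx by simp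
      qed
    qed
    moreover have T_S: "f x \<in> S" if "x \<in> S" "f \<in> carrier E" "\<And>h. h \<in> J \<Longrightarrow> h \<otimes>\<^bsub>E\<^esub> f \<in> J" for f x
    proof -
      have xc: "x \<in> carrier R" "\<epsilon> j x \<in> J" using that unfolding S_def by blast+
      note fx = endosD(2)[OF that(2) xc(1)]
      have "\<epsilon> j (f x) = \<epsilon> j x \<otimes>\<^bsub>E\<^esub> f"
        by (rule E_eq_on_basis[OF \<epsilon>(1)[OF fx] E_closed(1)[OF \<epsilon>(1)[OF xc(1)] that(2)]])
          (use xc fx e_closed endos_zero[OF that(2)] in \<open>simp_all add: E_apply \<epsilon>(2)\<close>)
      then show ?thesis unfolding S_def using that(3)[OF xc(2)] fx by simp
    qed
    moreover have "v \<in> S"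
    proof -
      have "\<epsilon> j v x \<in> {k \<otimes> v | k. k \<in> K}" if x: "x \<in> carrier R" for x
      proof -
        obtain u where u: "\<forall>i\<in>{..<n}. u i \<in> K" "x = (\<Oplus>i\<in>{..<n}. u i \<otimes> e i)"
          using e_span x unfolding left_spanning_def by blast
        have uc: "u i \<in> carrier R" if "i < n" for i using u(1) K_carrier that by blast
        have "\<epsilon> j v x = (\<Oplus>i\<in>{..<n}. u i \<otimes> \<epsilon> j v (e i))"
          unfolding u(2) using endos_lincomb[OF \<epsilon>(1)[OF vc], of "{..<n}" u e] u(1) uc e_closed by simp
        also have "\<dots> = (\<Oplus>i\<in>{..<n}. if j = i then u i \<otimes> v else \<zero>)"
          using uc vc by (intro finsum_cong') (auto simp: \<epsilon>(2)[OF vc])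
        also have "\<dots> = u j \<otimes> v" using j uc vc by (intro finsum_singleton) auto
        finally show ?thesis using u(1) j by blast
      qed
      then have "\<epsilon> j v \<in> \<Phi>" unfolding \<Phi>_def line_ops_def using \<epsilon>(1)[OF vc] by blast
      then show ?thesis unfolding S_def using J_const vc by blast
    qed
    ultimately have "e j \<in> S" using cyclic[of S j] j TE J_rmult by blast
    then show ?thesis unfolding S_def by blast
  qed
  have J_sum: "(\<Oplus>\<^bsub>E\<^esub>j\<in>{..<k}. \<epsilon> j (e j)) \<in> J" if "k \<le> n" for k
    using that
  proof (induction k)
    case 0
    have "\<zero>\<^bsub>E\<^esub> \<in> \<Phi>" unfolding \<Phi>_def line_ops_def
      using E_closed(4) K_sub(2) vc by (auto simp: E_apply intro!: bexI[of _ \<zero>])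
    then show ?case using J_const by simp
  next
    case (Suc k)
    have "(\<Oplus>\<^bsub>E\<^esub>j\<in>{..<Suc k}. \<epsilon> j (e j)) = \<epsilon> k (e k) \<oplus>\<^bsub>E\<^esub> (\<Oplus>\<^bsub>E\<^esub>j\<in>{..<k}. \<epsilon> j (e j))"
      unfolding lessThan_Suc using Suc.prems \<epsilon>(1) e_closed by (intro E.finsum_insert) auto
    then show ?case using J_add[OF J_unit[of k]] Suc by simp
  qed
  have "(\<Oplus>\<^bsub>E\<^esub>j\<in>{..<n}. \<epsilon> j (e j)) = \<one>\<^bsub>E\<^esub>"
  proof (rule E_eq_on_basis)
    have c: "\<epsilon> j (e j) \<in> carrier E" if "j \<in> {..<n}" for j using \<epsilon>(1) e_closed that by simp
    show "(\<Oplus>\<^bsub>E\<^esub>j\<in>{..<n}. \<epsilon> j (e j)) \<in> carrier E" using c by (intro E.finsum_closed) auto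
    show "\<one>\<^bsub>E\<^esub> \<in> carrier E" by (rule E_closed(3))
    fix i assume i: "i < n"
    have "(\<Oplus>\<^bsub>E\<^esub>j\<in>{..<n}. \<epsilon> j (e j)) (e i) = (\<Oplus>j\<in>{..<n}. \<epsilon> j (e j) (e i))"
      using endos_finsum_apply[OF K_sub(1), of "{..<n}" "\<lambda>j. \<epsilon> j (e j)" "e i"] c e_closed[OF i] by simp
    also have "\<dots> = (\<Oplus>j\<in>{..<n}. if i = j then e j else \<zero>)"
      using i e_closed by (intro finsum_cong') (auto simp: \<epsilon>(2))
    also have "\<dots> = e i" using i e_closed by (intro finsum_singleton) auto
    finally show "(\<Oplus>\<^bsub>E\<^esub>j\<in>{..<n}. \<epsilon> j (e j)) (e i) = \<one>\<^bsub>E\<^esub> (e i)"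
      using e_closed[OF i] by (simp add: E_apply)
  qed
  then have "\<one>\<^bsub>E\<^esub> \<in> J" using J_sum[of n] by simp
  then obtain g where "E.laurent \<Phi> g" "g T = \<one>\<^bsub>E\<^esub>" unfolding J_def by blast
  then show ?thesis using aU vc T_word unfolding \<Phi>_def by blast
qed

text \<open>At \<open>T = rmul a\<close> the powers of \<open>T\<close> multiply the line \<open>K v\<close> on the right by powers of \<open>a\<close>, which
  lie in \<open>H\<close>.\<close>

lemma laurent_rmul_image:
  assumes g: "E.laurent (line_ops v) g" and v: "v \<in> carrier R"
    and H: "subfield H R" "a \<in> H" "a \<noteq> \<zero>" and x: "x \<in> carrier R"
  shows "g (rmul a) x \<in> bispan K v H"
proof -
  note HE = subringE[OF subfieldE(1)[OF H(1)]]
  note cl = bispan_closed[OF K_sub(1) v HE(1)]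
  have ac: "a \<in> carrier R" using HE(1) H(2) by blast
  have iH: "inv a \<in> H" using subfield_m_inv[OF H(1), of a] H by simp
  have rU: "inv\<^bsub>E\<^esub> (rmul a) = rmul (inv a)"
  proof -
    note i = inv_nonzero[OF ac H(3)]
    have "rmul a \<otimes>\<^bsub>E\<^esub> rmul (inv a) = \<one>\<^bsub>E\<^esub>" "rmul (inv a) \<otimes>\<^bsub>E\<^esub> rmul a = \<one>\<^bsub>E\<^esub>"
      using ring_hom_mult[OF rmul_hom[OF K_sub(1)] ac i(1)] ring_hom_mult[OF rmul_hom[OF K_sub(1)] i(1) ac]
        i ring_hom_one[OF rmul_hom[OF K_sub(1)]] by simp_all
    then show ?thesis
      using E.inv_unique'[OF rmul_closed[OF K_sub(1) ac] rmul_closed[OF K_sub(1) i(1)]] by simp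
  qed
  have rm: "y \<otimes> h \<in> bispan K v H" if "y \<in> bispan K v H" "h \<in> H" for y h
    using that(1)
  proof (induction rule: bispan.induct)
    case zero
    then show ?case using HE(1) that(2) bispan.zero by auto
  next
    case (step y k h')
    have c: "y \<in> carrier R" "k \<in> carrier R" "h' \<in> carrier R" "h \<in> carrier R"
      using cl step K_carrier HE(1) that(2) by auto
    have "(y \<oplus> k \<otimes> v \<otimes> h') \<otimes> h = y \<otimes> h \<oplus> k \<otimes> v \<otimes> (h' \<otimes> h)"
      using c v by (simp add: l_distr m_assoc)
    then show ?case using bispan.step[OF step.IH step.hyps(2) HE(6)[OF step.hyps(3) that(2)]] by simp
  qed
  have r: "rmul a \<in> carrier E" "inv\<^bsub>E\<^esub> (rmul a) \<in> carrier E"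
    unfolding rU using rmul_closed[OF K_sub(1)] ac iH HE(1) by auto
  have gc: "g (rmul a) \<in> carrier E \<and> (\<forall>x\<in>carrier R. g (rmul a) x \<in> bispan K v H)"
    using g
  proof (induction rule: E.laurent.induct)
    case (const \<phi>)
    then have \<phi>: "\<phi> \<in> carrier E" "\<And>x. x \<in> carrier R \<Longrightarrow> \<exists>k\<in>K. \<phi> x = k \<otimes> v"
      unfolding line_ops_def by blast+
    have "\<phi> x \<in> bispan K v H" if x: "x \<in> carrier R" for x
    proof -
      obtain k where k: "k \<in> K" "\<phi> x = k \<otimes> v" using \<phi>(2)[OF x] by blast
      have "\<zero> \<oplus> k \<otimes> v \<otimes> \<one> \<in> bispan K v H" by (rule bispan.step[OF bispan.zero k(1) HE(3)])
      then show ?thesis using k K_carrier v by simp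
    qed
    then show ?case using \<phi>(1) by blast
  next
    case (add f g)
    then show ?case using E_closed(2) bispan_add[OF K_sub(1) v HE(1)] by (simp add: E_apply)
  next
    case (lmult y f)
    then show ?case using E_closed(1) endosD(2)[OF lmult(1)] by (simp add: E_apply)
  next
    case (rmult f)
    then show ?case using E_closed(1)[OF _ r(1)] rm[OF _ H(2)] endosD(2) cl by (simp add: E_apply)
  next
    case (rmult_inv f)
    then show ?case using E_closed(1)[OF _ r(2)] rm[OF _ iH] endosD(2) cl unfolding rU by (simp add: E_apply)
  qed
  then show ?thesis using x by blast
qed

section \<open>Infinite centers\<close>

text \<open>The operators with a cyclic word from \<open>exists_cyclic_word\<close> are combinations of the right
  multiplications \<open>rmul (d j)\<close> with coefficients in \<open>K\<close>. By \<open>laurent_word_transfer\<close> the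
  coefficients can be moved into the infinite center while the expression \<open>g\<close> remains a unit;
  the operators then are right multiplications by elements \<open>c i\<close> of the division ring, and their
  word is the right multiplication by \<open>x = w(c)\<close>. A unit is surjective, so the image of
  \<open>g (rmul x)\<close>, which lies in \<open>K v F(x)\<close>, is everything, and \<open>maximal_subfield_if_bispan\<close>
  applies.\<close>

lemma word_generates_maximal_subfield:
  assumes F: "infinite (ring_center R)"
    and d: "\<And>i. i < (N::nat) \<Longrightarrow> d i \<in> carrier R" "left_spanning {..<N} d (ring_center R)"
    and w: "nontrivial_word w"
  shows "\<exists>c. (\<forall>i. c i \<in> carrier R - {\<zero>}) \<and>
    maximal_subfield (generate_field R (insert (word_eval R c w) (ring_center R))) R"
proof -
  let ?F = "ring_center R"
  have FK: "?F \<subseteq> K" using centralizer_anti[OF K_sub(1)] unfolding K center_eq_centralizer .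
  have Fc: "z \<in> carrier R" "\<And>x. x \<in> carrier R \<Longrightarrow> x \<otimes> z = z \<otimes> x" if "z \<in> ?F" for z
    using that unfolding ring_center_def by simp_all
  obtain a v g where a: "\<And>i. a i \<in> Units E" and v: "v \<in> carrier R"
    and g: "E.laurent (line_ops v) g" "g (word_eval E a w) = \<one>\<^bsub>E\<^esub>"
    using exists_cyclic_word[OF infinite_super[OF FK F] w] by blast
  define I where "I = fst ` set w"
  have ga: "g (word_eval E (\<lambda>i. if i \<in> I then a i else \<one>\<^bsub>E\<^esub>) w) \<in> Units E"
  proof -
    have "word_eval E (\<lambda>i. if i \<in> I then a i else \<one>\<^bsub>E\<^esub>) w = word_eval E a w"
      by (rule word_eval_letters_cong) (simp add: I_def)
    then show ?thesis using g(2) by simp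
  qed
  have sp: "\<exists>u. (\<forall>i<N. u i \<in> lmul ` K) \<and> f = (\<Oplus>\<^bsub>E\<^esub>i\<in>{..<N}. u i \<otimes>\<^bsub>E\<^esub> rmul (d i))"
    if f: "f \<in> carrier E" for f
    using endos_span_rmul[where J = "{..<n}" and e = e and N = N and d = d, OF K] e_closed e_span e_ind d f by simp
  have "inj_on lmul ?F" using lmul_inj Fc(1) by (auto intro: inj_onI)
  then have infF: "infinite (lmul ` ?F)" using F finite_imageD by blast
  have "\<exists>z. (\<forall>i\<in>I. \<forall>j<N. z i j \<in> lmul ` ?F) \<and>
     (\<forall>i\<in>I. (\<Oplus>\<^bsub>E\<^esub>j\<in>{..<N}. z i j \<otimes>\<^bsub>E\<^esub> rmul (d j)) \<in> Units E) \<and>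
     g (word_eval E (\<lambda>i. if i \<in> I then (\<Oplus>\<^bsub>E\<^esub>j\<in>{..<N}. z i j \<otimes>\<^bsub>E\<^esub> rmul (d j)) else \<one>\<^bsub>E\<^esub>) w) \<in> Units E"
    by (rule E.laurent_word_transfer[OF rmul_closed[OF K_sub(1) d(1)] sp _ infF _ g(1) _ a ga])
      (use FK in \<open>auto simp: line_ops_def I_def\<close>)
  then obtain z where z: "\<forall>i\<in>I. \<forall>j<N. z i j \<in> lmul ` ?F"
     "\<forall>i\<in>I. (\<Oplus>\<^bsub>E\<^esub>j\<in>{..<N}. z i j \<otimes>\<^bsub>E\<^esub> rmul (d j)) \<in> Units E"
     "g (word_eval E (\<lambda>i. if i \<in> I then (\<Oplus>\<^bsub>E\<^esub>j\<in>{..<N}. z i j \<otimes>\<^bsub>E\<^esub> rmul (d j)) else \<one>\<^bsub>E\<^esub>) w) \<in> Units E"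
    by (elim exE conjE)
  have "\<forall>i. \<exists>\<zeta>. i \<in> I \<longrightarrow> (\<forall>j<N. \<zeta> j \<in> ?F \<and> z i j = lmul (\<zeta> j))"
  proof
    fix i
    have "\<forall>j. \<exists>k. i \<in> I \<longrightarrow> j < N \<longrightarrow> k \<in> ?F \<and> z i j = lmul k" using z(1) by blast
    from choice[OF this] show "\<exists>\<zeta>. i \<in> I \<longrightarrow> (\<forall>j<N. \<zeta> j \<in> ?F \<and> z i j = lmul (\<zeta> j))" by blast
  qed
  from choice[OF this] obtain \<zeta> where \<zeta>: "\<And>i j. i \<in> I \<Longrightarrow> j < N \<Longrightarrow> \<zeta> i j \<in> ?F"
    "\<And>i j. i \<in> I \<Longrightarrow> j < N \<Longrightarrow> z i j = lmul (\<zeta> i j)" by blast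
  define c where "c i = (if i \<in> I then (\<Oplus>j\<in>{..<N}. \<zeta> i j \<otimes> d j) else \<one>)" for i
  have cc: "c i \<in> carrier R" for i
    unfolding c_def using \<zeta>(1) Fc(1) d(1) by (auto intro!: finsum_closed)
  have rc: "rmul (c i) = (if i \<in> I then (\<Oplus>\<^bsub>E\<^esub>j\<in>{..<N}. z i j \<otimes>\<^bsub>E\<^esub> rmul (d j)) else \<one>\<^bsub>E\<^esub>)" for i
  proof (cases "i \<in> I")
    case True
    note lc = lmul_closed[OF K_subfield] and rc = rmul_closed[OF K_sub(1) d(1)]
    have mc: "z i j \<otimes>\<^bsub>E\<^esub> rmul (d j) \<in> carrier E" if "j \<in> {..<N}" for j
      using that \<zeta>[OF True, of j] FK lc rc by (auto intro!: E_closed(1))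
    have "rmul (c i) = (\<Oplus>\<^bsub>E\<^esub>j\<in>{..<N}. z i j \<otimes>\<^bsub>E\<^esub> rmul (d j))"
    proof (rule endos_eqI[OF rmul_closed[OF K_sub(1) cc]])
      show "(\<Oplus>\<^bsub>E\<^esub>j\<in>{..<N}. z i j \<otimes>\<^bsub>E\<^esub> rmul (d j)) \<in> carrier E"
        using mc by (intro E.finsum_closed) auto
      fix x assume x: "x \<in> carrier R"
      have "(\<Oplus>\<^bsub>E\<^esub>j\<in>{..<N}. z i j \<otimes>\<^bsub>E\<^esub> rmul (d j)) x = (\<Oplus>j\<in>{..<N}. (z i j \<otimes>\<^bsub>E\<^esub> rmul (d j)) x)"
        using endos_finsum_apply[OF K_sub(1), of "{..<N}" "\<lambda>j. z i j \<otimes>\<^bsub>E\<^esub> rmul (d j)" x] mc x by simp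
      also have "\<dots> = (\<Oplus>j\<in>{..<N}. x \<otimes> (\<zeta> i j \<otimes> d j))"
      proof (rule finsum_cong')
        fix j assume j: "j \<in> {..<N}"
        have zc: "\<zeta> i j \<in> carrier R" "d j \<in> carrier R" using j \<zeta>(1)[OF True] Fc(1) d(1) by auto
        have "x \<otimes> (\<zeta> i j \<otimes> d j) = (x \<otimes> \<zeta> i j) \<otimes> d j" using zc x by (simp add: m_assoc)
        also have "x \<otimes> \<zeta> i j = \<zeta> i j \<otimes> x" using Fc(2)[OF \<zeta>(1)[OF True] x] j by simp
        finally have e: "x \<otimes> (\<zeta> i j \<otimes> d j) = \<zeta> i j \<otimes> x \<otimes> d j" .
        have "(z i j \<otimes>\<^bsub>E\<^esub> rmul (d j)) x = \<zeta> i j \<otimes> x \<otimes> d j"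
          using \<zeta>(2)[OF True] j zc x by (simp add: E_apply)
        then show "(z i j \<otimes>\<^bsub>E\<^esub> rmul (d j)) x = x \<otimes> (\<zeta> i j \<otimes> d j)" unfolding e .
      qed (use \<zeta>(1)[OF True] Fc(1) d(1) x in auto)
      also have "\<dots> = x \<otimes> c i"
        unfolding c_def using True \<zeta>(1)[OF True] Fc(1) d(1) x by (simp add: finsum_rdistr Pi_def)
      finally show "rmul (c i) x = (\<Oplus>\<^bsub>E\<^esub>j\<in>{..<N}. z i j \<otimes>\<^bsub>E\<^esub> rmul (d j)) x" using x by simp
    qed
    then show ?thesis using True by simp
  next
    case False
    then show ?thesis unfolding c_def using ring_hom_one[OF rmul_hom[OF K_sub(1)]] by simp
  qed
  have rU: "rmul (c i) \<in> Units E" for i using z(2) unfolding rc by simp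
  have c0: "c i \<noteq> \<zero>" for i
  proof
    assume c0: "c i = \<zero>"
    have 1: "(rmul \<zero> \<otimes>\<^bsub>E\<^esub> inv\<^bsub>E\<^esub> (rmul \<zero>)) \<one> = \<one>"
      using E.Units_r_inv[OF rU[of i]] unfolding c0 by (simp add: E_apply)
    have "inv\<^bsub>E\<^esub> (rmul \<zero>) \<in> carrier E" using E.Units_inv_closed[OF rU[of i]] unfolding c0 .
    then have "(rmul \<zero> \<otimes>\<^bsub>E\<^esub> inv\<^bsub>E\<^esub> (rmul \<zero>)) \<one> = \<zero>"
      using endos_zero by (simp add: E_apply)
    then show False using 1 by simp
  qed
  have cU: "c i \<in> Units R" for i using cc c0 nonzero_Units by simp
  have rcU: "range c \<subseteq> Units R" using cU by blast
  define x where "x = word_eval R c w"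
  have xU: "x \<in> Units R"
    using group.word_eval_closed[OF units_group, of c w] rcU
    unfolding x_def by (simp add: units_of_carrier word_eval_units_of)
  have x: "x \<in> carrier R" "x \<noteq> \<zero>" using xU nonzero_Units by simp_all
  have rx: "word_eval E (\<lambda>i. rmul (c i)) w = rmul x"
  proof -
    have h: "rmul \<in> hom (units_of R) (units_of E)"
    proof (rule homI)
      note rh = rmul_hom[OF K_sub(1)]
      show "rmul y \<in> carrier (units_of E)" if "y \<in> carrier (units_of R)" for y
      proof -
        have yU: "y \<in> Units R" using that by (simp add: units_of_carrier)
        note i = Units_inv_closed[OF yU] and yc = Units_closed[OF yU]
        have "rmul y \<otimes>\<^bsub>E\<^esub> rmul (inv y) = \<one>\<^bsub>E\<^esub>" "rmul (inv y) \<otimes>\<^bsub>E\<^esub> rmul y = \<one>\<^bsub>E\<^esub>"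
          using ring_hom_mult[OF rh yc i] ring_hom_mult[OF rh i yc] yU ring_hom_one[OF rh] by simp_all
        then show ?thesis
          using rmul_closed[OF K_sub(1) yc] rmul_closed[OF K_sub(1) i]
          unfolding units_of_carrier Units_def by blast
      qed
      show "rmul (y \<otimes>\<^bsub>units_of R\<^esub> y') = rmul y \<otimes>\<^bsub>units_of E\<^esub> rmul y'"
        if "y \<in> carrier (units_of R)" "y' \<in> carrier (units_of R)" for y y'
        using that ring_hom_mult[OF rh] by (simp add: units_of_carrier units_of_mult Units_closed)
    qed
    have "word_eval E (\<lambda>i. rmul (c i)) w = word_eval (units_of E) (\<lambda>i. rmul (c i)) w"
      using rU by (intro E.word_eval_units_of[symmetric]) blast
    also have "\<dots> = rmul (word_eval (units_of R) c w)"
      using rcU by (intro hom_word_eval[symmetric, OF units_group E.units_group h])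
        (simp add: units_of_carrier)
    also have "\<dots> = rmul x" unfolding x_def word_eval_units_of[OF rcU] ..
    finally show ?thesis .
  qed
  have gU: "g (rmul x) \<in> Units E"
  proof -
    have "(\<lambda>i. rmul (c i)) = (\<lambda>i. if i \<in> I then (\<Oplus>\<^bsub>E\<^esub>j\<in>{..<N}. z i j \<otimes>\<^bsub>E\<^esub> rmul (d j)) else \<one>\<^bsub>E\<^esub>)"
      using rc by blast
    then show ?thesis using z(3) rx by simp
  qed
  let ?S = "insert x ?F"
  have S: "?S \<subseteq> carrier R" using x(1) Fc(1) by blast
  have Scomm: "p \<otimes> q = q \<otimes> p" if "p \<in> ?S" "q \<in> ?S" for p q
  proof (cases "p \<in> ?F")
    case True then show ?thesis using Fc(2)[of p q] that(2) S by auto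
  next
    case False
    then have p: "p = x" using that(1) by blast
    show ?thesis
    proof (cases "q \<in> ?F")
      case True then show ?thesis using Fc(2)[of q p] that(1) S by auto
    next
      case False then show ?thesis using p that(2) by blast
    qed
  qed
  let ?H = "generate_field R ?S"
  have Hf: "subfield ?H R" by (rule generate_field_subfield[OF S Scomm])
  have xH: "x \<in> ?H" by (rule generate_field.incl) simp
  have "y \<in> bispan K v ?H" if y: "y \<in> carrier R" for y
  proof -
    let ?i = "inv\<^bsub>E\<^esub> (g (rmul x))"
    have ic: "?i y \<in> carrier R" using endosD(2)[OF E.Units_inv_closed[OF gU] y] .
    have "g (rmul x) (?i y) = (?i \<otimes>\<^bsub>E\<^esub> g (rmul x)) y" using y by (simp add: E_apply)
    also have "\<dots> = y" using E.Units_l_inv[OF gU] y by (simp add: E_apply)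
    finally show ?thesis using laurent_rmul_image[OF g(1) v Hf xH x(2) ic] by simp
  qed
  then have "maximal_subfield ?H R"
    by (intro maximal_subfield_if_bispan[OF K S _ Scomm v]) auto
  then show ?thesis using cc c0 unfolding x_def by blast
qed

end

section \<open>Finite division rings\<close>

context skew_field
begin

lemma card_carrier_basis:
  assumes K: "subfield K R" and e: "\<And>i. i < (n::nat) \<Longrightarrow> e i \<in> carrier R"
    "left_spanning {..<n} e K" "left_independent {..<n} e K"
  shows "card (carrier R) = card K ^ n"
proof -
  have Kc: "k \<in> carrier R" if "k \<in> K" for k using subfieldE(3)[OF K] that by blast
  note KE = subringE[OF subfieldE(1)[OF K]]
  let ?f = "\<lambda>u. \<Oplus>i\<in>{..<n}. u i \<otimes> e i"
  have "bij_betw ?f ({..<n} \<rightarrow>\<^sub>E K) (carrier R)"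
    unfolding bij_betw_def
  proof
    show "inj_on ?f ({..<n} \<rightarrow>\<^sub>E K)"
    proof (rule inj_onI)
      fix u v assume u: "u \<in> {..<n} \<rightarrow>\<^sub>E K" and v: "v \<in> {..<n} \<rightarrow>\<^sub>E K" and eq: "?f u = ?f v"
      have uv: "u i \<in> K" "v i \<in> K" if "i < n" for i using u v that by auto
      have c: "u i \<in> carrier R" "v i \<in> carrier R" if "i < n" for i using uv[OF that] Kc by blast+
      have "(\<Oplus>i\<in>{..<n}. (u i \<oplus> \<ominus> v i) \<otimes> e i) = (\<Oplus>i\<in>{..<n}. u i \<otimes> e i \<oplus> (\<ominus> \<one>) \<otimes> (v i \<otimes> e i))"
        using c e(1) by (intro finsum_cong') (auto simp: l_distr l_minus)
      also have "\<dots> = ?f u \<oplus> (\<Oplus>i\<in>{..<n}. (\<ominus> \<one>) \<otimes> (v i \<otimes> e i))"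
        using c e(1) by (intro finsum_addf) auto
      also have "(\<Oplus>i\<in>{..<n}. (\<ominus> \<one>) \<otimes> (v i \<otimes> e i)) = (\<ominus> \<one>) \<otimes> ?f v"
        using c e(1) by (intro finsum_rdistr[symmetric]) auto
      also have "?f u \<oplus> (\<ominus> \<one>) \<otimes> ?f v = \<zero>"
      proof -
        have "?f v \<in> carrier R" using c e(1) by (intro finsum_closed) auto
        then show ?thesis unfolding eq by (simp add: l_minus r_neg)
      qed
      finally have z: "(\<Oplus>i\<in>{..<n}. (u i \<oplus> \<ominus> v i) \<otimes> e i) = \<zero>" .
      have "u i = v i" if i: "i < n" for i
      proof (rule eq_of_minus_zero[OF c[OF i]])
        show "u i \<oplus> \<ominus> v i = \<zero>"
          by (rule left_independentD[OF e(3), of "\<lambda>i. u i \<oplus> \<ominus> v i"]) (use z uv KE(5,7) i in auto)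
      qed
      then show "u = v" using u v by (intro PiE_ext) auto
    qed
    show "?f ` ({..<n} \<rightarrow>\<^sub>E K) = carrier R"
    proof
      show "?f ` ({..<n} \<rightarrow>\<^sub>E K) \<subseteq> carrier R" using Kc e(1) by (auto intro!: finsum_closed)
      show "carrier R \<subseteq> ?f ` ({..<n} \<rightarrow>\<^sub>E K)"
      proof
        fix x assume "x \<in> carrier R"
        then obtain u where u: "\<forall>i\<in>{..<n}. u i \<in> K" "x = ?f u"
          using e(2) unfolding left_spanning_def by blast
        have "x = ?f (restrict u {..<n})"
          unfolding u(2) using u(1) Kc e(1) by (intro finsum_cong') auto
        then show "x \<in> ?f ` ({..<n} \<rightarrow>\<^sub>E K)" using u(1) by (intro image_eqI[of _ _ "restrict u {..<n}"]) auto
      qed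
    qed
  qed
  then show ?thesis using bij_betw_same_card card_PiE[of "{..<n}" "\<lambda>_. K"] by fastforce
qed

end

text \<open>Both sides count the endomorphisms: on the right by their values on the basis over \<open>K\<close>, on the
  left by their coordinates with respect to the right multiplications by a basis over the
  center, which are unique by \<open>annihilator_zero\<close>.\<close>

lemma (in splitting) card_endos:
  assumes d: "\<And>i. i < (m::nat) \<Longrightarrow> d i \<in> carrier R" "left_spanning {..<m} d (ring_center R)"
    "left_independent {..<m} d (ring_center R)"
  shows "card K ^ m = card (carrier R) ^ n"
proof -
  have 1: "card (carrier E) = card (carrier R) ^ n"
  proof -
    let ?f = "\<lambda>f. \<lambda>i\<in>{..<n}. f (e i)"
    have "bij_betw ?f (carrier E) ({..<n} \<rightarrow>\<^sub>E carrier R)"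
      unfolding bij_betw_def
    proof
      show "inj_on ?f (carrier E)"
      proof (rule inj_onI)
        fix f g assume fg: "f \<in> carrier E" "g \<in> carrier E" "?f f = ?f g"
        have "f (e i) = g (e i)" if "i < n" for i using fun_cong[OF fg(3), of i] that by simp
        then show "f = g" by (rule E_eq_on_basis[OF fg(1,2)])
      qed
      show "?f ` carrier E = {..<n} \<rightarrow>\<^sub>E carrier R"
      proof
        show "?f ` carrier E \<subseteq> {..<n} \<rightarrow>\<^sub>E carrier R"
          using endosD(2) e_closed by (intro image_subsetI) (simp add: restrict_PiE_iff)
        show "{..<n} \<rightarrow>\<^sub>E carrier R \<subseteq> ?f ` carrier E"
        proof
          fix y assume y: "y \<in> {..<n} \<rightarrow>\<^sub>E carrier R"
          then have yc: "y i \<in> carrier R" if "i < n" for i using that by auto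
          have "y = ?f (basis_map y)"
            using y basis_map(2)[of y] yc by (intro PiE_ext[OF y]) auto
          then show "y \<in> ?f ` carrier E" using basis_map(1)[of y] yc by blast
        qed
      qed
    qed
    then show ?thesis using bij_betw_same_card card_PiE[of "{..<n}" "\<lambda>_. carrier R"] by fastforce
  qed
  have 2: "card (carrier E) = card K ^ m"
  proof -
    let ?f = "\<lambda>\<kappa>. \<Oplus>\<^bsub>E\<^esub>i\<in>{..<m}. lmul (\<kappa> i) \<otimes>\<^bsub>E\<^esub> rmul (d i)"
    note lc = lmul_closed[OF K_subfield] and rc = rmul_closed[OF K_sub(1) d(1)]
    have mc: "lmul k \<otimes>\<^bsub>E\<^esub> rmul (d i) \<in> carrier E" if "k \<in> K" "i < m" for k i
      using E_closed(1)[OF lc[OF that(1)] rc[OF that(2)]] .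
    have ap: "?f \<kappa> x = (\<Oplus>i\<in>{..<m}. \<kappa> i \<otimes> x \<otimes> d i)" if \<kappa>: "\<And>i. i < m \<Longrightarrow> \<kappa> i \<in> K" and x: "x \<in> carrier R" for \<kappa> x
    proof -
      have "?f \<kappa> x = (\<Oplus>i\<in>{..<m}. (lmul (\<kappa> i) \<otimes>\<^bsub>E\<^esub> rmul (d i)) x)"
        using endos_finsum_apply[OF K_sub(1), of "{..<m}" "\<lambda>i. lmul (\<kappa> i) \<otimes>\<^bsub>E\<^esub> rmul (d i)" x] mc \<kappa> x by simp
      also have "\<dots> = (\<Oplus>i\<in>{..<m}. \<kappa> i \<otimes> x \<otimes> d i)"
        using \<kappa> K_carrier x d(1) by (intro finsum_cong') (auto simp: E_apply)
      finally show ?thesis .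
    qed
    have "bij_betw ?f ({..<m} \<rightarrow>\<^sub>E K) (carrier E)"
      unfolding bij_betw_def
    proof
      show "inj_on ?f ({..<m} \<rightarrow>\<^sub>E K)"
      proof (rule inj_onI)
        fix u v assume u: "u \<in> {..<m} \<rightarrow>\<^sub>E K" and v: "v \<in> {..<m} \<rightarrow>\<^sub>E K" and eq: "?f u = ?f v"
        have uv: "u i \<in> K" "v i \<in> K" if "i < m" for i using u v that by auto
        have c: "u i \<in> carrier R" "v i \<in> carrier R" if "i < m" for i using uv[OF that] K_carrier by blast+
        have ann: "(\<Oplus>i\<in>{..<m}. (u i \<oplus> \<ominus> v i) \<otimes> (x \<otimes> d i)) = \<zero>" if x: "x \<in> carrier R" for x
        proof -
          let ?s = "\<lambda>u. \<Oplus>i\<in>{..<m}. u i \<otimes> x \<otimes> d i"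
          have "(\<Oplus>i\<in>{..<m}. (u i \<oplus> \<ominus> v i) \<otimes> (x \<otimes> d i)) =
            (\<Oplus>i\<in>{..<m}. u i \<otimes> x \<otimes> d i \<oplus> (\<ominus> \<one>) \<otimes> (v i \<otimes> x \<otimes> d i))"
            using c d(1) x by (intro finsum_cong') (auto simp: l_distr l_minus m_assoc)
          also have "\<dots> = ?s u \<oplus> (\<Oplus>i\<in>{..<m}. (\<ominus> \<one>) \<otimes> (v i \<otimes> x \<otimes> d i))"
            using c d(1) x by (intro finsum_addf) auto
          also have "(\<Oplus>i\<in>{..<m}. (\<ominus> \<one>) \<otimes> (v i \<otimes> x \<otimes> d i)) = (\<ominus> \<one>) \<otimes> ?s v"
            using c d(1) x by (intro finsum_rdistr[symmetric]) auto
          also have "?s u = ?s v" using fun_cong[OF eq, of x] ap[of u x] ap[of v x] uv x by simp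
          finally have e: "(\<Oplus>i\<in>{..<m}. (u i \<oplus> \<ominus> v i) \<otimes> (x \<otimes> d i)) = ?s v \<oplus> (\<ominus> \<one>) \<otimes> ?s v" .
          have "?s v \<in> carrier R" using c d(1) x by (intro finsum_closed) auto
          then show ?thesis unfolding e by (simp add: l_minus r_neg)
        qed
        have "u i = v i" if i: "i < m" for i
        proof (rule eq_of_minus_zero[OF c[OF i]])
          show "u i \<oplus> \<ominus> v i = \<zero>"
            by (rule annihilator_zero[where B = "carrier R" and I = "{..<m}" and e = d and u = "\<lambda>i. u i \<oplus> \<ominus> v i"])
              (use carrier_is_subring d(1) d(3) c ann i in \<open>auto simp: center_eq_centralizer\<close>)
        qed
        then show "u = v" using u v by (intro PiE_ext) auto
      qed
      show "?f ` ({..<m} \<rightarrow>\<^sub>E K) = carrier E"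
      proof
        show "?f ` ({..<m} \<rightarrow>\<^sub>E K) \<subseteq> carrier E" using mc by (auto intro!: E.finsum_closed)
        show "carrier E \<subseteq> ?f ` ({..<m} \<rightarrow>\<^sub>E K)"
        proof
          fix f assume f: "f \<in> carrier E"
          obtain z where z: "\<forall>i<m. z i \<in> lmul ` K" "f = (\<Oplus>\<^bsub>E\<^esub>i\<in>{..<m}. z i \<otimes>\<^bsub>E\<^esub> rmul (d i))"
            using endos_span_rmul[where J = "{..<n}" and e = e and N = m and d = d, OF K]
              e_closed e_span e_ind d(1,2) f by auto
          have "\<forall>i. \<exists>k. i < m \<longrightarrow> k \<in> K \<and> z i = lmul k" using z(1) by blast
          from choice[OF this] obtain \<kappa> where \<kappa>: "\<And>i. i < m \<Longrightarrow> \<kappa> i \<in> K \<and> z i = lmul (\<kappa> i)" by blast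
          have "f = ?f (restrict \<kappa> {..<m})"
            unfolding z(2) using \<kappa> mc by (intro E.finsum_cong') auto
          then show "f \<in> ?f ` ({..<m} \<rightarrow>\<^sub>E K)" using \<kappa> by (intro image_eqI[of _ _ "restrict \<kappa> {..<m}"]) auto
        qed
      qed
    qed
    then show ?thesis using bij_betw_same_card card_PiE[of "{..<m}" "\<lambda>_. K"] by fastforce
  qed
  show ?thesis using 1 2 by simp
qed

context skew_field
begin

text \<open>Evaluation of a polynomial whose coefficients, lowest first, stand to the right of the
  variable.\<close>

fun horner :: "'a list \<Rightarrow> 'a \<Rightarrow> 'a" where
  "horner [] t = \<zero>"
| "horner (c # cs) t = c \<oplus> t \<otimes> horner cs t"

text \<open>The quotient in the division of the polynomial by the variable minus \<open>k\<close>, by synthetic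
  division.\<close>

fun horner_quotient :: "'a \<Rightarrow> 'a list \<Rightarrow> 'a list" where
  "horner_quotient k [] = []"
| "horner_quotient k [c] = []"
| "horner_quotient k (c # d # cs) = horner (d # cs) k # horner_quotient k (d # cs)"

lemma horner_closed: "set cs \<subseteq> carrier R \<Longrightarrow> t \<in> carrier R \<Longrightarrow> horner cs t \<in> carrier R"
  by (induction cs) auto

lemma horner_quotient_closed:
  "set cs \<subseteq> carrier R \<Longrightarrow> k \<in> carrier R \<Longrightarrow> set (horner_quotient k cs) \<subseteq> carrier R"
  by (induction k cs rule: horner_quotient.induct) (auto simp: horner_closed)

lemma horner_quotient_length: "length (horner_quotient k cs) = length cs - 1"
  by (induction k cs rule: horner_quotient.induct) auto

lemma horner_division:
  assumes "set cs \<subseteq> carrier R" "t \<in> carrier R" "k \<in> carrier R" "t \<otimes> k = k \<otimes> t"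
  shows "horner cs t = (t \<oplus> \<ominus> k) \<otimes> horner (horner_quotient k cs) t \<oplus> horner cs k"
  using assms
proof (induction k cs rule: horner_quotient.induct)
  case (3 k c d cs)
  define p where "p = horner (d # cs) t"
  define p0 where "p0 = horner (d # cs) k"
  define q where "q = horner (horner_quotient k (d # cs)) t"
  have cl: "p \<in> carrier R" "p0 \<in> carrier R" "q \<in> carrier R" "c \<in> carrier R" "t \<in> carrier R" "k \<in> carrier R"
  proof -
    have s: "set (d # cs) \<subseteq> carrier R" using 3(2) by simp
    show "p \<in> carrier R" "p0 \<in> carrier R" "q \<in> carrier R"
      unfolding p_def p0_def q_def
      by (rule horner_closed[OF s 3(3)] horner_closed[OF s 3(4)]
          horner_closed[OF horner_quotient_closed[OF s 3(4)] 3(3)])+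
    show "c \<in> carrier R" "t \<in> carrier R" "k \<in> carrier R" using 3 by auto
  qed
  have IH: "p = (t \<oplus> \<ominus> k) \<otimes> q \<oplus> p0" using 3 unfolding p_def p0_def q_def by simp
  have tk: "t \<otimes> (t \<oplus> \<ominus> k) = (t \<oplus> \<ominus> k) \<otimes> t" using cl 3(5) by (simp add: l_distr r_distr l_minus r_minus)
  have "t \<otimes> p = t \<otimes> ((t \<oplus> \<ominus> k) \<otimes> q) \<oplus> t \<otimes> p0" unfolding IH using cl by (simp add: r_distr)
  also have "t \<otimes> ((t \<oplus> \<ominus> k) \<otimes> q) = (t \<oplus> \<ominus> k) \<otimes> (t \<otimes> q)"
    using cl tk by (simp add: m_assoc[symmetric])
  also have "t \<otimes> p0 = (t \<oplus> \<ominus> k) \<otimes> p0 \<oplus> k \<otimes> p0"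
    using cl by (simp add: l_distr[symmetric] a_assoc l_neg)
  also have "(t \<oplus> \<ominus> k) \<otimes> (t \<otimes> q) \<oplus> ((t \<oplus> \<ominus> k) \<otimes> p0 \<oplus> k \<otimes> p0) = (t \<oplus> \<ominus> k) \<otimes> (p0 \<oplus> t \<otimes> q) \<oplus> k \<otimes> p0"
    using cl by (simp add: r_distr a_ac)
  finally have tp: "t \<otimes> p = (t \<oplus> \<ominus> k) \<otimes> (p0 \<oplus> t \<otimes> q) \<oplus> k \<otimes> p0" .
  have "c \<oplus> t \<otimes> p = (t \<oplus> \<ominus> k) \<otimes> (p0 \<oplus> t \<otimes> q) \<oplus> (c \<oplus> k \<otimes> p0)"
    unfolding tp using cl by (simp add: a_ac)
  moreover have "horner (horner_quotient k (c # d # cs)) t = p0 \<oplus> t \<otimes> q"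
    unfolding p0_def q_def by simp
  moreover have "horner (c # d # cs) t = c \<oplus> t \<otimes> p" "horner (c # d # cs) k = c \<oplus> k \<otimes> p0"
    unfolding p_def p0_def by (rule horner.simps(2))+
  ultimately show ?case by (simp only:)
qed simp_all

lemma horner_quotient_zero:
  "set cs \<subseteq> carrier R \<Longrightarrow> k \<in> carrier R \<Longrightarrow> set (horner_quotient k cs) \<subseteq> {\<zero>} \<Longrightarrow> horner cs k = \<zero> \<Longrightarrow>
   set cs \<subseteq> {\<zero>}"
proof (induction k cs rule: horner_quotient.induct)
  case (3 k c d cs)
  have h: "horner (d # cs) k = \<zero>" using 3(4) by simp
  have "set (d # cs) \<subseteq> {\<zero>}" using 3 h by simp
  moreover have "horner (c # d # cs) k = c \<oplus> k \<otimes> horner (d # cs) k" by (rule horner.simps(2))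
  then have "c = \<zero>" using 3(2,3,5) unfolding h by simp
  ultimately show ?case by simp
qed simp_all

text \<open>A polynomial over a division ring can have many roots, but not many that commute with each
  other: for commuting \<open>t\<close> and \<open>k\<close> division with remainder is compatible with evaluation.\<close>

lemma horner_roots:
  assumes "finite A" "A \<subseteq> carrier R" "\<And>x y. x \<in> A \<Longrightarrow> y \<in> A \<Longrightarrow> x \<otimes> y = y \<otimes> x"
    "set cs \<subseteq> carrier R" "length cs \<le> card A" "\<And>k. k \<in> A \<Longrightarrow> horner cs k = \<zero>"
  shows "set cs \<subseteq> {\<zero>}"
  using assms
proof (induction "length cs" arbitrary: cs A)
  case (Suc l)
  have "A \<noteq> {}" using Suc by auto
  then obtain k where k: "k \<in> A" by blast
  let ?A = "A - {k}" and ?q = "horner_quotient k cs"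
  have kc: "k \<in> carrier R" using k Suc.prems(2) by blast
  have qc: "set ?q \<subseteq> carrier R" by (rule horner_quotient_closed[OF Suc.prems(4) kc])
  have "set ?q \<subseteq> {\<zero>}"
  proof (rule Suc.hyps(1)[of ?q ?A])
    show "l = length ?q" using Suc.hyps(2) by (simp add: horner_quotient_length)
    show "length ?q \<le> card ?A" using Suc.prems(1,5) k by (simp add: horner_quotient_length)
    show "x \<otimes> y = y \<otimes> x" if "x \<in> ?A" "y \<in> ?A" for x y using Suc.prems(3) that by simp
    show "horner ?q t = \<zero>" if t: "t \<in> ?A" for t
    proof (rule ccontr)
      assume nz: "horner ?q t \<noteq> \<zero>"
      have tc: "t \<in> carrier R" "t \<noteq> k" using t Suc.prems(2) by auto
      have "(t \<oplus> \<ominus> k) \<otimes> horner ?q t \<oplus> horner cs k = \<zero>"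
        using horner_division[OF Suc.prems(4) tc(1) kc Suc.prems(3)] t k Suc.prems(6)[of t] by simp
      then have "(t \<oplus> \<ominus> k) \<otimes> horner ?q t = \<zero>"
        using Suc.prems(6)[OF k] horner_closed[OF qc tc(1)] tc(1) kc by simp
      moreover have "t \<oplus> \<ominus> k \<noteq> \<zero>" using eq_of_minus_zero[OF tc(1) kc] tc(2) by blast
      ultimately show False using nonzero_mult[OF _ horner_closed[OF qc tc(1)] _ nz] tc(1) kc by simp
    qed
  qed (use Suc.prems qc in auto)
  then show ?case by (rule horner_quotient_zero[OF Suc.prems(4) kc _ Suc.prems(6)[OF k]])
qed simp

text \<open>For \<open>k \<in> K\<close> and \<open>N = |K| - 1\<close> put \<open>x = b^(N-1) + k b^(N-2) + \<dots> + k^(N-1)\<close>. Then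
  \<open>k x + b^N = x b + k^N\<close>, so \<open>x\<close> satisfies the equation as soon as it is nonzero. As a
  polynomial in \<open>k\<close> of degree less than \<open>N\<close> it cannot vanish at all \<open>N\<close> nonzero elements of \<open>K\<close>.\<close>

lemma exists_eigenvector:
  assumes K: "subfield K R" "finite K" and b: "b \<in> carrier R" "b [^] (card K - 1) = \<one>"
    and Kp: "\<And>k. k \<in> K \<Longrightarrow> k \<noteq> \<zero> \<Longrightarrow> k [^] (card K - 1) = \<one>"
  shows "\<exists>x k. x \<in> carrier R \<and> x \<noteq> \<zero> \<and> k \<in> K \<and> k \<noteq> \<zero> \<and> x \<otimes> b = k \<otimes> x"
proof -
  note KE = subringE[OF subfieldE(1)[OF K(1)]]
  define bs where "bs N = map (\<lambda>i. b [^] i) (rev [0..<N])" for N :: nat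
  have bs_Suc: "bs (Suc N) = b [^] N # bs N" for N unfolding bs_def by simp
  have bsc: "set (bs N) \<subseteq> carrier R" for N unfolding bs_def using b(1) by auto
  have tele: "k \<otimes> horner (bs N) k \<oplus> b [^] N = horner (bs N) k \<otimes> b \<oplus> k [^] N" if k: "k \<in> carrier R" for N k
  proof (induction N)
    case 0
    then show ?case using k b by (simp add: bs_def)
  next
    case (Suc N)
    define y where "y = horner (bs N) k"
    have c: "y \<in> carrier R" "b [^] N \<in> carrier R" "k [^] N \<in> carrier R"
      unfolding y_def using horner_closed[OF bsc k] b(1) k by auto
    have y': "horner (bs (Suc N)) k = b [^] N \<oplus> k \<otimes> y" unfolding bs_Suc y_def by simp
    have IH: "k \<otimes> y \<oplus> b [^] N = y \<otimes> b \<oplus> k [^] N" using Suc unfolding y_def .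
    have "k \<otimes> (b [^] N \<oplus> k \<otimes> y) \<oplus> b [^] Suc N = k \<otimes> (k \<otimes> y \<oplus> b [^] N) \<oplus> b [^] N \<otimes> b"
      using c k b(1) by (simp add: a_comm)
    also have "\<dots> = k \<otimes> (y \<otimes> b) \<oplus> k \<otimes> k [^] N \<oplus> b [^] N \<otimes> b"
      unfolding IH using c k b(1) by (simp add: r_distr)
    also have "k \<otimes> k [^] N = k [^] Suc N" using nat_pow_Suc2[OF k] by simp
    also have "k \<otimes> (y \<otimes> b) \<oplus> k [^] Suc N \<oplus> b [^] N \<otimes> b = (b [^] N \<oplus> k \<otimes> y) \<otimes> b \<oplus> k [^] Suc N"
      using c k b(1) nat_pow_closed[OF k, of "Suc N"] by (simp add: l_distr m_assoc a_ac del: nat_pow_Suc)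
    finally show ?case unfolding y' .
  qed
  define N where "N = card K - 1"
  let ?A = "K - {\<zero>}"
  have cA: "card ?A = N" unfolding N_def using K(2) KE(2) by simp
  have "?A \<noteq> {}" using KE(3) by auto
  then have N: "N \<noteq> 0" using cA K(2) by auto
  have "\<exists>k\<in>?A. horner (bs N) k \<noteq> \<zero>"
  proof (rule ccontr)
    assume none: "\<not> ?thesis"
    have "set (bs N) \<subseteq> {\<zero>}"
    proof (rule horner_roots[of ?A])
      show "x \<otimes> y = y \<otimes> x" if "x \<in> ?A" "y \<in> ?A" for x y
        using subcring.sub_m_comm[OF subdomain.axioms(1)[OF subfield.axioms(1)[OF K(1)]]] that by blast
      show "length (bs N) \<le> card ?A" unfolding cA by (simp add: bs_def)
    qed (use K(2) KE(1) bsc none in auto)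
    moreover have "b [^] (0::nat) \<in> set (bs N)" unfolding bs_def using N by force
    ultimately show False by auto
  qed
  then obtain k where k: "k \<in> K" "k \<noteq> \<zero>" "horner (bs N) k \<noteq> \<zero>" by blast
  have kc: "k \<in> carrier R" using k(1) KE(1) by blast
  note xc = horner_closed[OF bsc[of N] kc]
  have "k \<otimes> horner (bs N) k \<oplus> \<one> = horner (bs N) k \<otimes> b \<oplus> \<one>"
    using tele[OF kc, of N] b(2) Kp[OF k(1,2)] unfolding N_def by simp
  then have "k \<otimes> horner (bs N) k = horner (bs N) k \<otimes> b"
    using xc kc b(1) add.r_cancel by simp
  then show ?thesis using xc k by (intro exI[of _ "horner (bs N) k"] exI[of _ k]) simp
qed

lemma subfield_pow_card:
  assumes K: "subfield K R" "finite K" and k: "k \<in> K" "k \<noteq> \<zero>"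
  shows "k [^] (card K - 1) = \<one>"
proof -
  interpret L: field "R\<lparr>carrier := K\<rparr>" using subfield_iff(2)[OF K(1)] .
  interpret G: group "Multiplicative_Group.mult_of (R\<lparr>carrier := K\<rparr>)" by (rule L.field_mult_group)
  have "k [^]\<^bsub>Multiplicative_Group.mult_of (R\<lparr>carrier := K\<rparr>)\<^esub> order (Multiplicative_Group.mult_of (R\<lparr>carrier := K\<rparr>)) = \<one>\<^bsub>Multiplicative_Group.mult_of (R\<lparr>carrier := K\<rparr>)\<^esub>"
    using k by (intro G.pow_order_eq_1) simp
  moreover have "order (Multiplicative_Group.mult_of (R\<lparr>carrier := K\<rparr>)) = card K - 1"
    using L.zero_closed by (simp add: order_def)
  moreover have "k [^]\<^bsub>Multiplicative_Group.mult_of (R\<lparr>carrier := K\<rparr>)\<^esub> (j::nat) = k [^] j" for j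
    by (induction j) simp_all
  ultimately show ?thesis by simp
qed

text \<open>Wedderburn's little theorem. If \<open>K\<close> is a maximal commutative subset, \<open>n\<close> the dimension over
  \<open>K\<close> and \<open>m\<close> the dimension over the center, then \<open>card_endos\<close> gives
  \<open>|K|^m = |D|^n = |K|^(n n)\<close>, so \<open>m = n n\<close>, and \<open>|D| = |K|^n\<close> shows that all maximal
  commutative subsets have the same size. Every \<open>b \<noteq> \<zero>\<close> lies in one of them, so it satisfies
  \<open>b^(|K| - 1) = \<one>\<close> and by \<open>exists_eigenvector\<close> it is conjugate into \<open>K\<close>: \<open>x b = k x\<close>. Now
  count. Choose such \<open>x\<close> and \<open>k\<close> for every \<open>b\<close>. For \<open>b \<noteq> \<one>\<close> and \<open>p \<in> K\<close> nonzero, the pair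
  \<open>(p x, k)\<close> determines \<open>b\<close> and \<open>p\<close>, because \<open>p x b = k p x\<close>, and \<open>k \<noteq> \<one>\<close>. Hence
  \<open>(|D| - 2) (|K| - 1) \<le> (|D| - 1) (|K| - 2)\<close>, which forces \<open>|D| \<le> |K|\<close>.\<close>

lemma finite_skew_field_commutative:
  assumes fin: "finite (carrier R)"
  shows "ring_center R = carrier R"
proof -
  let ?F = "ring_center R"
  have finS: "finite S" if "S \<subseteq> carrier R" for S using fin that finite_subset by blast
  obtain N and d0 :: "nat \<Rightarrow> 'a" where "carrier R = d0 ` {i. i < N}"
    using finite_imp_nat_seg_image_inj_on[OF fin] by blast
  then have d0: "d0 ` {..<N} = carrier R" by (simp add: lessThan_def)
  have d0c: "d0 i \<in> carrier R" if "i < N" for i using d0 that by blast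
  have d0s: "left_spanning {..<N} d0 ?F"
    unfolding left_spanning_def
  proof
    note FE = subringE[OF subfieldE(1)[OF center_subfield]]
    fix x assume "x \<in> carrier R"
    then obtain j where j: "j < N" "x = d0 j" using d0 by blast
    have "(\<Oplus>i\<in>{..<N}. (if i = j then \<one> else \<zero>) \<otimes> d0 i) = (\<Oplus>i\<in>{..<N}. if j = i then d0 i else \<zero>)"
      using d0c by (intro finsum_cong') auto
    also have "\<dots> = x" unfolding j(2) using j(1) d0c by (intro finsum_singleton) auto
    finally show "\<exists>u. (\<forall>i\<in>{..<N}. u i \<in> ?F) \<and> x = (\<Oplus>i\<in>{..<N}. u i \<otimes> d0 i)"
      using FE(2,3) by (intro exI[of _ "\<lambda>i. if i = j then \<one> else \<zero>"]) auto
  qed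
  obtain m and d :: "nat \<Rightarrow> 'a" where d: "\<And>i. i < m \<Longrightarrow> d i \<in> carrier R"
    "left_spanning {..<m} d ?F" "left_independent {..<m} d ?F"
    using exists_enumerated_basis[of ?F N d0] center_subfield d0c d0s by blast
  have size: "\<exists>n. m = n * n \<and> n \<noteq> 0 \<and> card (carrier R) = card K ^ n" if K: "centralizer K = K" for K
  proof -
    have Kf: "subfield K R" by (rule self_centralizing_subfield[OF K])
    note KE = subringE[OF subfieldE(1)[OF Kf]]
    have FK: "?F \<subseteq> K" using centralizer_anti[OF KE(1)] unfolding K center_eq_centralizer .
    obtain n and e :: "nat \<Rightarrow> 'a" where e: "\<And>i. i < n \<Longrightarrow> e i \<in> carrier R"
      "left_spanning {..<n} e K" "left_independent {..<n} e K"
      using exists_enumerated_basis[of K N d0] Kf d0c left_spanning_mono[OF d0s FK] by blast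
    interpret splitting R K n e
      by unfold_locales (use K e in auto)
    have c: "card (carrier R) = card K ^ n" by (rule card_carrier_basis[OF Kf e])
    have "{\<zero>, \<one>} \<subseteq> K" using KE(2,3) by simp
    from card_mono[OF finS[OF KE(1)] this] have K2: "1 < card K" using one_not_zero by simp
    have "card K ^ m = card K ^ (n * n)" using card_endos[OF d] unfolding c by (simp add: power_mult)
    then have "m = n * n" using K2 by simp
    moreover have "n \<noteq> 0"
    proof
      assume "n = 0"
      then have "card (carrier R) = 1" using c by simp
      moreover have "card K \<le> card (carrier R)" by (rule card_mono[OF fin KE(1)])
      ultimately show False using K2 by simp
    qed
    ultimately show ?thesis using c by blast
  qed
  obtain K where K: "centralizer K = K" using exists_self_centralizing[of "{}"] by auto
  have Kf: "subfield K R" by (rule self_centralizing_subfield[OF K])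
  note KE = subringE[OF subfieldE(1)[OF Kf]]
  have Kcomm: "k \<otimes> l = l \<otimes> k" if "k \<in> K" "l \<in> K" for k l
    using subcring.sub_m_comm[OF subdomain.axioms(1)[OF subfield.axioms(1)[OF Kf]] that] .
  have fK: "finite K" by (rule finS[OF KE(1)])
  have conj: "\<exists>x k. x \<in> carrier R \<and> x \<noteq> \<zero> \<and> k \<in> K \<and> k \<noteq> \<zero> \<and> x \<otimes> b = k \<otimes> x"
    if b: "b \<in> carrier R" "b \<noteq> \<zero>" for b
  proof -
    obtain K' where K': "b \<in> K'" "centralizer K' = K'"
      using exists_self_centralizing[of "{b}"] b(1) by auto
    have Kf': "subfield K' R" by (rule self_centralizing_subfield[OF K'(2)])
    obtain n where n: "m = n * n" "n \<noteq> 0" "card (carrier R) = card K ^ n" using size[OF K] by blast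
    obtain n' where n': "m = n' * n'" "n' \<noteq> 0" "card (carrier R) = card K' ^ n'" using size[OF K'(2)] by blast
    have "n = n'" using n(1) n'(1) power2_eq_iff_nonneg[of n n'] unfolding power2_eq_square by simp
    then have "card K ^ n = card K' ^ n" using n(3) n'(3) by simp
    then have "card K = card K'" using n(2) by (simp add: power_eq_iff_eq_base)
    then have "b [^] (card K - 1) = \<one>"
      using subfield_pow_card[OF Kf' finS[OF subfieldE(3)[OF Kf']] K'(1) b(2)] by simp
    then show ?thesis
      by (rule exists_eigenvector[OF Kf fK b(1) _ subfield_pow_card[OF Kf fK]])
  qed
  let ?G = "carrier R - {\<zero>}" and ?P = "K - {\<zero>}"
  have "\<forall>b. \<exists>y. b \<in> ?G \<longrightarrow> fst y \<in> ?G \<and> snd y \<in> ?P \<and> fst y \<otimes> b = snd y \<otimes> fst y"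
    using conj by fastforce
  from choice[OF this] obtain y where y: "\<And>b. b \<in> ?G \<Longrightarrow> fst (y b) \<in> ?G \<and> snd (y b) \<in> ?P \<and>
      fst (y b) \<otimes> b = snd (y b) \<otimes> fst (y b)" by blast
  have cancel: "p = p'" if "p \<otimes> x = p' \<otimes> x" "x \<in> ?G" "p \<in> carrier R" "p' \<in> carrier R" for p p' x
  proof -
    have x: "x \<in> carrier R" "x \<noteq> \<zero>" using that(2) by auto
    note i = inv_nonzero[OF x]
    have "p = (p \<otimes> x) \<otimes> inv x" using x i that(3) by (simp add: m_assoc)
    also have "\<dots> = p'" unfolding that(1) using x i that(4) by (simp add: m_assoc)
    finally show ?thesis .
  qed
  have lcancel: "b = b'" if "x \<otimes> b = x \<otimes> b'" "x \<in> ?G" "b \<in> carrier R" "b' \<in> carrier R" for b b' x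
  proof -
    have x: "x \<in> carrier R" "x \<noteq> \<zero>" using that(2) by auto
    note i = inv_nonzero[OF x]
    have "b = inv x \<otimes> (x \<otimes> b)" using x i that(3) by (simp add: m_assoc[symmetric])
    also have "\<dots> = b'" unfolding that(1) using x i that(4) by (simp add: m_assoc[symmetric])
    finally show ?thesis .
  qed
  \<comment> \<open>The pairs \<open>(p x, k)\<close> with \<open>x b = k x\<close> determine \<open>b\<close> and \<open>p\<close>.\<close>
  let ?h = "\<lambda>(b, p). (p \<otimes> fst (y b), snd (y b))"
  have "inj_on ?h ((?G - {\<one>}) \<times> ?P)"
  proof (rule inj_onI)
    fix r r' assume r: "r \<in> (?G - {\<one>}) \<times> ?P" "r' \<in> (?G - {\<one>}) \<times> ?P" "?h r = ?h r'"
    obtain b p b' p' where rr: "r = (b, p)" "r' = (b', p')" by (cases r; cases r')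
    have b: "b \<in> carrier R" "b \<noteq> \<zero>" "b' \<in> carrier R" "b' \<noteq> \<zero>"
      and p: "p \<in> K" "p \<noteq> \<zero>" "p' \<in> K" "p' \<noteq> \<zero>"
      and e: "p \<otimes> fst (y b) = p' \<otimes> fst (y b')" "snd (y b) = snd (y b')"
      using r unfolding rr by auto
    have main: "(q \<otimes> fst (y c)) \<otimes> c = snd (y c) \<otimes> (q \<otimes> fst (y c))"
      if "c \<in> ?G" "q \<in> K" for c q
    proof -
      have yc: "fst (y c) \<in> carrier R" "snd (y c) \<in> K" "fst (y c) \<otimes> c = snd (y c) \<otimes> fst (y c)"
        using y[OF that(1)] by auto
      have cl: "q \<in> carrier R" "snd (y c) \<in> carrier R" "c \<in> carrier R" using that yc(2) KE(1) by auto
      have "(q \<otimes> fst (y c)) \<otimes> c = q \<otimes> (snd (y c) \<otimes> fst (y c))" using cl yc by (simp add: m_assoc)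
      also have "\<dots> = (q \<otimes> snd (y c)) \<otimes> fst (y c)" using cl yc by (simp add: m_assoc)
      also have "q \<otimes> snd (y c) = snd (y c) \<otimes> q" by (rule Kcomm[OF that(2) yc(2)])
      finally show ?thesis using cl yc by (simp add: m_assoc)
    qed
    have xG: "p \<otimes> fst (y b) \<in> ?G"
      using y[of b] b p KE(1) nonzero_mult[of p "fst (y b)"] by auto
    have "(p \<otimes> fst (y b)) \<otimes> b = (p \<otimes> fst (y b)) \<otimes> b'"
      using main[of b p] main[of b' p'] b p e by simp
    then have bb: "b = b'" by (rule lcancel[OF _ xG b(1,3)])
    have "p = p'"
      by (rule cancel[of p "fst (y b)" p']) (use e bb y[of b] b p KE(1) in auto)
    then show "r = r'" using bb rr by simp
  qed
  moreover have "?h ` ((?G - {\<one>}) \<times> ?P) \<subseteq> ?G \<times> (?P - {\<one>})"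
  proof (rule image_subsetI)
    fix r assume r: "r \<in> (?G - {\<one>}) \<times> ?P"
    obtain b p where rr: "r = (b, p)" by (cases r)
    have b: "b \<in> carrier R" "b \<noteq> \<zero>" "b \<noteq> \<one>" and p: "p \<in> K" "p \<noteq> \<zero>"
      using r unfolding rr by auto
    have yb: "fst (y b) \<in> carrier R" "fst (y b) \<noteq> \<zero>" "snd (y b) \<in> K" "snd (y b) \<noteq> \<zero>"
      "fst (y b) \<otimes> b = snd (y b) \<otimes> fst (y b)" using y[of b] b by auto
    have pc: "p \<in> carrier R" using p KE(1) by blast
    have h: "p \<otimes> fst (y b) \<in> carrier R" "p \<otimes> fst (y b) \<noteq> \<zero>"
      using pc yb(1) nonzero_mult[OF pc yb(1) p(2) yb(2)] by auto
    have "snd (y b) \<noteq> \<one>"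
    proof
      assume "snd (y b) = \<one>"
      then have "fst (y b) \<otimes> b = fst (y b) \<otimes> \<one>" using yb by simp
      then have "b = \<one>" by (rule lcancel) (use yb b in auto)
      then show False using b(3) by blast
    qed
    then show "?h r \<in> ?G \<times> (?P - {\<one>})" unfolding rr using h yb(3,4) by simp
  qed
  ultimately have "card ((?G - {\<one>}) \<times> ?P) \<le> card (?G \<times> (?P - {\<one>}))"
    using fin fK by (intro card_inj_on_le) auto
  then have le: "(card ?G - 1) * card ?P \<le> card ?G * (card ?P - 1)"
    using fin fK KE(3) by (simp add: card_cartesian_product)
  have "\<one> \<in> ?P" using KE(3) by simp
  then have P0: "0 < card ?P" using fK by (auto simp: card_gt_0_iff)
  have "card ?P \<le> card ?G" using fin KE(1) by (intro card_mono) auto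
  then obtain i j where ij: "card ?G = Suc i" "card ?P = Suc j" using P0 by (metis gr0_implies_Suc less_le_trans)
  have "card ?G \<le> card ?P" using le unfolding ij by (simp add: algebra_simps)
  then have "?P = ?G" using fin KE(1) by (intro card_seteq) auto
  then have "K = carrier R" using KE(1,2) by blast
  then show ?thesis using K center_eq_centralizer by simp
qed

end

section \<open>Words generating maximal subfields\<close>

theorem theorem4p3:
  fixes D :: "('a, 'b) ring_scheme" and F :: "'a set" and n :: nat and w :: gword
  assumes "skew_field D"
    and "F = ring_center D"
    and "ring.finite_dimension D F (carrier D)"
    and "w \<in> words n"
    and "nontrivial_word w"
  shows "\<exists>c. (\<forall>i \<in> {1..n}. c i \<in> carrier D - {\<zero>\<^bsub>D\<^esub>}) \<and>
             maximal_subfield (simple_extension_field D F (word_eval D c w)) D"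
proof -
  interpret skew_field D by (rule assms(1))
  have Ff: "subfield F D" unfolding assms(2) by (rule center_subfield)
  obtain k where "dimension k F (carrier D)" using assms(3) unfolding finite_dimension_def by blast
  then obtain Us where Us: "set Us \<subseteq> carrier D" "Span F Us = carrier D"
    using exists_base[OF Ff] by blast
  let ?d = "\<lambda>i. Us ! i" and ?N = "length Us"
  have d: "?d i \<in> carrier D" if "i < ?N" for i using Us(1) that by auto
  have sp: "left_spanning {..<?N} ?d F" by (rule left_spanning_of_Span[OF Ff Us])
  show ?thesis
  proof (cases "finite F")
    case False
    obtain K where K: "centralizer K = K" using exists_self_centralizing[of "{}"] by auto
    have Kf: "subfield K D" by (rule self_centralizing_subfield[OF K])
    have FK: "F \<subseteq> K"
      using centralizer_anti[OF subfieldE(3)[OF Kf]] unfolding K assms(2) center_eq_centralizer .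
    obtain m and e :: "nat \<Rightarrow> 'a" where e: "\<And>i. i < m \<Longrightarrow> e i \<in> carrier D"
      "left_spanning {..<m} e K" "left_independent {..<m} e K"
      using exists_enumerated_basis[of K ?N ?d] Kf d left_spanning_mono[OF sp FK] by blast
    interpret splitting D K m e
      by unfold_locales (use K e in auto)
    show ?thesis
      using word_generates_maximal_subfield[of ?N ?d w] False d sp assms(5)
      unfolding simple_extension_field_def assms(2) by blast
  next
    case True
    have "carrier D \<subseteq> (\<lambda>u. \<Oplus>\<^bsub>D\<^esub>i\<in>{..<?N}. u i \<otimes>\<^bsub>D\<^esub> ?d i) ` ({..<?N} \<rightarrow>\<^sub>E F)"
    proof
      fix x assume "x \<in> carrier D"
      then obtain u where u: "\<forall>i\<in>{..<?N}. u i \<in> F" "x = (\<Oplus>\<^bsub>D\<^esub>i\<in>{..<?N}. u i \<otimes>\<^bsub>D\<^esub> ?d i)"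
        using sp unfolding left_spanning_def by blast
      have "x = (\<Oplus>\<^bsub>D\<^esub>i\<in>{..<?N}. restrict u {..<?N} i \<otimes>\<^bsub>D\<^esub> ?d i)"
        unfolding u(2) using u(1) d subfieldE(3)[OF Ff] by (intro finsum_cong') auto
      then show "x \<in> (\<lambda>u. \<Oplus>\<^bsub>D\<^esub>i\<in>{..<?N}. u i \<otimes>\<^bsub>D\<^esub> ?d i) ` ({..<?N} \<rightarrow>\<^sub>E F)"
        using u(1) by (intro image_eqI[of _ _ "restrict u {..<?N}"]) auto
    qed
    then have "finite (carrier D)" using True by (meson finite_PiE finite_imageI finite_lessThan finite_subset)
    then have FD: "F = carrier D" unfolding assms(2) by (rule finite_skew_field_commutative)
    \<comment> \<open>The field generated is \<open>D\<close> whatever the values of the letters.\<close>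
    let ?c = "\<lambda>i::nat. \<one>\<^bsub>D\<^esub>"
    define x where "x = word_eval D ?c w"
    have "range ?c \<subseteq> Units D" by auto
    then have "x \<in> Units D"
      using group.word_eval_closed[OF units_group, of ?c w] word_eval_units_of[of ?c w]
      unfolding x_def by (simp add: units_of_carrier)
    then have S: "insert x F = carrier D" unfolding FD by auto
    have comm: "p \<otimes>\<^bsub>D\<^esub> q = q \<otimes>\<^bsub>D\<^esub> p" if "p \<in> carrier D" "q \<in> carrier D" for p q
    proof -
      have "p \<in> ring_center D" using that(1) FD assms(2) by simp
      then show ?thesis using that(2) by (simp add: ring_center_def)
    qed
    have Hf: "subfield (generate_field D (carrier D)) D" by (rule generate_field_subfield[OF order.refl comm])
    have "generate_field D (carrier D) = carrier D"
      using subfieldE(3)[OF Hf] generate_field.incl[of _ "carrier D" D] by (intro equalityI subsetI) auto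
    then have "maximal_subfield (simple_extension_field D F x) D"
      unfolding simple_extension_field_def S maximal_subfield_def using Hf by (auto dest: subfieldE(3))
    then show ?thesis unfolding x_def by (intro exI[of _ ?c]) simp
  qed
qed

end
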